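(* Let $\phi$ satisfy $(\phi_1)$–$(\phi_3)$, with $\ell$ as in $(\phi_3)$, and let $f:\Omega\times[0,\infty)\to\mathbb{R}$ be a Carathéodory function such that, for a.e. $x\in\Omega$, the map $t\mapsto f(x,t)/t^{\ell-1}$ is strictly decreasing on $(0,\infty)$. If $u_1,u_2\in W^{1,\Phi}(\Omega)$ are respectively a subsolution and a supersolution of the problem $$-\Delta_\Phi u=f(x,u)\ \text{in }\Omega,\qquad u>0\ \text{in }\Omega,\qquad u=0\ \text{on }\partial\Omega,$$ such that $u_1/u_2\in L^\infty(\Omega)$ and $u_1\le u_2$ on $\partial\Omega$, then $u_1\le u_2$ a.e. in $\Omega$.
   Context: $\Omega\subset\mathbb{R}^N$ is a bounded domain with smooth boundary. The function $\phi:(0,\infty)\to(0,\infty)$ is $C^1$, and the hypotheses are: $(\phi_1)$ $s\phi(s)\to0$ as $s\to0$ and $s\phi(s)\to\infty$ as $s\to\infty$; $(\phi_2)$ $s\mapsto s\phi(s)$ is strictly increasing in $(0,\infty)$; $(\phi_3)$ there exist $\ell,m\in(1,N)$ such that $\ell-1\le \frac{(s\phi(s))'}{\phi(s)}\le m-1$ for all $s>0$. $\Phi(t)=\int_0^t s\phi(|s|)\,ds$, $t\in\mathbb{R}$. $L_\Phi(\Omega)$ is the Orlicz space with Luxemburg norm $\|u\|_\Phi=\inf\{\lambda>0:\int_\Omega\Phi(u/\lambda)\,dx\le1\}$. $W^{1,\Phi}(\Omega)$ is the Orlicz–Sobolev space with norm $\|u\|_{\Phi}+\sum_{i=1}^N\|\partial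 u/\partial x_i\|_\Phi$, and $W^{1,\Phi}_0(\Omega)$ is the closure of $C_0^\infty(\Omega)$ in it. $-\Delta_\Phi u$ denotes the operator $\langle-\Delta_\Phi u,w\rangle=\int_\Omega\phi(|\nabla u|)\nabla u\cdot\nabla w\,dx$. A function $u\in W^{1,\Phi}(\Omega)$ with $u>0$ a.e. in $\Omega$ is a subsolution (respectively supersolution) of the problem if $$\int_\Omega\phi(|\nabla u|)\nabla u\cdot\nabla\varphi\,dx\le(\text{resp. }\ge)\int_\Omega f(x,u)\varphi\,dx\quad\text{for all }\varphi\in W_0^{1,\Phi}(\Omega),\ \varphi\ge0,$$ the integrals on the right being understood to exist. No boundary condition is imposed on sub- or supersolutions by this definition. "$u_1\le u_2$ on $\partial\Omega$" is meant in the sense that $(u_1-u_2)^+\in W_0^{1,\Phi}(\Omega)$. *)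

theory Defs
  imports "HOL-Analysis.Analysis"
begin

section \<open>Smooth functions and smooth bounded domains\<close>

text \<open>The underlying space $R^N$ is a Euclidean space of type \<open>'a\<close>, with
  \<open>N = DIM('a)\<close> and orthonormal basis \<open>Basis\<close>.\<close>

definition pderiv_dir :: "'a::euclidean_space \<Rightarrow> ('a \<Rightarrow> real) \<Rightarrow> 'a \<Rightarrow> real" where
  "pderiv_dir i g x = frechet_derivative g (at x) i"

primrec Ck_on :: "nat \<Rightarrow> 'a::euclidean_space set \<Rightarrow> ('a \<Rightarrow> real) \<Rightarrow> bool" where
  "Ck_on 0 S g \<longleftrightarrow> continuous_on S g"
| "Ck_on (Suc k) S g \<longleftrightarrow>
     (\<forall>x\<in>S. g differentiable (at x)) \<and> (\<forall>i\<in>Basis. Ck_on k S (pderiv_dir i g))"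

text \<open>Only meaningful for open \<open>S\<close>, since it uses the two-sided derivative at each point.\<close>

definition Cinf_on :: "'a::euclidean_space set \<Rightarrow> ('a \<Rightarrow> real) \<Rightarrow> bool" where
  "Cinf_on S g \<longleftrightarrow> (\<forall>k. Ck_on k S g)"

text \<open>Near each boundary point, the domain is the negative set of a smooth function
  with nonvanishing gradient (so that the boundary is locally the zero set of that function,
  and the domain lies on one side of it).\<close>

definition smooth_boundary :: "'a::euclidean_space set \<Rightarrow> bool" where
  "smooth_boundary \<Omega> \<longleftrightarrow>
     (\<forall>p\<in>frontier \<Omega>. \<exists>U g. open U \<and> p \<in> U \<and> Cinf_on U g \<and>
        (\<forall>x\<in>U. \<exists>i\<in>Basis. pderiv_dir i g x \<noteq> 0) \<and>
        \<Omega> \<inter> U = {x\<in>U. g x < 0})"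

definition smooth_bounded_domain :: "'a::euclidean_space set \<Rightarrow> bool" where
  "smooth_bounded_domain \<Omega> \<longleftrightarrow>
     open \<Omega> \<and> connected \<Omega> \<and> \<Omega> \<noteq> {} \<and> bounded \<Omega> \<and> smooth_boundary \<Omega>"

text \<open>The space $C_0^\infty(\Omega)$; its elements are extended by zero to the whole space.\<close>

definition test_functions :: "'a::euclidean_space set \<Rightarrow> ('a \<Rightarrow> real) set" where
  "test_functions \<Omega> =
     {\<psi>. Cinf_on UNIV \<psi> \<and> compact (closure {x. \<psi> x \<noteq> 0}) \<and> closure {x. \<psi> x \<noteq> 0} \<subseteq> \<Omega>}"

section \<open>Weak derivatives\<close>

definition locally_integrable :: "'a::euclidean_space set \<Rightarrow> ('a \<Rightarrow> real) \<Rightarrow> bool" where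
  "locally_integrable \<Omega> u \<longleftrightarrow> (\<forall>K. compact K \<longrightarrow> K \<subseteq> \<Omega> \<longrightarrow> integrable (lebesgue_on K) u)"

definition has_weak_grad :: "'a::euclidean_space set \<Rightarrow> ('a \<Rightarrow> real) \<Rightarrow> ('a \<Rightarrow> 'a) \<Rightarrow> bool" where
  "has_weak_grad \<Omega> u G \<longleftrightarrow>
     locally_integrable \<Omega> u \<and>
     (\<forall>i\<in>Basis. locally_integrable \<Omega> (\<lambda>x. G x \<bullet> i) \<and>
        (\<forall>\<psi>\<in>test_functions \<Omega>.
           (\<integral>x. u x * pderiv_dir i \<psi> x \<partial>lebesgue_on \<Omega>)
             = - (\<integral>x. (G x \<bullet> i) * \<psi> x \<partial>lebesgue_on \<Omega>)))"

text \<open>A representative of the weak gradient, which is unique up to null sets.\<close>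

definition weak_grad :: "'a::euclidean_space set \<Rightarrow> ('a \<Rightarrow> real) \<Rightarrow> 'a \<Rightarrow> 'a" where
  "weak_grad \<Omega> u = (SOME G. has_weak_grad \<Omega> u G)"

section \<open>Orlicz and Orlicz--Sobolev spaces\<close>

text \<open>Elements of the function spaces are representatives: real functions on the whole
  type, of which only the restriction to \<open>\<Omega>\<close> up to null sets matters.
  Values of \<open>\<phi>\<close> at nonpositive arguments are irrelevant: \<open>\<phi> 0\<close> always occurs with a factor 0.\<close>

definition Phi :: "(real \<Rightarrow> real) \<Rightarrow> real \<Rightarrow> real" where
  "Phi \<phi> t = (LBINT s=0..t. s * \<phi> \<bar>s\<bar>)"

text \<open>The modular is a nonnegative (extended real valued) integral, as \<open>Phi \<phi> \<ge> 0\<close>.\<close>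

definition modular :: "(real \<Rightarrow> real) \<Rightarrow> 'a::euclidean_space set \<Rightarrow> ('a \<Rightarrow> real) \<Rightarrow> ennreal" where
  "modular \<phi> \<Omega> u = (\<integral>\<^sup>+x. ennreal (Phi \<phi> (u x)) \<partial>lebesgue_on \<Omega>)"

definition Orlicz :: "(real \<Rightarrow> real) \<Rightarrow> 'a::euclidean_space set \<Rightarrow> ('a \<Rightarrow> real) set" where
  "Orlicz \<phi> \<Omega> =
     {u \<in> borel_measurable (lebesgue_on \<Omega>). \<exists>c>0. modular \<phi> \<Omega> (\<lambda>x. u x / c) < \<infinity>}"

definition luxemburg_norm :: "(real \<Rightarrow> real) \<Rightarrow> 'a::euclidean_space set \<Rightarrow> ('a \<Rightarrow> real) \<Rightarrow> real" where
  "luxemburg_norm \<phi> \<Omega> u = Inf {c. c > 0 \<and> modular \<phi> \<Omega> (\<lambda>x. u x / c) \<le> 1}"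

definition W1 :: "(real \<Rightarrow> real) \<Rightarrow> 'a::euclidean_space set \<Rightarrow> ('a \<Rightarrow> real) set" where
  "W1 \<phi> \<Omega> = {u \<in> Orlicz \<phi> \<Omega>.
     \<exists>G. has_weak_grad \<Omega> u G \<and> (\<forall>i\<in>Basis. (\<lambda>x. G x \<bullet> i) \<in> Orlicz \<phi> \<Omega>)}"

definition W1_norm :: "(real \<Rightarrow> real) \<Rightarrow> 'a::euclidean_space set \<Rightarrow> ('a \<Rightarrow> real) \<Rightarrow> real" where
  "W1_norm \<phi> \<Omega> u =
     luxemburg_norm \<phi> \<Omega> u + (\<Sum>i\<in>Basis. luxemburg_norm \<phi> \<Omega> (\<lambda>x. weak_grad \<Omega> u x \<bullet> i))"

definition W10 :: "(real \<Rightarrow> real) \<Rightarrow> 'a::euclidean_space set \<Rightarrow> ('a \<Rightarrow> real) set" where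
  "W10 \<phi> \<Omega> = {u \<in> W1 \<phi> \<Omega>.
     \<forall>\<epsilon>>0. \<exists>\<psi>\<in>test_functions \<Omega>. W1_norm \<phi> \<Omega> (\<lambda>x. u x - \<psi> x) < \<epsilon>}"

definition Linf :: "'a::euclidean_space set \<Rightarrow> ('a \<Rightarrow> real) set" where
  "Linf \<Omega> = {u \<in> borel_measurable (lebesgue_on \<Omega>). \<exists>C. AE x in lebesgue_on \<Omega>. \<bar>u x\<bar> \<le> C}"

section \<open>Sub- and supersolutions\<close>

definition Caratheodory :: "'a::euclidean_space set \<Rightarrow> ('a \<Rightarrow> real \<Rightarrow> real) \<Rightarrow> bool" where
  "Caratheodory \<Omega> f \<longleftrightarrow>
     (\<forall>t\<ge>0. (\<lambda>x. f x t) \<in> borel_measurable (lebesgue_on \<Omega>)) \<and>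
     (AE x in lebesgue_on \<Omega>. continuous_on {0..} (f x))"

definition Phi_Laplace :: "(real \<Rightarrow> real) \<Rightarrow> 'a::euclidean_space set \<Rightarrow> ('a \<Rightarrow> real) \<Rightarrow> ('a \<Rightarrow> real) \<Rightarrow> real"
  where "Phi_Laplace \<phi> \<Omega> u w =
    (\<integral>x. \<phi> (norm (weak_grad \<Omega> u x)) * (weak_grad \<Omega> u x \<bullet> weak_grad \<Omega> w x) \<partial>lebesgue_on \<Omega>)"

text \<open>\<open>Phi_Laplace \<phi> \<Omega> u w\<close> is the value of minus the \<open>\<Phi>\<close>-Laplacian of \<open>u\<close> at \<open>w\<close>. Under the
  growth condition on \<open>\<phi>\<close> its integrand is integrable for \<open>u\<close>, \<open>w\<close> in \<open>W1 \<phi> \<Omega>\<close>, by Young's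
  inequality. Existence of the integral on the right, in contrast, is part of the definitions
  below. No boundary condition is imposed.\<close>

definition subsolution ::
  "(real \<Rightarrow> real) \<Rightarrow> ('a::euclidean_space \<Rightarrow> real \<Rightarrow> real) \<Rightarrow> 'a set \<Rightarrow> ('a \<Rightarrow> real) \<Rightarrow> bool" where
  "subsolution \<phi> f \<Omega> u \<longleftrightarrow>
     u \<in> W1 \<phi> \<Omega> \<and> (AE x in lebesgue_on \<Omega>. u x > 0) \<and>
     (\<forall>w\<in>W10 \<phi> \<Omega>. (AE x in lebesgue_on \<Omega>. w x \<ge> 0) \<longrightarrow>
        integrable (lebesgue_on \<Omega>) (\<lambda>x. f x (u x) * w x) \<and>
        Phi_Laplace \<phi> \<Omega> u w \<le> (\<integral>x. f x (u x) * w x \<partial>lebesgue_on \<Omega>))"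

definition supersolution ::
  "(real \<Rightarrow> real) \<Rightarrow> ('a::euclidean_space \<Rightarrow> real \<Rightarrow> real) \<Rightarrow> 'a set \<Rightarrow> ('a \<Rightarrow> real) \<Rightarrow> bool" where
  "supersolution \<phi> f \<Omega> u \<longleftrightarrow>
     u \<in> W1 \<phi> \<Omega> \<and> (AE x in lebesgue_on \<Omega>. u x > 0) \<and>
     (\<forall>w\<in>W10 \<phi> \<Omega>. (AE x in lebesgue_on \<Omega>. w x \<ge> 0) \<longrightarrow>
        integrable (lebesgue_on \<Omega>) (\<lambda>x. f x (u x) * w x) \<and>
        Phi_Laplace \<phi> \<Omega> u w \<ge> (\<integral>x. f x (u x) * w x \<partial>lebesgue_on \<Omega>))"

definition le_on_boundary ::
  "(real \<Rightarrow> real) \<Rightarrow> 'a::euclidean_space set \<Rightarrow> ('a \<Rightarrow> real) \<Rightarrow> ('a \<Rightarrow> real) \<Rightarrow> bool" where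
  "le_on_boundary \<phi> \<Omega> u v \<longleftrightarrow> (\<lambda>x. max (u x - v x) 0) \<in> W10 \<phi> \<Omega>"

end

theory Submission
  imports Defs
begin

text \<open>Put $w_1 = (u_1^l - u_2^l)^+ / u_1^{l-1}$ and $w_2 = (u_1^l - u_2^l)^+ / u_2^{l-1}$. Since $u_1/u_2$ is
  bounded, both are nonnegative multiples of $(u_1 - u_2)^+$ with bounded factors, belong to $W_0^{1,\Phi}$, and may
  be used as test functions for $u_1$ and $u_2$, respectively. A pointwise inequality of Diaz-Saa type, which uses
  only that $\phi(s)/s^{l-2}$ is nondecreasing, shows that the difference of the left-hand sides is nonnegative,
  whereas the difference of the right-hand sides,
  $\int (f(x,u_1)/u_1^{l-1} - f(x,u_2)/u_2^{l-1}) (u_1^l - u_2^l)^+$, is negative unless $u_1 \le u_2$ a.e.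

  Membership in $W_0^{1,\Phi}$ follows by mollification: if $0 \le w \le L v$ with $v$ the limit of test functions
  $\psi_n$, then $w$ is the limit of the compactly supported functions $\min(w, L \psi_n^+)$, and the upper bound on
  $(s\phi(s))'/\phi(s)$ (the $\Delta_2$ condition) makes modular and norm convergence equivalent.\<close>

section \<open>Smooth functions with compact support\<close>

text \<open>In terms of \<open>a = u1\<close> and \<open>b = min u1 u2\<close> both test functions
  are positively homogeneous of degree 1, so their partial derivatives depend on the quotient
  \<open>a / b\<close> alone and are bounded on the cone \<open>b \<le> a \<le> K * b\<close>. This
  is how the bound on \<open>u1 / u2\<close> enters; it takes the place of a positive lower bound on
  \<open>u2\<close>, which need not exist. The obstacle is the vertex of the cone, where such
  functions are not differentiable. The chain rule is therefore proved relative to a closed convex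
  set, the kind of set that averaging by a mollifier preserves, and the cone is reached by a limit.
  The exponents are dictated by the signs: division by the power \<open>l - 1\<close> turns both
  right-hand sides into the quotient that is assumed to decrease, with the common weight
  \<open>u1 powr l - u2 powr l\<close> on the set \<open>u1 > u2\<close>. On the left, the same
  exponent is the growth rate for which Young's inequality lets the ratios \<open>a / b\<close> drop
  out, so that only lengths of gradients remain to be compared.\<close>

lemma pderiv_dir_eq:
  assumes "(g has_derivative D) (at x)"
  shows "pderiv_dir i g x = D i"
  using frechet_derivative_at[OF assms] by (simp add: pderiv_dir_def)

lemma Ck_on_Suc_imp: "Ck_on (Suc k) UNIV g \<Longrightarrow> Ck_on k UNIV g"
proof (induction k arbitrary: g)
  case 0
  then show ?case
    by (auto simp: continuous_on_eq_continuous_within intro!: differentiable_imp_continuous_within)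
next
  case (Suc k)
  then show ?case by (metis Ck_on.simps(2))
qed

lemma pderiv_dir_const: "pderiv_dir i (\<lambda>x. c) = (\<lambda>x. 0)"
  by (rule ext, subst pderiv_dir_eq[where D="\<lambda>_. 0"]) (auto intro!: derivative_eq_intros)

lemma pderiv_dir_add:
  assumes "f differentiable (at x)" "g differentiable (at x)"
  shows "pderiv_dir i (\<lambda>x. f x + g x) x = pderiv_dir i f x + pderiv_dir i g x"
proof -
  from assms obtain D E where "(f has_derivative D) (at x)" "(g has_derivative E) (at x)"
    by (auto simp: differentiable_def)
  then show ?thesis
    using pderiv_dir_eq[OF has_derivative_add[of f D "at x" g E]] by (simp add: pderiv_dir_eq)
qed

lemma pderiv_dir_mult:
  assumes "f differentiable (at x)" "g differentiable (at x)"
  shows "pderiv_dir i (\<lambda>x. f x * g x) x = f x * pderiv_dir i g x + pderiv_dir i f x * g x"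
proof -
  from assms obtain D E where "(f has_derivative D) (at x)" "(g has_derivative E) (at x)"
    by (auto simp: differentiable_def)
  then show ?thesis
    using pderiv_dir_eq[OF has_derivative_mult[of f D x UNIV g E]] by (simp add: pderiv_dir_eq)
qed

lemma Ck_on_const: "Ck_on k UNIV (\<lambda>x. c)"
  by (induction k arbitrary: c) (auto simp: pderiv_dir_const)

lemma Ck_on_add:
  "Ck_on k UNIV f \<Longrightarrow> Ck_on k UNIV g \<Longrightarrow> Ck_on k UNIV (\<lambda>x. f x + g x)"
proof (induction k arbitrary: f g)
  case (Suc k)
  then have "pderiv_dir i (\<lambda>x. f x + g x) = (\<lambda>x. pderiv_dir i f x + pderiv_dir i g x)" for i
    by (auto simp: pderiv_dir_add)
  then show ?case using Suc by auto
qed (auto intro: continuous_intros)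

lemma Ck_on_mult:
  "Ck_on k UNIV f \<Longrightarrow> Ck_on k UNIV g \<Longrightarrow> Ck_on k UNIV (\<lambda>x. f x * g x)"
proof (induction k arbitrary: f g)
  case (Suc k)
  then have "pderiv_dir i (\<lambda>x. f x * g x) = (\<lambda>x. f x * pderiv_dir i g x + pderiv_dir i f x * g x)" for i
    by (auto simp: pderiv_dir_mult)
  moreover have "Ck_on k UNIV f" "Ck_on k UNIV g" using Suc.prems Ck_on_Suc_imp by auto
  ultimately show ?case using Suc by (auto intro!: Ck_on_add)
qed (auto intro: continuous_intros)

lemma Ck_on_inner: "Ck_on k UNIV (\<lambda>x. x \<bullet> a)"
proof (cases k)
  case (Suc n)
  have "pderiv_dir i (\<lambda>x. x \<bullet> a) = (\<lambda>x. i \<bullet> a)" for i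
    by (rule ext, rule pderiv_dir_eq) (auto intro!: derivative_eq_intros)
  then show ?thesis unfolding Suc by (auto intro!: Ck_on_const exI derivative_eq_intros simp: differentiable_def)
qed (auto intro!: continuous_intros)

text \<open>The power in the denominator makes the family closed under differentiation up to linear
  combinations, so smoothness becomes an induction with \<open>k\<close> arbitrary.\<close>

definition flat_exp :: "nat \<Rightarrow> real \<Rightarrow> real" where
  "flat_exp k t = (if t > 0 then exp (- (1/t)) / t^k else 0)"

lemma flat_exp_nonneg: "flat_exp k t \<ge> 0"
  by (simp add: flat_exp_def)

lemma exp_ge_power_div_fact:
  fixes x :: real
  assumes "0 \<le> x" shows "x^n / fact n \<le> exp x"
proof -
  have "(\<Sum>k\<in>{n}. x^k /\<^sub>R fact k) \<le> (\<Sum>k. x^k /\<^sub>R fact k)"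
    using assms exp_converges[of x] by (intro sum_le_suminf) (auto simp: sums_iff)
  then show ?thesis by (simp add: exp_def divide_inverse mult.commute)
qed

text \<open>Flatness to every order at 0: one term of the exponential series at \<open>1/t\<close>,
  the one of order \<open>k + n\<close>, absorbs the pole \<open>t^k\<close> and still leaves
  \<open>t^n\<close>.\<close>

lemma flat_exp_le:
  assumes "t > 0" shows "flat_exp k t \<le> fact (k+n) * t^n"
proof -
  have "(1/t)^(k+n) / fact (k+n) \<le> exp (1/t)"
    using exp_ge_power_div_fact[of "1/t" "k+n"] assms by simp
  then have "exp (-(1/t)) \<le> fact (k+n) * t^(k+n)"
    using assms by (simp add: exp_minus field_simps)
  then show ?thesis using assms by (simp add: flat_exp_def field_simps power_add)
qed

lemma flat_exp_has_derivative:
  "(flat_exp k has_real_derivative (flat_exp (k+2) t - real k * flat_exp (k+1) t)) (at t)"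
proof -
  consider "t > 0" | "t < 0" | "t = 0" by linarith
  then show ?thesis
  proof cases
    case 1
    have "((\<lambda>t. exp (- (1/t)) / t^k) has_real_derivative (flat_exp (k+2) t - real k * flat_exp (k+1) t)) (at t)"
    proof -
      have "real k * t^(k - 1) = real k * t^k / t" using 1 by (cases k) auto
      then show ?thesis using 1
        by (auto intro!: derivative_eq_intros simp: flat_exp_def) (simp add: field_simps power2_eq_square power_add)
    qed
    then show ?thesis
      by (rule has_field_derivative_transform_within_open[where S="{0<..}"])
         (use 1 in \<open>auto simp: flat_exp_def\<close>)
  next
    case 2
    have "((\<lambda>t. 0) has_real_derivative (flat_exp (k+2) t - real k * flat_exp (k+1) t)) (at t)"
      using 2 by (auto simp: flat_exp_def)
    then show ?thesis
      by (rule has_field_derivative_transform_within_open[where S="{..<0}"])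
         (use 2 in \<open>auto simp: flat_exp_def\<close>)
  next
    case 3
    \<comment> \<open>\<open>flat_exp_le\<close> with exponent 2 leaves one factor \<open>h\<close>
      after the division; for negative \<open>h\<close> the quotient is 0.\<close>
    have "((\<lambda>h. flat_exp k h / h) \<longlongrightarrow> 0) (at 0)"
    proof (rule Lim_null_comparison[where g="\<lambda>h. fact (k+2) * \<bar>h\<bar>"])
      show "\<forall>\<^sub>F h in at 0. norm (flat_exp k h / h) \<le> fact (k+2) * \<bar>h\<bar>"
      proof (rule always_eventually, rule allI)
        fix h
        show "norm (flat_exp k h / h) \<le> fact (k+2) * \<bar>h\<bar>"
          using flat_exp_le[of h k 2] flat_exp_nonneg[of k h]
          by (cases "h > 0") (auto simp: divide_simps power2_eq_square mult.assoc, auto simp: flat_exp_def)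
      qed
    qed (auto intro!: tendsto_eq_intros)
    then show ?thesis using 3 by (simp add: DERIV_def flat_exp_def)
  qed
qed

text \<open>The inner function is a polynomial, so a derivative is again a sum of products of
  polynomials with members of the family, at larger \<open>k\<close>.\<close>

lemma Ck_on_flat_exp_comp:
  "Ck_on n UNIV (\<lambda>x::'a::euclidean_space. flat_exp k (c - x \<bullet> x))"
proof (induction n arbitrary: k)
  case 0
  have "continuous_on UNIV (flat_exp k)"
    using flat_exp_has_derivative
    by (meson DERIV_continuous continuous_at_imp_continuous_on)
  then show ?case by (auto intro!: continuous_intros continuous_on_compose2[of UNIV "flat_exp k"])
next
  case (Suc n)
  let ?D = "\<lambda>x. flat_exp (k+2) (c - x \<bullet> x) - real k * flat_exp (k+1) (c - x \<bullet> x)"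
  have d: "((\<lambda>x::'a. flat_exp k (c - x \<bullet> x)) has_derivative (\<lambda>h. ?D x * (- (2 * (x \<bullet> h))))) (at x)" for x
  proof -
    have "((\<lambda>x::'a. c - x \<bullet> x) has_derivative (\<lambda>h. - (2 * (x \<bullet> h)))) (at x)"
      by (auto intro!: derivative_eq_intros simp: inner_commute)
    from has_derivative_compose[OF this flat_exp_has_derivative[unfolded has_field_derivative_def, of k]]
    show ?thesis by simp
  qed
  have "pderiv_dir i (\<lambda>x::'a. flat_exp k (c - x \<bullet> x)) = (\<lambda>x. (flat_exp (k+2) (c - x \<bullet> x) + (- real k) * flat_exp (k+1) (c - x \<bullet> x)) * ((-2) * (x \<bullet> i)))" for i
    by (rule ext, subst pderiv_dir_eq[OF d]) simp
  moreover have "Ck_on n UNIV (\<lambda>x::'a. (flat_exp (k+2) (c - x \<bullet> x) + (- real k) * flat_exp (k+1) (c - x \<bullet> x)) * ((-2) * (x \<bullet> i)))" for i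
    by (intro Ck_on_mult Ck_on_add Ck_on_const Ck_on_inner Suc.IH)
  ultimately show ?case
    using d by (auto simp: differentiable_def simp del: mult_minus_left mult_minus_right)
qed

text \<open>The case \<open>s = -1\<close> serves the reflected kernel, that is,
  \<open>bump r (x - y)\<close> as a function of \<open>y\<close>.\<close>

lemma Ck_on_affine:
  assumes "s = 1 \<or> s = (-1::real)"
  shows "Ck_on k UNIV f \<Longrightarrow> Ck_on k UNIV (\<lambda>x. f (a + s *\<^sub>R x))"
proof (induction k arbitrary: f)
  case 0 then show ?case by (auto intro!: continuous_intros continuous_on_compose2[of UNIV f])
next
  case (Suc k)
  have d: "((\<lambda>x. f (a + s *\<^sub>R x)) has_derivative (\<lambda>h. frechet_derivative f (at (a + s *\<^sub>R x)) (s *\<^sub>R h))) (at x)" for x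
  proof -
    have "((\<lambda>x. a + s *\<^sub>R x) has_derivative (\<lambda>h. s *\<^sub>R h)) (at x)"
      by (auto intro!: derivative_eq_intros)
    moreover have "(f has_derivative frechet_derivative f (at (a + s *\<^sub>R x))) (at (a + s *\<^sub>R x))"
      using Suc.prems frechet_derivative_works by auto
    ultimately show ?thesis by (rule has_derivative_compose)
  qed
  have "pderiv_dir i (\<lambda>x. f (a + s *\<^sub>R x)) = (\<lambda>x. s * pderiv_dir i f (a + s *\<^sub>R x))" for i
  proof
    fix x
    have "linear (frechet_derivative f (at (a + s *\<^sub>R x)))"
      using Suc.prems by (auto intro: linear_frechet_derivative)
    then show "pderiv_dir i (\<lambda>x. f (a + s *\<^sub>R x)) x = s * pderiv_dir i f (a + s *\<^sub>R x)"
      by (simp add: pderiv_dir_eq[OF d] pderiv_dir_def linear_scale)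
  qed
  then show ?case using Suc d by (auto intro!: Ck_on_mult Ck_on_const simp: differentiable_def)
qed

lemma Cinf_on_differentiable: "Cinf_on UNIV f \<Longrightarrow> f differentiable (at x)"
  by (drule Cinf_on_def[THEN iffD1], drule spec[of _ 1]) simp

lemma Cinf_on_continuous: "Cinf_on UNIV f \<Longrightarrow> continuous_on S f"
  by (drule Cinf_on_def[THEN iffD1], drule spec[of _ 0]) (auto intro: continuous_on_subset)

lemma Cinf_on_pderiv_dir: "Cinf_on UNIV f \<Longrightarrow> i \<in> Basis \<Longrightarrow> Cinf_on UNIV (pderiv_dir i f)"
  unfolding Cinf_on_def by (metis Ck_on.simps(2))

lemma frechet_derivative_eq_sum:
  assumes "f differentiable (at x)"
  shows "frechet_derivative f (at x) h = (\<Sum>i\<in>Basis. (h \<bullet> i) * pderiv_dir i f x)"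
proof -
  interpret linear "frechet_derivative f (at x)" using assms by (rule linear_frechet_derivative)
  have "frechet_derivative f (at x) h = frechet_derivative f (at x) (\<Sum>i\<in>Basis. (h \<bullet> i) *\<^sub>R i)"
    by (simp add: euclidean_representation)
  also have "\<dots> = (\<Sum>i\<in>Basis. (h \<bullet> i) * pderiv_dir i f x)"
    by (simp add: sum scale pderiv_dir_def)
  finally show ?thesis .
qed

lemma pderiv_dir_zero_outside:
  fixes f :: "'a::euclidean_space \<Rightarrow> real"
  assumes "\<And>y. y \<notin> K \<Longrightarrow> f y = 0" "closed K" "x \<notin> K"
  shows "pderiv_dir i f x = 0"
proof -
  have "((\<lambda>_. 0) has_derivative (\<lambda>_. 0)) (at x)" by (rule has_derivative_const)
  then have "(f has_derivative (\<lambda>_. 0)) (at x)"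
    apply (rule has_derivative_transform_within_open[where s="-K"])
    using assms(2) apply (rule open_Compl)
    using assms(3) apply simp
    using assms(1) apply simp
    done
  then show ?thesis using pderiv_dir_eq by blast
qed

lemma continuous_compact_support_bounded:
  fixes f :: "'a::euclidean_space \<Rightarrow> real"
  assumes "continuous_on UNIV f" "compact K" "\<And>y. y \<notin> K \<Longrightarrow> f y = 0"
  obtains B where "B > 0" "\<And>x. \<bar>f x\<bar> \<le> B"
proof -
  have "compact (f ` K)"
    using assms by (intro compact_continuous_image) (auto intro: continuous_on_subset)
  then have "bounded (f ` K)" by (rule compact_imp_bounded)
  then obtain B where B: "B > 0" "\<And>x. x \<in> K \<Longrightarrow> \<bar>f x\<bar> \<le> B"
    unfolding bounded_pos by auto
  have "\<bar>f x\<bar> \<le> B" for x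
    using B assms(3)[of x] by (cases "x \<in> K") auto
  with B(1) show ?thesis by (rule that)
qed

lemma continuous_compact_support_integrable:
  fixes f :: "'a::euclidean_space \<Rightarrow> real"
  assumes "continuous_on UNIV f" "compact K" "\<And>y. y \<notin> K \<Longrightarrow> f y = 0"
  shows "integrable lborel f"
proof -
  have "integrable lborel (\<lambda>x. indicator K x *\<^sub>R f x)"
    using borel_integrable_compact[of K f] assms continuous_on_subset by blast
  moreover have "(\<lambda>x. indicator K x *\<^sub>R f x) = f" using assms(3) by (auto simp: indicator_def fun_eq_iff)
  ultimately show ?thesis by simp
qed

section \<open>Test functions: support, derivatives and bounds\<close>

lemma test_functions_support:
  assumes "\<psi> \<in> test_functions \<Omega>"
  shows "\<exists>K. compact K \<and> K \<subseteq> \<Omega> \<and> (\<forall>x. x \<notin> K \<longrightarrow> \<psi> x = 0)"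
  using assms closure_subset[of "{x. \<psi> x \<noteq> 0}"]
  by (intro exI[of _ "closure {x. \<psi> x \<noteq> 0}"]) (auto simp: test_functions_def)

lemma test_functionsI:
  assumes "Cinf_on UNIV \<psi>" "compact K" "K \<subseteq> \<Omega>" "\<And>x. x \<notin> K \<Longrightarrow> \<psi> x = 0"
  shows "\<psi> \<in> test_functions \<Omega>"
proof -
  have "closure {x. \<psi> x \<noteq> 0} \<subseteq> K"
    using assms by (intro closure_minimal) (auto intro: compact_imp_closed)
  moreover from this have "bounded (closure {x. \<psi> x \<noteq> 0})"
    using assms(2) bounded_subset compact_imp_bounded by blast
  ultimately show ?thesis using assms
    by (auto simp: test_functions_def compact_eq_bounded_closed)
qed

lemma test_functions_Cinf: "\<psi> \<in> test_functions \<Omega> \<Longrightarrow> Cinf_on UNIV \<psi>"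
  by (simp add: test_functions_def)

lemma test_functions_pderiv_dir:
  assumes "\<psi> \<in> test_functions \<Omega>" "i \<in> Basis"
  shows "pderiv_dir i \<psi> \<in> test_functions \<Omega>"
proof -
  obtain K where K: "compact K" "K \<subseteq> \<Omega>" "\<And>x. x \<notin> K \<Longrightarrow> \<psi> x = 0"
    using test_functions_support[OF assms(1)] by blast
  show ?thesis
    by (rule test_functionsI[of _ K])
      (use assms K in \<open>auto intro: Cinf_on_pderiv_dir test_functions_Cinf pderiv_dir_zero_outside compact_imp_closed\<close>)
qed

lemma test_functions_bounded:
  assumes "\<psi> \<in> test_functions \<Omega>"
  obtains B where "B > 0" "\<And>x. \<bar>\<psi> x\<bar> \<le> B"
proof -
  obtain K where "compact K" "\<And>x. x \<notin> K \<Longrightarrow> \<psi> x = 0"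
    using test_functions_support[OF assms] by blast
  then show thesis
    using continuous_compact_support_bounded[OF Cinf_on_continuous[OF test_functions_Cinf[OF assms]]] that
    by blast
qed

lemma test_functions_borel_measurable:
  assumes "\<psi> \<in> test_functions \<Omega>"
  shows "\<psi> \<in> borel_measurable (lebesgue_on S)"
  using borel_measurable_continuous_onI[OF Cinf_on_continuous[OF test_functions_Cinf[OF assms]]]
  by (intro measurable_restrict_space1) (simp add: measurable_completion)

text \<open>The standard mollifier of radius \<open>r\<close>, normalised for each \<open>r\<close>
  separately instead of rescaling one fixed bump.\<close>

definition bump :: "real \<Rightarrow> 'a::euclidean_space \<Rightarrow> real" where
  "bump r x = flat_exp 0 (r\<^sup>2 - x \<bullet> x) / (\<integral>x. flat_exp 0 (r\<^sup>2 - x \<bullet> x) \<partial>(lborel :: 'a measure))"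

lemma Cinf_on_flat_exp_comp: "Cinf_on UNIV (\<lambda>x::'a::euclidean_space. flat_exp k (c - x \<bullet> x))"
  by (simp add: Cinf_on_def Ck_on_flat_exp_comp)

lemma flat_exp_comp_eq_0:
  fixes x :: "'a::euclidean_space" assumes "x \<notin> cball 0 r" "r > 0" shows "flat_exp k (r\<^sup>2 - x \<bullet> x) = 0"
proof -
  have "r\<^sup>2 \<le> (norm x)\<^sup>2" using assms by (intro power_mono) auto
  then show ?thesis by (simp add: flat_exp_def power2_norm_eq_inner)
qed

lemma flat_exp_comp_integrable:
  assumes "r > 0" shows "integrable lborel (\<lambda>x::'a::euclidean_space. flat_exp k (r\<^sup>2 - x \<bullet> x))"
  by (rule continuous_compact_support_integrable[of _ "cball 0 r"])
     (auto intro!: Cinf_on_continuous Cinf_on_flat_exp_comp flat_exp_comp_eq_0 assms)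

text \<open>A nonnegative function with integral 0 vanishes almost everywhere, but this one is
  positive on an open ball, which is not a null set.\<close>

lemma bump_normalization:
  assumes "r > 0" shows "(\<integral>x. flat_exp 0 (r\<^sup>2 - x \<bullet> x) \<partial>(lborel :: 'a::euclidean_space measure)) > 0"
proof -
  let ?g = "\<lambda>x::'a. flat_exp 0 (r\<^sup>2 - x \<bullet> x)"
  have "(\<integral>x. ?g x \<partial>lborel) \<noteq> 0"
  proof
    assume "(\<integral>x. ?g x \<partial>lborel) = 0"
    then have "AE x in lborel. ?g x = 0"
      using integral_nonneg_eq_0_iff_AE[OF flat_exp_comp_integrable[OF assms, of 0, where 'a='a]] by (simp add: flat_exp_nonneg)
    moreover have "?g x \<noteq> 0" if "x \<in> ball 0 r" for x
    proof -
      have "(norm x)\<^sup>2 < r\<^sup>2" using that assms by (intro power_strict_mono) auto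
      then show ?thesis by (simp add: flat_exp_def power2_norm_eq_inner)
    qed
    ultimately have "AE x in lborel. x \<notin> ball (0::'a) r" by (auto elim: AE_mp)
    then have "ball (0::'a) r \<in> null_sets lborel" by (subst AE_iff_null_sets) auto
    then have "negligible (ball (0::'a) r)" by (simp add: negligible_iff_null_sets null_sets_completionI)
    then show False using open_not_negligible[of "ball (0::'a) r"] assms by auto
  qed
  moreover have "(\<integral>x. ?g x \<partial>lborel) \<ge> 0" by (simp add: flat_exp_nonneg)
  ultimately show ?thesis by linarith
qed

lemma bump_nonneg: "r > 0 \<Longrightarrow> bump r x \<ge> 0"
  using bump_normalization[of r, where 'a='a] by (auto simp: bump_def flat_exp_nonneg less_imp_le)

lemma bump_eq_0: "r > 0 \<Longrightarrow> x \<notin> cball 0 r \<Longrightarrow> bump r x = 0"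
  by (simp add: bump_def flat_exp_comp_eq_0)

lemma Cinf_on_bump: "Cinf_on UNIV (bump r)"
  unfolding bump_def divide_inverse Cinf_on_def
  by (auto intro!: Ck_on_mult Ck_on_const Ck_on_flat_exp_comp)

lemma integral_bump: "r > 0 \<Longrightarrow> (\<integral>x. bump r x \<partial>(lborel :: 'a::euclidean_space measure)) = 1"
  using bump_normalization[of r, where 'a='a] by (simp add: bump_def)

lemma integrable_bump: "r > 0 \<Longrightarrow> integrable lborel (bump r :: 'a::euclidean_space \<Rightarrow> real)"
  using flat_exp_comp_integrable[of r 0, where 'a='a] by (simp add: bump_def[abs_def])

text \<open>By translation invariance every difference quotient in direction \<open>i\<close>
  integrates to 0. The quotients converge to the derivative with a common bound and a common bounded
  support, so dominated convergence applies.\<close>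

lemma integral_pderiv_dir_eq_0:
  fixes F :: "'a::euclidean_space \<Rightarrow> real"
  assumes F: "\<And>x. F differentiable (at x)" and cont: "continuous_on UNIV (pderiv_dir i F)"
    and K: "compact K" "\<And>x. x \<notin> K \<Longrightarrow> F x = 0" and i: "i \<in> Basis"
  shows "(\<integral>x. pderiv_dir i F x \<partial>lborel) = 0"
proof -
  have D0: "pderiv_dir i F x = 0" if "x \<notin> K" for x
    using K(2) compact_imp_closed[OF K(1)] that by (rule pderiv_dir_zero_outside)
  obtain B where B: "B > 0" "\<And>x. \<bar>pderiv_dir i F x\<bar> \<le> B"
    using continuous_compact_support_bounded[OF cont K(1) D0] by blast
  obtain R where R: "\<And>x. x \<in> K \<Longrightarrow> norm x \<le> R" 
    using compact_imp_bounded[OF K(1)] unfolding bounded_iff by blast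
  have contF: "continuous_on UNIV F"
    using F by (auto simp: continuous_on_eq_continuous_within intro!: differentiable_imp_continuous_within)
  define s where "s n = inverse (real (Suc n))" for n
  have s: "s n > 0" "s n \<le> 1" for n by (auto simp: s_def field_simps)
  define q where "q n x = (F (s n *\<^sub>R i + x) - F x) / s n" for n x
  have line: "((\<lambda>t. F (t *\<^sub>R i + x)) has_real_derivative pderiv_dir i F (t *\<^sub>R i + x)) (at t)" for t x
  proof -
    have "((\<lambda>t. t *\<^sub>R i + x) has_derivative (\<lambda>h. h *\<^sub>R i)) (at t)"
      by (auto intro!: derivative_eq_intros)
    moreover have "(F has_derivative frechet_derivative F (at (t *\<^sub>R i + x))) (at (t *\<^sub>R i + x))"
      using F frechet_derivative_works by auto
    ultimately have "((\<lambda>t. F (t *\<^sub>R i + x)) has_derivative (\<lambda>h. frechet_derivative F (at (t *\<^sub>R i + x)) (h *\<^sub>R i))) (at t)"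
      by (rule has_derivative_compose)
    moreover have "linear (frechet_derivative F (at (t *\<^sub>R i + x)))"
      using F by (rule linear_frechet_derivative)
    then have "(\<lambda>h. frechet_derivative F (at (t *\<^sub>R i + x)) (h *\<^sub>R i)) = (*) (pderiv_dir i F (t *\<^sub>R i + x))"
      by (intro ext) (simp add: pderiv_dir_def linear_scale)
    ultimately show ?thesis
      by (simp add: has_field_derivative_def)
  qed
  have q_lim: "(\<lambda>n. q n x) \<longlonglongrightarrow> pderiv_dir i F x" for x
  proof -
    have "((\<lambda>h. (F (h *\<^sub>R i + x) - F x) / h) \<longlongrightarrow> pderiv_dir i F x) (at 0)"
      using line[of x 0] by (simp add: DERIV_def)
    moreover have "filterlim s (at 0) sequentially"
      unfolding filterlim_at using s(1) LIMSEQ_inverse_real_of_nat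
      by (auto simp: s_def[abs_def] intro!: always_eventually)
    ultimately show ?thesis
      unfolding q_def by (rule filterlim_compose)
  qed
  \<comment> \<open>Steps are at most 1 along a unit vector, so enlarging the radius
    \<open>R\<close> by 1 covers the supports of all quotients. Inside, the mean value theorem gives
    the bound \<open>B\<close>.\<close>
  have q_bound: "\<bar>q n x\<bar> \<le> B * indicator (cball 0 (R + 1)) x" for n x
  proof (cases "x \<in> cball 0 (R + 1)")
    case True
    obtain z where "F (s n *\<^sub>R i + x) - F (0 *\<^sub>R i + x) = (s n - 0) * pderiv_dir i F (z *\<^sub>R i + x)"
      using MVT2[OF s(1)[of n], of "\<lambda>t. F (t *\<^sub>R i + x)" "\<lambda>t. pderiv_dir i F (t *\<^sub>R i + x)"] line by metis
    then show ?thesis using True B(2) s(1)[of n] by (simp add: q_def)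
  next
    case False
    have "norm x \<le> norm (s n *\<^sub>R i + x) + norm (s n *\<^sub>R i)"
      by (metis add.commute add_diff_cancel norm_triangle_ineq4)
    also have "norm (s n *\<^sub>R i) \<le> 1" using s[of n] i by (simp add: less_imp_le)
    finally have "s n *\<^sub>R i + x \<notin> K" "x \<notin> K" using R[of "s n *\<^sub>R i + x"] R[of x] False by auto
    then show ?thesis using B(1) by (simp add: q_def K False)
  qed
  have shift: "(\<integral>x. F (s n *\<^sub>R i + x) \<partial>lborel) = (\<integral>x. F x \<partial>lborel)"
              "integrable lborel (\<lambda>x. F (s n *\<^sub>R i + x))" for n
  proof -
    have m: "F \<in> borel_measurable borel" using contF by (rule borel_measurable_continuous_onI)
    show "(\<integral>x. F (s n *\<^sub>R i + x) \<partial>lborel) = (\<integral>x. F x \<partial>lborel)"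
      using integral_distr[of "(+) (s n *\<^sub>R i)" lborel borel F] m by (simp add: lborel_distr_plus)
    have "integrable (distr lborel borel ((+) (s n *\<^sub>R i))) F"
      unfolding lborel_distr_plus using continuous_compact_support_integrable[OF contF K] .
    then show "integrable lborel (\<lambda>x. F (s n *\<^sub>R i + x))"
      using m by (subst (asm) integrable_distr_eq) auto
  qed
  have "(\<lambda>n. \<integral>x. q n x \<partial>lborel) \<longlonglongrightarrow> (\<integral>x. pderiv_dir i F x \<partial>lborel)"
  proof (rule integral_dominated_convergence[where w="\<lambda>x. B * indicator (cball 0 (R + 1)) x"])
    show "pderiv_dir i F \<in> borel_measurable lborel"
      using borel_measurable_continuous_onI[OF cont] by simp
    show "q n \<in> borel_measurable lborel" for n
      using borel_measurable_continuous_onI[OF contF] unfolding q_def by measurable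
    show "integrable lborel (\<lambda>x. B * indicator (cball (0::'a) (R + 1)) x)"
      by (intro integrable_mult_right integrable_real_indicator) (use emeasure_bounded_finite[OF bounded_cball, of "0::'a" "R + 1"] in auto)
  qed (use q_lim q_bound in auto)
  moreover have "(\<integral>x. q n x \<partial>lborel) = 0" for n
    unfolding q_def using shift[of n] continuous_compact_support_integrable[OF contF K] by simp
  ultimately show ?thesis by (simp add: LIMSEQ_const_iff)
qed

section \<open>Mollification\<close>

lemma lborel_integrable_translate:
  fixes g :: "'a::euclidean_space \<Rightarrow> real"
  assumes "integrable lborel g"
  shows "integrable lborel (\<lambda>x. g (x - y))" "(\<integral>x. g (x - y) \<partial>lborel) = (\<integral>x. g x \<partial>lborel)"
proof -
  have m: "g \<in> borel_measurable borel" using assms by auto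
  have "integrable (distr lborel borel ((+) (-y))) g" using assms by (simp add: lborel_distr_plus)
  then show "integrable lborel (\<lambda>x. g (x - y))"
    using m by (subst (asm) integrable_distr_eq) auto
  show "(\<integral>x. g (x - y) \<partial>lborel) = (\<integral>x. g x \<partial>lborel)"
    using integral_distr[of "(+) (-y)" lborel borel g] m by (simp add: lborel_distr_plus)
qed

lemma lborel_integral_reflect:
  fixes g :: "'a::euclidean_space \<Rightarrow> real"
  assumes "g \<in> borel_measurable borel"
  shows "(\<integral>y. g (x - y) \<partial>lborel) = (\<integral>y. g y \<partial>lborel)"
proof -
  have "(lborel :: 'a measure) = distr lborel borel (\<lambda>t. x + (-1) *\<^sub>R t)"
    by (subst lborel_affine[of "-1" x]) (auto simp: density_1)
  then have "(\<integral>y. g y \<partial>lborel) = (\<integral>y. g y \<partial>distr lborel borel (\<lambda>t. x + (-1) *\<^sub>R t))" by simp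
  also have "\<dots> = (\<integral>y. g (x + (-1) *\<^sub>R y) \<partial>lborel)"
    using assms by (subst integral_distr) auto
  finally show ?thesis by simp
qed

lemma integrable_mult_bounded:
  fixes f g :: "'a \<Rightarrow> real"
  assumes "integrable M f" "g \<in> borel_measurable M" "AE x in M. \<bar>g x\<bar> \<le> B"
  shows "integrable M (\<lambda>x. f x * g x)"
proof (rule Bochner_Integration.integrable_bound[where f="\<lambda>x. B * f x"])
  show "AE x in M. norm (f x * g x) \<le> norm (B * f x)"
    using assms(3)
  proof eventually_elim
    case (elim x)
    then have "\<bar>f x\<bar> * \<bar>g x\<bar> \<le> \<bar>f x\<bar> * \<bar>B\<bar>" by (intro mult_left_mono) auto
    then show ?case by (simp add: abs_mult mult.commute)
  qed
qed (use assms in auto)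

text \<open>Continuity of translation in the mean. Induction over integrable functions reduces it to
  indicators, and outer regularity reduces these to open sets, where \<open>x - Y n\<close>
  eventually lies in the set whenever \<open>x\<close> does.\<close>

lemma L1_translation_lim:
  fixes g :: "'a::euclidean_space \<Rightarrow> real"
  assumes "integrable lborel g" "Y \<longlonglongrightarrow> 0"
  shows "(\<lambda>n. \<integral>x. \<bar>g (x - Y n) - g x\<bar> \<partial>lborel) \<longlonglongrightarrow> 0"
  using assms(1)
proof (induction g rule: integrable_induct)
  case (base A c)
  have open_case: "(\<lambda>n. \<integral>x. \<bar>indicat_real U (x - Y n) - indicat_real U x\<bar> \<partial>lborel) \<longlonglongrightarrow> 0"
    if U: "open U" "emeasure lborel U < \<infinity>" for U :: "'a set"
  proof -
    have iU: "integrable lborel (indicat_real U)" using U by auto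
    note iUY = lborel_integrable_translate[OF iU]
    \<comment> \<open>Off \<open>U\<close> there is neither a pointwise limit at boundary points nor
      an obvious majorant. Only the part of \<open>U\<close> that the translation loses is
      estimated, with majorant the indicator of \<open>U\<close>; since both indicators have the
      same integral, the full difference is twice this part.\<close>
    let ?p = "\<lambda>n x. max (indicat_real U x - indicat_real U (x - Y n)) 0"
    have ip: "integrable lborel (?p n)" for n using iU iUY by auto
    have "(\<lambda>n. \<integral>x. ?p n x \<partial>lborel) \<longlonglongrightarrow> (\<integral>x. 0 \<partial>(lborel::'a measure))"
    proof (rule integral_dominated_convergence[where w="indicat_real U"])
      show "AE x in lborel. (\<lambda>n. ?p n x) \<longlonglongrightarrow> 0"
      proof (rule AE_I2)
        fix x
        show "(\<lambda>n. ?p n x) \<longlonglongrightarrow> 0"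
        proof (cases "x \<in> U")
          case True
          have "(\<lambda>n. x - Y n) \<longlonglongrightarrow> x" using tendsto_diff[OF tendsto_const assms(2), of x] by simp
          then have "\<forall>\<^sub>F n in sequentially. x - Y n \<in> U" using True U(1) by (simp add: topological_tendstoD)
          then have "\<forall>\<^sub>F n in sequentially. ?p n x = 0" by eventually_elim (auto simp: True)
          then show ?thesis by (rule tendsto_eventually)
        qed auto
      qed
      show "?p n \<in> borel_measurable lborel" for n using ip[of n] by (rule borel_measurable_integrable)
    qed (use iU in \<open>auto simp: indicator_def\<close>)
    then have "(\<lambda>n. 2 * (\<integral>x. ?p n x \<partial>lborel)) \<longlonglongrightarrow> 2 * 0" by (intro tendsto_intros) simp
    moreover have "(\<integral>x. \<bar>indicat_real U (x - Y n) - indicat_real U x\<bar> \<partial>lborel) = 2 * (\<integral>x. ?p n x \<partial>lborel)" for n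
    proof -
      have "\<bar>indicat_real U (x - Y n) - indicat_real U x\<bar> = (indicat_real U (x - Y n) - indicat_real U x) + 2 * ?p n x" for x
        by (auto simp: max_def)
      then show ?thesis using iU iUY ip by simp
    qed
    ultimately show ?thesis by simp
  qed
  have "(\<lambda>n. \<integral>x. \<bar>indicat_real A (x - Y n) - indicat_real A x\<bar> \<partial>lborel) \<longlonglongrightarrow> 0"
  proof (rule LIMSEQ_I)
    fix e :: real assume "e > 0"
    have A: "A \<in> sets lebesgue" using base by auto
    \<comment> \<open>The error for \<open>A\<close> is at most the error for an open superset
      \<open>U\<close> plus the measure of \<open>U - A\<close> counted twice, once translated;
      hence thirds.\<close>
    have "e/3 > 0" using \<open>e > 0\<close> by simp
    then obtain U where U: "open U" "A \<subseteq> U" "U - A \<in> lmeasurable" "emeasure lebesgue (U - A) < ennreal (e/3)"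
      by (rule sets_lebesgue_outer_open[OF A])
    have D: "U - A \<in> sets borel" using U(1) base by auto
    then have D1: "emeasure lborel (U - A) < ennreal (e/3)" using U(4) by (simp add: emeasure_completion)
    have "emeasure lborel U = emeasure lborel (A \<union> (U - A))" using U(2) by (simp add: Un_absorb1)
    also have "\<dots> \<le> emeasure lborel A + emeasure lborel (U - A)"
      using base(1) D by (intro emeasure_subadditive) auto
    also have "\<dots> < \<infinity>" using base D1 by (auto simp: less_top[symmetric] ennreal_add_eq_top)
    finally have U2: "emeasure lborel U < \<infinity>" .
    have iA: "integrable lborel (indicat_real A)" and iU: "integrable lborel (indicat_real U)"
      and iD: "integrable lborel (indicat_real (U - A))"
    proof -
      have "emeasure lborel (U - A) < \<infinity>"
        using D1 by (rule order.strict_trans) simp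
      with D[folded sets_lborel] show "integrable lborel (indicat_real (U - A))"
        by (rule integrable_real_indicator)
      show "integrable lborel (indicat_real A)" using base by (intro integrable_real_indicator)
      show "integrable lborel (indicat_real U)" using U(1) U2 by (intro integrable_real_indicator) simp_all
    qed
    have mD: "(\<integral>x. indicat_real (U - A) x \<partial>lborel) < e/3"
    proof -
      have "ennreal (measure lborel (U - A)) < ennreal (e/3)"
        using D1 by (subst emeasure_eq_ennreal_measure[symmetric]) (auto simp: top_unique)
      then show ?thesis using D by (simp add: ennreal_less_iff)
    qed
    from LIMSEQ_D[OF open_case[OF U(1) U2], of "e/3"] \<open>e > 0\<close>
    obtain N where N: "\<And>n. n \<ge> N \<Longrightarrow> (\<integral>x. \<bar>indicat_real U (x - Y n) - indicat_real U x\<bar> \<partial>lborel) < e/3"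
      by auto
    show "\<exists>N. \<forall>n\<ge>N. norm ((\<integral>x. \<bar>indicat_real A (x - Y n) - indicat_real A x\<bar> \<partial>lborel) - 0) < e"
    proof (intro exI allI impI)
      fix n assume "n \<ge> N"
      note tr = lborel_integrable_translate
      have "(\<integral>x. \<bar>indicat_real A (x - Y n) - indicat_real A x\<bar> \<partial>lborel)
        \<le> (\<integral>x. \<bar>indicat_real U (x - Y n) - indicat_real U x\<bar> + indicat_real (U-A) (x - Y n) + indicat_real (U-A) x \<partial>lborel)"
      proof (rule integral_mono)
        show "integrable lborel (\<lambda>x. \<bar>indicat_real A (x - Y n) - indicat_real A x\<bar>)"
          using iA tr(1)[OF iA, of "Y n"] by auto
        show "integrable lborel (\<lambda>x. \<bar>indicat_real U (x - Y n) - indicat_real U x\<bar> + indicat_real (U-A) (x - Y n) + indicat_real (U-A) x)"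
          using iU iD tr(1)[OF iU, of "Y n"] tr(1)[OF iD, of "Y n"] by auto
      qed (use U(2) in \<open>auto simp: indicator_def\<close>)
      also have "\<dots> < e/3 + e/3 + e/3"
        using iA iU iD tr[OF iU, of "Y n"] tr[OF iD, of "Y n"] mD N[OF \<open>n \<ge> N\<close>] by (simp add: tr(2)[OF iD])
      finally show "norm ((\<integral>x. \<bar>indicat_real A (x - Y n) - indicat_real A x\<bar> \<partial>lborel) - 0) < e" by simp
    qed
  qed
  then have "(\<lambda>n. (\<integral>x. \<bar>indicat_real A (x - Y n) - indicat_real A x\<bar> \<partial>lborel) * \<bar>c\<bar>) \<longlonglongrightarrow> 0"
    by (rule tendsto_mult_left_zero)
  moreover have "\<bar>indicat_real A (x - Y n) *\<^sub>R c - indicat_real A x *\<^sub>R c\<bar>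
     = \<bar>indicat_real A (x - Y n) - indicat_real A x\<bar> * \<bar>c\<bar>" for x n
    by (simp add: abs_mult[symmetric] algebra_simps)
  ultimately show ?case by simp
next
  case (add f g)
  note tr = lborel_integrable_translate(1)
  show ?case
  proof (rule tendsto_sandwich[OF _ _ tendsto_const])
    show "(\<lambda>n. (\<integral>x. \<bar>f (x - Y n) - f x\<bar> \<partial>lborel) + (\<integral>x. \<bar>g (x - Y n) - g x\<bar> \<partial>lborel)) \<longlonglongrightarrow> 0"
      using tendsto_add[OF add(3,4)] by simp
    show "\<forall>\<^sub>F n in sequentially. (\<integral>x. \<bar>f (x - Y n) + g (x - Y n) - (f x + g x)\<bar> \<partial>lborel)
      \<le> (\<integral>x. \<bar>f (x - Y n) - f x\<bar> \<partial>lborel) + (\<integral>x. \<bar>g (x - Y n) - g x\<bar> \<partial>lborel)"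
    proof (rule always_eventually, rule allI)
      fix n
      show "(\<integral>x. \<bar>f (x - Y n) + g (x - Y n) - (f x + g x)\<bar> \<partial>lborel)
        \<le> (\<integral>x. \<bar>f (x - Y n) - f x\<bar> \<partial>lborel) + (\<integral>x. \<bar>g (x - Y n) - g x\<bar> \<partial>lborel)"
        by (subst Bochner_Integration.integral_add[symmetric])
           (auto intro!: integral_mono integrable_abs integrable_add integrable_diff tr add)
    qed
  qed auto
next
  case (lim f s)
  note tr = lborel_integrable_translate
  have fm: "f \<in> borel_measurable borel" "s i \<in> borel_measurable borel" for i using lim.hyps by auto
  \<comment> \<open>The induction rule supplies
    \<open>\<bar>s i x\<bar> \<le> 2 * \<bar>f x\<bar>\<close>, whence the factor 3 in the
    majorant.\<close>
  have "(\<lambda>i. \<integral>x. \<bar>s i x - f x\<bar> \<partial>lborel) \<longlonglongrightarrow> (\<integral>x. 0 \<partial>(lborel::'a measure))"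
  proof (rule integral_dominated_convergence[where w="\<lambda>x. 3 * \<bar>f x\<bar>"])
    show "AE x in lborel. (\<lambda>i. \<bar>s i x - f x\<bar>) \<longlonglongrightarrow> 0"
      using lim.hyps(2) by (auto intro!: tendsto_rabs_zero simp: LIM_zero_iff)
    show "AE x in lborel. norm \<bar>s i x - f x\<bar> \<le> 3 * \<bar>f x\<bar>" for i
    proof (rule AE_I2)
      fix x show "norm \<bar>s i x - f x\<bar> \<le> 3 * \<bar>f x\<bar>"
        using lim.hyps(3)[of x i] by (auto simp: abs_if split: if_splits)
    qed
  qed (use lim.hyps fm in auto)
  then have s0: "(\<lambda>i. \<integral>x. \<bar>s i x - f x\<bar> \<partial>lborel) \<longlonglongrightarrow> 0" by simp
  show ?case
  proof (rule LIMSEQ_I)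
    fix e :: real assume "e > 0"
    from LIMSEQ_D[OF s0, of "e/3"] \<open>e > 0\<close> obtain i where i: "(\<integral>x. \<bar>s i x - f x\<bar> \<partial>lborel) < e/3" by auto
    from LIMSEQ_D[OF lim.IH[of i], of "e/3"] \<open>e > 0\<close>
    obtain N where N: "\<And>n. n \<ge> N \<Longrightarrow> (\<integral>x. \<bar>s i (x - Y n) - s i x\<bar> \<partial>lborel) < e/3"
      by auto
    have iD: "integrable lborel (\<lambda>x. \<bar>s i x - f x\<bar>)" using lim.hyps by auto
    show "\<exists>N. \<forall>n\<ge>N. norm ((\<integral>x. \<bar>f (x - Y n) - f x\<bar> \<partial>lborel) - 0) < e"
    proof (intro exI allI impI)
      fix n assume "n \<ge> N"
      have iS: "integrable lborel (\<lambda>x. \<bar>s i (x - Y n) - s i x\<bar>)" using tr(1)[OF lim.hyps(1), of i "Y n"] lim.hyps(1)[of i] by auto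
      have "(\<integral>x. \<bar>f (x - Y n) - f x\<bar> \<partial>lborel)
        \<le> (\<integral>x. \<bar>s i (x - Y n) - s i x\<bar> + \<bar>s i (x - Y n) - f (x - Y n)\<bar> + \<bar>s i x - f x\<bar> \<partial>lborel)"
        using tr(1)[OF iD, of "Y n"] iD iS tr(1)[OF lim.hyps(4), of "Y n"] lim.hyps(4) by (intro integral_mono) auto
      also have "\<dots> = (\<integral>x. \<bar>s i (x - Y n) - s i x\<bar> \<partial>lborel) + (\<integral>x. \<bar>s i x - f x\<bar> \<partial>lborel) + (\<integral>x. \<bar>s i x - f x\<bar> \<partial>lborel)"
        using tr(1)[OF iD, of "Y n"] iD iS by (simp add: tr(2)[OF iD])
      also have "\<dots> < e/3 + e/3 + e/3" using N[OF \<open>n \<ge> N\<close>] i by linarith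
      finally show "norm ((\<integral>x. \<bar>f (x - Y n) - f x\<bar> \<partial>lborel) - 0) < e" by simp
    qed
  qed
qed

text \<open>Convolution of the bump with \<open>f\<close> extended by zero outside \<Omega>. Near
  the boundary the kernel loses mass, so statements about derivatives or averages assume that the
  ball of radius \<open>r\<close> around \<open>x\<close> lies in \<Omega>.\<close>

definition moll :: "real \<Rightarrow> 'a::euclidean_space set \<Rightarrow> ('a \<Rightarrow> real) \<Rightarrow> 'a \<Rightarrow> real" where
  "moll r \<Omega> f x = (\<integral>y. f y * bump r (x - y) \<partial>lebesgue_on \<Omega>)"

lemma bump_bounded:
  assumes "r > 0" shows "\<exists>B. \<forall>x::'a::euclidean_space. \<bar>bump r x\<bar> \<le> B"
  using continuous_compact_support_bounded[OF Cinf_on_continuous[OF Cinf_on_bump] compact_cball[of 0 r] bump_eq_0[OF assms]]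
  by metis

lemma bump_borel_measurable [measurable]: "bump r \<in> borel_measurable borel"
  by (intro borel_measurable_continuous_onI Cinf_on_continuous Cinf_on_bump)

text \<open>The distance is at most an average, weighted by the kernel, of the mean distances
  between \<open>f\<close> and its translates, and only short translations occur for small
  \<open>r\<close>. A nonnegative integral is used because integrability of the mollified function
  is deduced from this statement later.\<close>

lemma moll_L1_convergence:
  assumes \<Omega>: "\<Omega> \<in> sets lebesgue" and f: "integrable (lebesgue_on \<Omega>) f"
  shows "((\<lambda>r. \<integral>\<^sup>+x. ennreal \<bar>moll r \<Omega> f x - f x\<bar> \<partial>lebesgue_on \<Omega>) \<longlongrightarrow> 0) (at_right 0)"
proof -
  have iF: "integrable lebesgue (\<lambda>x. indicator \<Omega> x * f x)"
    using f \<Omega> by (simp add: integrable_restrict_space)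
  \<comment> \<open>Fubini's theorem is applied to the product of two Borel measures, so the
    extension by zero is exchanged for a Borel representative.\<close>
  then obtain g where g[measurable]: "g \<in> borel_measurable lborel" and fg: "AE x in lborel. indicator \<Omega> x * f x = g x"
    using completion_ex_borel_measurable_real by blast
  have fg': "AE x in lebesgue. indicator \<Omega> x * f x = g x" using fg by (rule AE_completion)
  have "integrable lebesgue g"
    using integrable_cong_AE_imp[OF iF _ fg'] g by (auto simp: measurable_completion)
  then have ig: "integrable lborel g" using g by (simp add: integrable_completion)
  have moll_eq: "moll r \<Omega> f x = (\<integral>y. g (x - y) * bump r y \<partial>lborel)" for r x
  proof -
    have "moll r \<Omega> f x = (\<integral>y. indicator \<Omega> y *\<^sub>R (f y * bump r (x - y)) \<partial>lebesgue)"
      unfolding moll_def using \<Omega> by (simp add: integral_restrict_space)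
    also have "\<dots> = (\<integral>y. g y * bump r (x - y) \<partial>lebesgue)"
    proof (rule integral_cong_AE)
      show "AE y in lebesgue. indicator \<Omega> y *\<^sub>R (f y * bump r (x - y)) = g y * bump r (x - y)"
        using fg' by eventually_elim (simp add: mult.assoc[symmetric])
      have m: "(\<lambda>y. bump r (x - y)) \<in> borel_measurable lebesgue"
        by (intro measurable_completion) measurable
      have "(\<lambda>y. (indicator \<Omega> y * f y) * bump r (x - y)) \<in> borel_measurable lebesgue"
        using borel_measurable_integrable[OF iF] m by (rule borel_measurable_times)
      then show "(\<lambda>y. indicator \<Omega> y *\<^sub>R (f y * bump r (x - y))) \<in> borel_measurable lebesgue"
        by (simp add: mult.assoc)
      show "(\<lambda>y. g y * bump r (x - y)) \<in> borel_measurable lebesgue"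
        using m g by (auto intro: measurable_completion)
    qed
    also have "\<dots> = (\<integral>y. g y * bump r (x - y) \<partial>lborel)"
      by (rule integral_completion) measurable
    also have "\<dots> = (\<integral>y. g (x - y) * bump r y \<partial>lborel)"
      using lborel_integral_reflect[of "\<lambda>y. g y * bump r (x - y)" x] by simp
    finally show ?thesis .
  qed
  have key: "\<exists>d>0. \<forall>r. 0 < r \<and> r < d \<longrightarrow> (\<integral>\<^sup>+x. ennreal \<bar>moll r \<Omega> f x - f x\<bar> \<partial>lebesgue_on \<Omega>) \<le> ennreal e"
    if "e > 0" for e
  proof -
    define \<omega> where "\<omega> y = (\<integral>x. \<bar>g (x - y) - g x\<bar> \<partial>lborel)" for y
    have "isCont \<omega> 0"
      unfolding continuous_at_sequentially using L1_translation_lim[OF ig] by (auto simp: \<omega>_def o_def)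
    then obtain d where d: "d > 0" "\<And>y. norm y < d \<Longrightarrow> \<bar>\<omega> y\<bar> < e"
      using \<open>e > 0\<close> unfolding continuous_at_eps_delta by (auto simp: \<omega>_def dist_norm)
    have "(\<integral>\<^sup>+x. ennreal \<bar>moll r \<Omega> f x - f x\<bar> \<partial>lebesgue_on \<Omega>) \<le> ennreal e" if r: "0 < r" "r < d" for r
    proof -
      note ib = integrable_bump[OF r(1), where 'a='a] and ib1 = integral_bump[OF r(1), where 'a='a]
      obtain B where B: "\<And>x::'a. \<bar>bump r x\<bar> \<le> B" using bump_bounded[OF r(1)] by blast
      have "(\<integral>\<^sup>+x. ennreal \<bar>moll r \<Omega> f x - f x\<bar> \<partial>lebesgue_on \<Omega>)
        = (\<integral>\<^sup>+x. ennreal \<bar>moll r \<Omega> f x - f x\<bar> * indicator \<Omega> x \<partial>lebesgue)"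
        using \<Omega> by (simp add: nn_integral_restrict_space)
      also have "\<dots> \<le> (\<integral>\<^sup>+x. ennreal \<bar>moll r \<Omega> f x - g x\<bar> \<partial>lebesgue)"
      proof (rule nn_integral_mono_AE)
        show "AE x in lebesgue. ennreal \<bar>moll r \<Omega> f x - f x\<bar> * indicator \<Omega> x \<le> ennreal \<bar>moll r \<Omega> f x - g x\<bar>"
          using fg' by eventually_elim (auto simp: indicator_def)
      qed
      also have "\<dots> = (\<integral>\<^sup>+x. ennreal \<bar>moll r \<Omega> f x - g x\<bar> \<partial>lborel)"
        by (rule nn_integral_completion)
      also have "\<dots> \<le> (\<integral>\<^sup>+x. (\<integral>\<^sup>+y. ennreal (\<bar>g (x - y) - g x\<bar> * bump r y) \<partial>lborel) \<partial>lborel)"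
      proof (rule nn_integral_mono)
        fix x
        have i1: "integrable lborel (\<lambda>y. g (x - y) * bump r y)"
        proof -
          have "integrable lborel (\<lambda>y. g (x - y))"
          proof -
            have "integrable (distr lborel borel (\<lambda>t. x + (-1) *\<^sub>R t)) g"
              using ig lborel_affine[of "-1" x] by (simp add: density_1)
            then show ?thesis by (subst (asm) integrable_distr_eq) auto
          qed
          then show ?thesis using B by (intro integrable_mult_bounded) auto
        qed
        have "moll r \<Omega> f x - g x = (\<integral>y. (g (x - y) - g x) * bump r y \<partial>lborel)"
          using i1 ib ib1 by (simp add: moll_eq left_diff_distrib)
        also have "ennreal \<bar>\<dots>\<bar> \<le> (\<integral>\<^sup>+y. ennreal (norm ((g (x - y) - g x) * bump r y)) \<partial>lborel)"
          using i1 ib by (subst real_norm_def[symmetric], intro integral_norm_bound_ennreal) (simp add: left_diff_distrib)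
        finally show "ennreal \<bar>moll r \<Omega> f x - g x\<bar> \<le> (\<integral>\<^sup>+y. ennreal (\<bar>g (x - y) - g x\<bar> * bump r y) \<partial>lborel)"
          using bump_nonneg[OF r(1), where 'a='a] by (simp add: abs_mult)
      qed
      also have "\<dots> = (\<integral>\<^sup>+y. (\<integral>\<^sup>+x. ennreal (\<bar>g (x - y) - g x\<bar> * bump r y) \<partial>lborel) \<partial>lborel)"
        by (rule lborel_pair.Fubini') measurable
      also have "\<dots> \<le> (\<integral>\<^sup>+y. ennreal e * ennreal (bump r y) \<partial>(lborel :: 'a measure))"
      proof (rule nn_integral_mono)
        fix y :: 'a
        show "(\<integral>\<^sup>+x. ennreal (\<bar>g (x - y) - g x\<bar> * bump r y) \<partial>lborel) \<le> ennreal e * ennreal (bump r y)"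
        proof (cases "y \<in> cball 0 r")
          case True
          have "(\<integral>\<^sup>+x. ennreal (\<bar>g (x - y) - g x\<bar> * bump r y) \<partial>lborel) = ennreal (\<omega> y) * ennreal (bump r y)"
            using bump_nonneg[OF r(1), of y] lborel_integrable_translate(1)[OF ig, of y] ig
            by (simp add: ennreal_mult' nn_integral_multc nn_integral_eq_integral \<omega>_def)
          also have "\<dots> \<le> ennreal e * ennreal (bump r y)"
            using d(2)[of y] True r by (intro mult_right_mono) (auto intro!: ennreal_leI)
          finally show ?thesis .
        next
          case False
          then show ?thesis by (simp add: bump_eq_0[OF r(1)])
        qed
      qed
      also have "\<dots> = ennreal e"
        using ib ib1 bump_nonneg[OF r(1), where 'a='a] by (simp add: nn_integral_cmult nn_integral_eq_integral)
      finally show ?thesis .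
    qed
    with d(1) show ?thesis by blast
  qed
  show ?thesis
  proof (rule order_tendstoI)
    fix a :: ennreal assume "0 < a"
    then obtain e where e: "0 < e" "ennreal e < a"
      by (metis dense ennreal_cases ennreal_less_zero_iff infinity_ennreal_def less_top not_less_iff_gr_or_eq top_greatest)
    from key[OF e(1)] obtain d where "d > 0"
      "\<And>r. 0 < r \<Longrightarrow> r < d \<Longrightarrow> (\<integral>\<^sup>+x. ennreal \<bar>moll r \<Omega> f x - f x\<bar> \<partial>lebesgue_on \<Omega>) \<le> ennreal e" by blast
    then show "\<forall>\<^sub>F r in at_right 0. (\<integral>\<^sup>+x. ennreal \<bar>moll r \<Omega> f x - f x\<bar> \<partial>lebesgue_on \<Omega>) < a"
      using e(2) by (auto simp: eventually_at_right_field intro!: exI[of _ d] intro: le_less_trans)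
  qed auto
qed

text \<open>The series of absolute values has a finite integral, so it converges almost everywhere
  and its terms tend to 0. A geometric rate thus yields convergence almost everywhere of the whole
  sequence, with no passage to subsequences.\<close>

lemma AE_tendsto_0_of_geometric_L1:
  fixes g :: "nat \<Rightarrow> 'a \<Rightarrow> real"
  assumes [measurable]: "\<And>n. g n \<in> borel_measurable M"
    and bound: "\<And>n. (\<integral>\<^sup>+x. ennreal \<bar>g n x\<bar> \<partial>M) \<le> ennreal ((1/2)^n)"
  shows "AE x in M. (\<lambda>n. g n x) \<longlonglongrightarrow> 0"
proof -
  have "(\<integral>\<^sup>+x. (\<Sum>n. ennreal \<bar>g n x\<bar>) \<partial>M) = (\<Sum>n. \<integral>\<^sup>+x. ennreal \<bar>g n x\<bar> \<partial>M)"
    by (rule nn_integral_suminf) measurable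
  also have "\<dots> \<le> (\<Sum>n. ennreal ((1/2)^n))"
    by (intro suminf_le bound) auto
  also have "\<dots> = ennreal (\<Sum>n. (1/2)^n)"
    by (intro suminf_ennreal2) (auto intro: summable_geometric)
  also have "\<dots> < \<infinity>" by simp
  finally have "(\<integral>\<^sup>+x. (\<Sum>n. ennreal \<bar>g n x\<bar>) \<partial>M) \<noteq> \<infinity>" by simp
  then have "AE x in M. (\<Sum>n. ennreal \<bar>g n x\<bar>) \<noteq> \<infinity>"
    by (intro nn_integral_PInf_AE) auto
  then show ?thesis
  proof eventually_elim
    case (elim x)
    then have "summable (\<lambda>n. \<bar>g n x\<bar>)" by (intro summable_suminf_not_top) auto
    then show ?case using summable_LIMSEQ_zero tendsto_rabs_zero_iff by blast
  qed
qed

text \<open>Split off \<open>min \<bar>g n - h\<bar> (2 * w)\<close>, which has a fixed dominating function.\<close>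

lemma generalized_dominated_convergence:
  fixes g :: "nat \<Rightarrow> 'a \<Rightarrow> real"
  assumes [measurable]: "\<And>n. g n \<in> borel_measurable M" "h \<in> borel_measurable M"
    and w: "integrable M w" "\<And>n. integrable M (W n)" "(\<lambda>n. \<integral>x. \<bar>W n x - w x\<bar> \<partial>M) \<longlonglongrightarrow> 0"
    and lim: "AE x in M. (\<lambda>n. g n x) \<longlonglongrightarrow> h x"
    and bound: "\<And>n. AE x in M. \<bar>g n x\<bar> \<le> W n x" "AE x in M. \<bar>h x\<bar> \<le> w x"
  shows "(\<lambda>n. \<integral>x. \<bar>g n x - h x\<bar> \<partial>M) \<longlonglongrightarrow> 0" "\<And>n. integrable M (\<lambda>x. g n x - h x)"
    "(\<lambda>n. \<integral>x. g n x \<partial>M) \<longlonglongrightarrow> (\<integral>x. h x \<partial>M)"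
proof -
  have ih: "integrable M h"
    by (rule Bochner_Integration.integrable_bound[OF w(1)]) (use bound(2) in auto)
  have ig: "integrable M (g n)" for n
    by (rule Bochner_Integration.integrable_bound[OF w(2)[of n]]) (use bound(1)[of n] in auto)
  show iD: "integrable M (\<lambda>x. g n x - h x)" for n using ih ig by auto
  let ?k = "\<lambda>n x. min \<bar>g n x - h x\<bar> \<bar>2 * w x\<bar>"
  have wm [measurable]: "w \<in> borel_measurable M" using w(1) by auto
  have ik: "integrable M (?k n)" for n using iD w(1) by (intro integrable_min integrable_abs) auto
  have "(\<lambda>n. \<integral>x. ?k n x \<partial>M) \<longlonglongrightarrow> (\<integral>x. 0 \<partial>M)"
  proof (rule integral_dominated_convergence[where w="\<lambda>x. \<bar>2 * w x\<bar>"])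
    show "AE x in M. (\<lambda>n. ?k n x) \<longlonglongrightarrow> 0"
      using lim
    proof eventually_elim
      case (elim x)
      then have "(\<lambda>n. \<bar>g n x - h x\<bar>) \<longlonglongrightarrow> 0" by (simp add: LIM_zero_iff tendsto_rabs_zero)
      then show ?case
        by (rule tendsto_sandwich[OF _ _ tendsto_const, rotated 2]) auto
    qed
  qed (use w in auto)
  then have k0: "(\<lambda>n. \<integral>x. ?k n x \<partial>M) \<longlonglongrightarrow> 0" by simp
  have "(\<lambda>n. (\<integral>x. ?k n x \<partial>M) + (\<integral>x. \<bar>W n x - w x\<bar> \<partial>M)) \<longlonglongrightarrow> 0 + 0"
    using k0 w(3) by (rule tendsto_add)
  then have s0: "(\<lambda>n. (\<integral>x. ?k n x \<partial>M) + (\<integral>x. \<bar>W n x - w x\<bar> \<partial>M)) \<longlonglongrightarrow> 0" by simp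
  have le: "(\<integral>x. \<bar>g n x - h x\<bar> \<partial>M) \<le> (\<integral>x. ?k n x \<partial>M) + (\<integral>x. \<bar>W n x - w x\<bar> \<partial>M)" for n
  proof -
    have "(\<integral>x. \<bar>g n x - h x\<bar> \<partial>M) \<le> (\<integral>x. ?k n x + \<bar>W n x - w x\<bar> \<partial>M)"
    proof (rule integral_mono_AE)
      show "AE x in M. \<bar>g n x - h x\<bar> \<le> ?k n x + \<bar>W n x - w x\<bar>"
        using bound(1)[of n] bound(2) by eventually_elim (auto simp: min_def)
    qed (use iD ik w in auto)
    also have "\<dots> = (\<integral>x. ?k n x \<partial>M) + (\<integral>x. \<bar>W n x - w x\<bar> \<partial>M)"
      using ik w by (intro Bochner_Integration.integral_add) auto
    finally show ?thesis .
  qed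
  show 1: "(\<lambda>n. \<integral>x. \<bar>g n x - h x\<bar> \<partial>M) \<longlonglongrightarrow> 0"
    by (rule tendsto_sandwich[OF _ _ tendsto_const s0]) (auto intro: always_eventually le)
  have "(\<lambda>n. \<integral>x. g n x - h x \<partial>M) \<longlonglongrightarrow> 0"
    by (rule Lim_null_comparison[OF _ 1]) (auto intro!: always_eventually integral_abs_bound)
  then show "(\<lambda>n. \<integral>x. g n x \<partial>M) \<longlonglongrightarrow> (\<integral>x. h x \<partial>M)"
    using ig ih by (simp add: LIM_zero_iff)
qed

lemma nn_integral_abs_eq_integral:
  assumes "integrable M g" shows "(\<integral>\<^sup>+x. ennreal \<bar>g x\<bar> \<partial>M) = ennreal (\<integral>x. \<bar>g x\<bar> \<partial>M)"
  using assms by (intro nn_integral_eq_integral) auto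

section \<open>Differentiation of convolutions\<close>

lemma Cinf_compact_Lipschitz:
  fixes \<rho> :: "'a::euclidean_space \<Rightarrow> real"
  assumes \<rho>: "Cinf_on UNIV \<rho>" and K: "compact K" "\<And>x. x \<notin> K \<Longrightarrow> \<rho> x = 0"
  shows "\<exists>B. \<forall>x y. \<bar>\<rho> x - \<rho> y\<bar> \<le> B * norm (x - y)"
proof -
  have "\<exists>B. \<forall>x. \<bar>pderiv_dir i \<rho> x\<bar> \<le> B" if i: "i \<in> Basis" for i
    using continuous_compact_support_bounded[OF Cinf_on_continuous[OF Cinf_on_pderiv_dir[OF \<rho> i]] K(1)
        pderiv_dir_zero_outside[OF K(2) compact_imp_closed[OF K(1)]]] by metis
  then obtain B where B: "\<And>i x. i \<in> Basis \<Longrightarrow> \<bar>pderiv_dir i \<rho> x\<bar> \<le> B i" by metis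
  have "\<bar>\<rho> x - \<rho> y\<bar> \<le> (\<Sum>i\<in>Basis. B i) * norm (x - y)" for x y
    unfolding real_norm_def[symmetric]
  proof (rule differentiable_bound[of UNIV \<rho> "\<lambda>x. frechet_derivative \<rho> (at x)"])
    fix x
    show "(\<rho> has_derivative frechet_derivative \<rho> (at x)) (at x within UNIV)"
      using Cinf_on_differentiable[OF \<rho>] frechet_derivative_works by auto
    show "onorm (frechet_derivative \<rho> (at x)) \<le> (\<Sum>i\<in>Basis. B i)"
    proof (rule onorm_le)
      fix h
      have "norm (frechet_derivative \<rho> (at x) h) \<le> (\<Sum>i\<in>Basis. \<bar>(h \<bullet> i) * pderiv_dir i \<rho> x\<bar>)"
        unfolding frechet_derivative_eq_sum[OF Cinf_on_differentiable[OF \<rho>]] real_norm_def by (rule sum_abs)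
      also have "\<dots> \<le> (\<Sum>i\<in>Basis. norm h * B i)"
        using B by (intro sum_mono) (auto simp: abs_mult intro!: mult_mono Basis_le_norm)
      finally show "norm (frechet_derivative \<rho> (at x) h) \<le> (\<Sum>i\<in>Basis. B i) * norm h"
        by (simp add: sum_distrib_left mult.commute)
    qed
  qed auto
  then show ?thesis by blast
qed

text \<open>The constant is uniform in \<open>x\<close>, so the remainder can be integrated against
  an arbitrary integrable function.\<close>

lemma Cinf_compact_quadratic_bound:
  fixes \<rho> :: "'a::euclidean_space \<Rightarrow> real"
  assumes \<rho>: "Cinf_on UNIV \<rho>" and K: "compact K" "\<And>x. x \<notin> K \<Longrightarrow> \<rho> x = 0"
  shows "\<exists>C. \<forall>x h. \<bar>\<rho> (x + h) - \<rho> x - (\<Sum>i\<in>Basis. (h \<bullet> i) * pderiv_dir i \<rho> x)\<bar> \<le> C * (norm h)\<^sup>2"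
proof -
  have "\<exists>B. \<forall>x y. \<bar>pderiv_dir i \<rho> x - pderiv_dir i \<rho> y\<bar> \<le> B * norm (x - y)" if i: "i \<in> Basis" for i
    using Cinf_compact_Lipschitz[OF Cinf_on_pderiv_dir[OF \<rho> i] K(1) pderiv_dir_zero_outside[OF K(2) compact_imp_closed[OF K(1)]]] .
  then obtain B where B: "\<And>i x y. i \<in> Basis \<Longrightarrow> \<bar>pderiv_dir i \<rho> x - pderiv_dir i \<rho> y\<bar> \<le> B i * norm (x - y)" by metis
  have "\<bar>\<rho> (x + h) - \<rho> x - (\<Sum>i\<in>Basis. (h \<bullet> i) * pderiv_dir i \<rho> x)\<bar> \<le> (\<Sum>i\<in>Basis. \<bar>B i\<bar>) * (norm h)\<^sup>2" for x h
  proof -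
    let ?S = "\<lambda>z. (\<Sum>i\<in>Basis. (h \<bullet> i) * pderiv_dir i \<rho> z)"
    \<comment> \<open>With the linear term subtracted first, a single use of the mean value theorem
      produces a difference of first derivatives, and their Lipschitz bounds give the second factor
      \<open>norm h\<close>.\<close>
    have "((\<lambda>t. \<rho> (x + t *\<^sub>R h) - t * ?S x) has_real_derivative (?S (x + t *\<^sub>R h) - ?S x)) (at t)" for t
    proof -
      have "((\<lambda>t. x + t *\<^sub>R h) has_derivative (\<lambda>s. s *\<^sub>R h)) (at t)"
        by (auto intro!: derivative_eq_intros)
      moreover have "(\<rho> has_derivative frechet_derivative \<rho> (at (x + t *\<^sub>R h))) (at (x + t *\<^sub>R h))"
        using Cinf_on_differentiable[OF \<rho>] frechet_derivative_works by auto
      ultimately have "((\<lambda>t. \<rho> (x + t *\<^sub>R h)) has_derivative (\<lambda>s. frechet_derivative \<rho> (at (x + t *\<^sub>R h)) (s *\<^sub>R h))) (at t)"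
        by (rule has_derivative_compose)
      moreover have "(\<lambda>s. frechet_derivative \<rho> (at (x + t *\<^sub>R h)) (s *\<^sub>R h)) = (*) (?S (x + t *\<^sub>R h))"
        unfolding frechet_derivative_eq_sum[OF Cinf_on_differentiable[OF \<rho>]]
        by (intro ext) (simp add: sum_distrib_left mult_ac)
      ultimately have "((\<lambda>t. \<rho> (x + t *\<^sub>R h)) has_real_derivative ?S (x + t *\<^sub>R h)) (at t)"
        by (simp add: has_field_derivative_def)
      then show ?thesis by (auto intro!: derivative_eq_intros)
    qed
    from MVT2[of 0 1, OF _ this] obtain z where z: "0 < z" "z < 1"
      "\<rho> (x + h) - ?S x - \<rho> x = ?S (x + z *\<^sub>R h) - ?S x" by auto
    have "\<bar>?S (x + z *\<^sub>R h) - ?S x\<bar> \<le> (\<Sum>i\<in>Basis. \<bar>(h \<bullet> i) * (pderiv_dir i \<rho> (x + z *\<^sub>R h) - pderiv_dir i \<rho> x)\<bar>)"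
      by (simp add: sum_subtractf[symmetric] right_diff_distrib[symmetric] sum_abs)
    also have "\<dots> \<le> (\<Sum>i\<in>Basis. norm h * (\<bar>B i\<bar> * norm h))"
    proof (rule sum_mono)
      fix i :: 'a assume i: "i \<in> Basis"
      have "\<bar>pderiv_dir i \<rho> (x + z *\<^sub>R h) - pderiv_dir i \<rho> x\<bar> \<le> B i * (z * norm h)"
        using B[OF i, of "x + z *\<^sub>R h" x] z by simp
      also have "\<dots> \<le> \<bar>B i\<bar> * norm h"
        using z by (intro mult_mono) (auto simp: mult_left_le_one_le)
      finally show "\<bar>(h \<bullet> i) * (pderiv_dir i \<rho> (x + z *\<^sub>R h) - pderiv_dir i \<rho> x)\<bar> \<le> norm h * (\<bar>B i\<bar> * norm h)"
        unfolding abs_mult using Basis_le_norm[OF i, of h] by (intro mult_mono) auto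
    qed
    finally show ?thesis using z by (simp add: sum_distrib_right sum_distrib_left power2_eq_square mult_ac algebra_simps)
  qed
  then show ?thesis by blast
qed

lemma lebesgue_on_measurable_continuous:
  fixes g :: "'a::euclidean_space \<Rightarrow> real"
  assumes "continuous_on UNIV g" shows "g \<in> borel_measurable (lebesgue_on S)"
  using borel_measurable_continuous_onI[OF assms] by (intro measurable_restrict_space1) (simp add: measurable_completion)

lemma conv_integrable:
  fixes f :: "'a::euclidean_space \<Rightarrow> real"
  assumes f: "integrable (lebesgue_on \<Omega>) f"
    and \<rho>: "continuous_on UNIV \<rho>" "compact K" "\<And>x. x \<notin> K \<Longrightarrow> \<rho> x = 0"
  shows "integrable (lebesgue_on \<Omega>) (\<lambda>y. f y * \<rho> (x - y))"
proof -
  obtain B where "\<And>x. \<bar>\<rho> x\<bar> \<le> B" using continuous_compact_support_bounded[OF \<rho>] by blast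
  then show ?thesis
    using f by (intro integrable_mult_bounded[where B=B] lebesgue_on_measurable_continuous
        continuous_on_compose2[OF \<rho>(1)] continuous_intros) auto
qed

text \<open>The uniform quadratic remainder of the kernel integrates to a remainder bounded by a
  multiple of \<open>(norm h)\<^sup>2\<close>, so no limit has to be exchanged with the
  integral.\<close>

lemma conv_has_derivative:
  fixes f :: "'a::euclidean_space \<Rightarrow> real"
  assumes f: "integrable (lebesgue_on \<Omega>) f"
    and \<rho>: "Cinf_on UNIV \<rho>" "compact K" "\<And>x. x \<notin> K \<Longrightarrow> \<rho> x = 0"
  shows "((\<lambda>x. \<integral>y. f y * \<rho> (x - y) \<partial>lebesgue_on \<Omega>) has_derivative
     (\<lambda>h. \<Sum>i\<in>Basis. (h \<bullet> i) * (\<integral>y. f y * pderiv_dir i \<rho> (x - y) \<partial>lebesgue_on \<Omega>))) (at x)"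
proof -
  let ?M = "lebesgue_on \<Omega>"
  obtain C where C: "\<And>x h. \<bar>\<rho> (x + h) - \<rho> x - (\<Sum>i\<in>Basis. (h \<bullet> i) * pderiv_dir i \<rho> x)\<bar> \<le> C * (norm h)\<^sup>2"
    using Cinf_compact_quadratic_bound[OF \<rho>] by blast
  have iD: "integrable ?M (\<lambda>y. f y * pderiv_dir i \<rho> (x - y))" if "i \<in> Basis" for i x
    using conv_integrable[OF f Cinf_on_continuous[OF Cinf_on_pderiv_dir[OF \<rho>(1) that]] \<rho>(2)
        pderiv_dir_zero_outside[OF \<rho>(3) compact_imp_closed[OF \<rho>(2)]]] .
  have i\<rho>: "integrable ?M (\<lambda>y. f y * \<rho> (x - y))" for x
    using conv_integrable[OF f Cinf_on_continuous[OF \<rho>(1)] \<rho>(2,3)] .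
  let ?F = "\<lambda>x. \<integral>y. f y * \<rho> (x - y) \<partial>?M"
  let ?L = "\<lambda>h. \<Sum>i\<in>Basis. (h \<bullet> i) * (\<integral>y. f y * pderiv_dir i \<rho> (x - y) \<partial>?M)"
  let ?A = "\<integral>y. \<bar>f y\<bar> \<partial>?M"
  have est: "norm (?F (x + h) - ?F x - ?L h) \<le> (\<bar>C\<bar> * ?A) * (norm h)\<^sup>2" for h
  proof -
    let ?R = "\<lambda>y. \<rho> (x - y + h) - \<rho> (x - y) - (\<Sum>i\<in>Basis. (h \<bullet> i) * pderiv_dir i \<rho> (x - y))"
    have L: "?L h = (\<integral>y. (\<Sum>i\<in>Basis. (h \<bullet> i) * (f y * pderiv_dir i \<rho> (x - y))) \<partial>?M)"
      by (subst Bochner_Integration.integral_sum) (auto intro!: iD)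
    have iS: "integrable ?M (\<lambda>y. (\<Sum>i\<in>Basis. (h \<bullet> i) * (f y * pderiv_dir i \<rho> (x - y))))"
      by (auto intro!: iD)
    have eq: "f y * \<rho> (x + h - y) - f y * \<rho> (x - y) - (\<Sum>i\<in>Basis. (h \<bullet> i) * (f y * pderiv_dir i \<rho> (x - y))) = f y * ?R y" for y
      by (simp add: right_diff_distrib sum_distrib_left algebra_simps)
    have iR: "integrable ?M (\<lambda>y. f y * ?R y)"
      unfolding eq[symmetric] using i\<rho> iS by auto
    have R: "?F (x + h) - ?F x - ?L h = (\<integral>y. f y * ?R y \<partial>?M)"
      unfolding eq[symmetric] L using i\<rho> iS by simp
    have "norm (?F (x + h) - ?F x - ?L h) \<le> (\<integral>y. norm (f y * ?R y) \<partial>?M)"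
      unfolding R by (rule integral_norm_bound)
    also have "\<dots> \<le> (\<integral>y. \<bar>f y\<bar> * (\<bar>C\<bar> * (norm h)\<^sup>2) \<partial>?M)"
    proof (rule integral_mono)
      fix y
      have "\<bar>?R y\<bar> \<le> \<bar>C\<bar> * (norm h)\<^sup>2"
        by (rule order_trans[OF C mult_right_mono]) auto
      then show "norm (f y * ?R y) \<le> \<bar>f y\<bar> * (\<bar>C\<bar> * (norm h)\<^sup>2)"
        unfolding real_norm_def abs_mult by (intro mult_left_mono) auto
    qed (use iR f in auto)
    finally show ?thesis by (simp add: mult_ac)
  qed
  show ?thesis
    unfolding has_derivative_at
  proof (intro conjI)
    show "bounded_linear ?L"
      by (intro bounded_linear_sum bounded_linear_mult_const bounded_linear_inner_left)
    show "(\<lambda>h. norm (?F (x + h) - ?F x - ?L h) / norm h) \<midarrow>0\<rightarrow> 0"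
    proof (rule Lim_null_comparison)
      show "\<forall>\<^sub>F h in at 0. norm (norm (?F (x + h) - ?F x - ?L h) / norm h) \<le> (\<bar>C\<bar> * ?A) * norm h"
      proof (rule eventually_at_filter[THEN iffD2], rule always_eventually, intro allI impI)
        fix h :: 'a assume "h \<noteq> 0"
        then show "norm (norm (?F (x + h) - ?F x - ?L h) / norm h) \<le> (\<bar>C\<bar> * ?A) * norm h"
          using est[of h] by (simp add: divide_le_eq power2_eq_square mult.assoc)
      qed
      show "(\<lambda>h. (\<bar>C\<bar> * ?A) * norm h) \<midarrow>0\<rightarrow> 0"
        by (intro tendsto_mult_right_zero tendsto_norm_zero tendsto_ident_at)
    qed
  qed
qed

lemma conv_pderiv_dir:
  fixes f :: "'a::euclidean_space \<Rightarrow> real"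
  assumes f: "integrable (lebesgue_on \<Omega>) f"
    and \<rho>: "Cinf_on UNIV \<rho>" "compact K" "\<And>x. x \<notin> K \<Longrightarrow> \<rho> x = 0" and i: "i \<in> Basis"
  shows "pderiv_dir i (\<lambda>x. \<integral>y. f y * \<rho> (x - y) \<partial>lebesgue_on \<Omega>)
    = (\<lambda>x. \<integral>y. f y * pderiv_dir i \<rho> (x - y) \<partial>lebesgue_on \<Omega>)"
proof
  fix x
  let ?c = "\<lambda>j. \<integral>y. f y * pderiv_dir j \<rho> (x - y) \<partial>lebesgue_on \<Omega>"
  have "pderiv_dir i (\<lambda>x. \<integral>y. f y * \<rho> (x - y) \<partial>lebesgue_on \<Omega>) x = (\<Sum>j\<in>Basis. (i \<bullet> j) * ?c j)"
    by (rule pderiv_dir_eq[OF conv_has_derivative[OF f \<rho>]])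
  also have "\<dots> = (\<Sum>j\<in>Basis. if j = i then ?c j else 0)"
    using i by (intro sum.cong) (auto simp: inner_Basis)
  also have "\<dots> = ?c i" using i by simp
  finally show "pderiv_dir i (\<lambda>x. \<integral>y. f y * \<rho> (x - y) \<partial>lebesgue_on \<Omega>) x = ?c i" .
qed

text \<open>All derivatives fall on the kernel, which is why the induction keeps
  \<open>\<rho>\<close> arbitrary and \<open>f\<close> fixed.\<close>

lemma Cinf_on_conv:
  fixes f :: "'a::euclidean_space \<Rightarrow> real"
  assumes f: "integrable (lebesgue_on \<Omega>) f"
    and \<rho>: "Cinf_on UNIV \<rho>" "compact K" "\<And>x. x \<notin> K \<Longrightarrow> \<rho> x = 0"
  shows "Cinf_on UNIV (\<lambda>x. \<integral>y. f y * \<rho> (x - y) \<partial>lebesgue_on \<Omega>)"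
proof -
  have "Ck_on k UNIV (\<lambda>x. \<integral>y. f y * \<rho> (x - y) \<partial>lebesgue_on \<Omega>)" for k
    using \<rho>
  proof (induction k arbitrary: \<rho>)
    case 0
    then show ?case using conv_has_derivative[OF f 0]
      by (auto simp: continuous_on_eq_continuous_within intro!: has_derivative_continuous)
  next
    case (Suc k)
    have "Ck_on k UNIV (pderiv_dir i (\<lambda>x. \<integral>y. f y * \<rho> (x - y) \<partial>lebesgue_on \<Omega>))" if i: "i \<in> Basis" for i
    proof -
      have "pderiv_dir i \<rho> x = 0" if "x \<notin> K" for x
        using Suc.prems(3) compact_imp_closed[OF Suc.prems(2)] that by (rule pderiv_dir_zero_outside)
      then have "Ck_on k UNIV (\<lambda>x. \<integral>y. f y * pderiv_dir i \<rho> (x - y) \<partial>lebesgue_on \<Omega>)"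
        using Suc.IH[OF Cinf_on_pderiv_dir[OF Suc.prems(1) i] Suc.prems(2)] by blast
      then show ?thesis using conv_pderiv_dir[OF f Suc.prems i] by simp
    qed
    then show ?case using conv_has_derivative[OF f Suc.prems] by (auto simp: differentiable_def)
  qed
  then show ?thesis by (simp add: Cinf_on_def)
qed

lemma Cinf_on_moll:
  assumes "r > 0" "integrable (lebesgue_on \<Omega>) f"
  shows "Cinf_on UNIV (moll r \<Omega> f)"
  unfolding moll_def[abs_def]
  by (rule Cinf_on_conv[OF assms(2) Cinf_on_bump compact_cball bump_eq_0[OF assms(1)]])

lemma moll_integrand_integrable:
  assumes "r > 0" "integrable (lebesgue_on \<Omega>) f"
  shows "integrable (lebesgue_on \<Omega>) (\<lambda>y. f y * bump r (x - y))"
  by (rule conv_integrable[OF assms(2) Cinf_on_continuous[OF Cinf_on_bump] compact_cball bump_eq_0[OF assms(1)]])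

lemma moll_measurable:
  assumes "r > 0" "integrable (lebesgue_on \<Omega>) f"
  shows "moll r \<Omega> f \<in> borel_measurable (lebesgue_on S)"
  by (intro lebesgue_on_measurable_continuous Cinf_on_continuous Cinf_on_moll assms)

lemma bump_reflect_test_function:
  fixes x :: "'a::euclidean_space"
  assumes "r > 0" "cball x r \<subseteq> \<Omega>"
  shows "(\<lambda>y. bump r (x - y)) \<in> test_functions \<Omega>"
proof (rule test_functionsI[of _ "cball x r"])
  show "Cinf_on UNIV (\<lambda>y. bump r (x - y))"
    unfolding Cinf_on_def
  proof
    fix k
    have "Ck_on k UNIV (bump r :: 'a \<Rightarrow> real)" using Cinf_on_bump unfolding Cinf_on_def by blast
    then have "Ck_on k UNIV (\<lambda>y. bump r (x + (-1) *\<^sub>R y))" by (intro Ck_on_affine) auto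
    then show "Ck_on k UNIV (\<lambda>y. bump r (x - y))" by simp
  qed
qed (use assms in \<open>auto simp: dist_norm norm_minus_commute intro!: bump_eq_0\<close>)

lemma pderiv_dir_reflect:
  assumes "f differentiable (at (x - y))"
  shows "pderiv_dir i (\<lambda>y. f (x - y)) y = - pderiv_dir i f (x - y)"
proof -
  have "((\<lambda>y. x - y) has_derivative uminus) (at y)" by (auto intro!: derivative_eq_intros)
  moreover have "(f has_derivative frechet_derivative f (at (x - y))) (at (x - y))"
    using assms frechet_derivative_works by auto
  ultimately have "((\<lambda>y. f (x - y)) has_derivative (\<lambda>h. frechet_derivative f (at (x - y)) (- h))) (at y)"
    by (rule has_derivative_compose)
  from pderiv_dir_eq[OF this] show ?thesis
    using linear_frechet_derivative[OF assms] by (simp add: pderiv_dir_def linear_neg)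
qed

text \<open>One sequence of radii serves finitely many functions. Errors below
  \<open>(1/2)^n\<close> give convergence almost everywhere besides convergence in the mean; the
  bound \<open>\<delta>\<close> lets callers keep the balls inside the domain.\<close>

lemma moll_sequence:
  fixes f :: "'i \<Rightarrow> 'a::euclidean_space \<Rightarrow> real"
  assumes \<Omega>: "\<Omega> \<in> sets lebesgue" and I: "finite I"
    and f: "\<And>i. i \<in> I \<Longrightarrow> integrable (lebesgue_on \<Omega>) (f i)" and "\<delta> > 0"
  shows "\<exists>r. (\<forall>n. 0 < r n \<and> r n < \<delta>) \<and> r \<longlonglongrightarrow> 0 \<and> (\<forall>i\<in>I.
    (AE x in lebesgue_on \<Omega>. (\<lambda>n. moll (r n) \<Omega> (f i) x) \<longlonglongrightarrow> f i x) \<and>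
    (\<lambda>n. \<integral>x. \<bar>moll (r n) \<Omega> (f i) x - f i x\<bar> \<partial>lebesgue_on \<Omega>) \<longlonglongrightarrow> 0 \<and>
    (\<forall>n. integrable (lebesgue_on \<Omega>) (moll (r n) \<Omega> (f i))))"
proof -
  let ?M = "lebesgue_on \<Omega>"
  have "\<exists>r>0. r < \<delta> \<and> r < (1/2)^n \<and> (\<forall>i\<in>I. (\<integral>\<^sup>+x. ennreal \<bar>moll r \<Omega> (f i) x - f i x\<bar> \<partial>?M) < ennreal ((1/2)^n))" for n
  proof -
    have "\<forall>\<^sub>F r in at_right 0. \<forall>i\<in>I. (\<integral>\<^sup>+x. ennreal \<bar>moll r \<Omega> (f i) x - f i x\<bar> \<partial>?M) < ennreal ((1/2)^n)"
      using I by (intro eventually_ball_finite ballI order_tendstoD(2)[OF moll_L1_convergence[OF \<Omega> f]]) auto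
    moreover have "\<forall>\<^sub>F r in at_right 0. 0 < r \<and> r < \<delta> \<and> r < (1/2)^n"
      using \<open>\<delta> > 0\<close> by (auto simp: eventually_at_right_field intro!: exI[of _ "min \<delta> ((1/2)^n)"])
    ultimately have "\<forall>\<^sub>F r in at_right 0. 0 < r \<and> r < \<delta> \<and> r < (1/2)^n \<and>
       (\<forall>i\<in>I. (\<integral>\<^sup>+x. ennreal \<bar>moll r \<Omega> (f i) x - f i x\<bar> \<partial>?M) < ennreal ((1/2)^n))"
      by eventually_elim auto
    from eventually_happens'[OF _ this] show ?thesis by auto
  qed
  then obtain r where r: "\<And>n. 0 < r n" "\<And>n. r n < \<delta>" "\<And>n. r n < (1/2)^n"
    and b: "\<And>n i. i \<in> I \<Longrightarrow> (\<integral>\<^sup>+x. ennreal \<bar>moll (r n) \<Omega> (f i) x - f i x\<bar> \<partial>?M) < ennreal ((1/2)^n)"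
    by metis
  have p0: "(\<lambda>n. (1/2)^n :: real) \<longlonglongrightarrow> 0" by (rule LIMSEQ_realpow_zero) auto
  have m: "(\<lambda>x. moll (r n) \<Omega> (f i) x - f i x) \<in> borel_measurable ?M" if "i \<in> I" for i n
    using moll_measurable[OF r(1) f[OF that]] borel_measurable_integrable[OF f[OF that]] by measurable
  have int: "integrable ?M (\<lambda>x. moll (r n) \<Omega> (f i) x - f i x)" if "i \<in> I" for i n
    using m[OF that] b[OF that, of n] by (auto simp: integrable_iff_bounded intro: order.strict_trans)
  show ?thesis
  proof (intro exI[of _ r] conjI ballI allI r)
    show "r \<longlonglongrightarrow> 0"
      by (rule tendsto_sandwich[OF _ _ tendsto_const p0])
        (auto intro!: always_eventually less_imp_le r)
    show "AE x in ?M. (\<lambda>n. moll (r n) \<Omega> (f i) x) \<longlonglongrightarrow> f i x" if "i \<in> I" for i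
    proof -
      have "AE x in ?M. (\<lambda>n. moll (r n) \<Omega> (f i) x - f i x) \<longlonglongrightarrow> 0"
        by (rule AE_tendsto_0_of_geometric_L1) (use m b that in \<open>auto intro: less_imp_le\<close>)
      then show ?thesis by (simp add: LIM_zero_iff)
    qed
    show "(\<lambda>n. \<integral>x. \<bar>moll (r n) \<Omega> (f i) x - f i x\<bar> \<partial>?M) \<longlonglongrightarrow> 0" if "i \<in> I" for i
    proof (rule tendsto_sandwich[OF _ _ tendsto_const p0])
      have "ennreal (\<integral>x. \<bar>moll (r n) \<Omega> (f i) x - f i x\<bar> \<partial>?M) < ennreal ((1/2)^n)" for n
        using b[OF that, of n] nn_integral_abs_eq_integral[OF int[OF that]] by simp
      then show "\<forall>\<^sub>F n in sequentially. (\<integral>x. \<bar>moll (r n) \<Omega> (f i) x - f i x\<bar> \<partial>?M) \<le> (1/2)^n"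
        by (intro always_eventually allI less_imp_le) (simp add: ennreal_less_iff)
    qed auto
    show "integrable ?M (moll (r n) \<Omega> (f i))" if "i \<in> I" for i n
      using Bochner_Integration.integrable_add[OF int[OF that] f[OF that], of n] by simp
  qed
qed

section \<open>Weak gradients\<close>

text \<open>In contrast to \<open>has_weak_grad\<close>, integrability on all of \<open>\<Omega>\<close> is required; it holds for the elements
  of Orlicz--Sobolev spaces on bounded domains.\<close>

definition wgrad :: "'a::euclidean_space set \<Rightarrow> ('a \<Rightarrow> real) \<Rightarrow> ('a \<Rightarrow> 'a) \<Rightarrow> bool" where
  "wgrad \<Omega> u G \<longleftrightarrow> integrable (lebesgue_on \<Omega>) u \<and>
     (\<forall>i\<in>Basis. integrable (lebesgue_on \<Omega>) (\<lambda>x. G x \<bullet> i) \<and>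
       (\<forall>\<psi>\<in>test_functions \<Omega>. (\<integral>x. u x * pderiv_dir i \<psi> x \<partial>lebesgue_on \<Omega>)
          = - (\<integral>x. (G x \<bullet> i) * \<psi> x \<partial>lebesgue_on \<Omega>)))"

lemma wgradD:
  assumes "wgrad \<Omega> u G"
  shows "integrable (lebesgue_on \<Omega>) u" "i \<in> Basis \<Longrightarrow> integrable (lebesgue_on \<Omega>) (\<lambda>x. G x \<bullet> i)"
    "i \<in> Basis \<Longrightarrow> \<psi> \<in> test_functions \<Omega> \<Longrightarrow> (\<integral>x. u x * pderiv_dir i \<psi> x \<partial>lebesgue_on \<Omega>)
          = - (\<integral>x. (G x \<bullet> i) * \<psi> x \<partial>lebesgue_on \<Omega>)"
  using assms by (auto simp: wgrad_def)

lemma integrable_lebesgue_on_subset: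
  fixes f :: "'a::euclidean_space \<Rightarrow> real"
  assumes "integrable (lebesgue_on \<Omega>) f" "S \<subseteq> \<Omega>" "S \<in> sets lebesgue" "\<Omega> \<in> sets lebesgue"
  shows "integrable (lebesgue_on S) f"
proof -
  have "integrable lebesgue (\<lambda>x. indicator \<Omega> x *\<^sub>R f x)"
    using assms(1,4) by (simp add: integrable_restrict_space)
  then have "integrable lebesgue (\<lambda>x. indicator S x *\<^sub>R (indicator \<Omega> x *\<^sub>R f x))"
    by (rule integrable_mult_indicator[OF assms(3)])
  moreover have "(\<lambda>x. indicator S x *\<^sub>R (indicator \<Omega> x *\<^sub>R f x)) = (\<lambda>x. indicator S x *\<^sub>R f x)"
    using assms(2) by (auto simp: indicator_def fun_eq_iff)
  ultimately show ?thesis using assms(3) by (simp add: integrable_restrict_space)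
qed

lemma lebesgue_on_support:
  fixes f :: "'a::euclidean_space \<Rightarrow> real"
  assumes "S \<subseteq> \<Omega>" "S \<in> sets lebesgue" "\<Omega> \<in> sets lebesgue" "\<And>x. x \<notin> S \<Longrightarrow> f x = 0"
  shows "integrable (lebesgue_on \<Omega>) f \<longleftrightarrow> integrable (lebesgue_on S) f"
    "(\<integral>x. f x \<partial>lebesgue_on \<Omega>) = (\<integral>x. f x \<partial>lebesgue_on S)"
    "(\<integral>x. f x \<partial>lebesgue_on \<Omega>) = (\<integral>x. f x \<partial>lebesgue)"
proof -
  have "(\<lambda>x. indicator \<Omega> x *\<^sub>R f x) = (\<lambda>x. indicator S x *\<^sub>R f x)" "(\<lambda>x. indicator \<Omega> x *\<^sub>R f x) = f"
    using assms(1,4) by (force simp: indicator_def fun_eq_iff)+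
  then show "integrable (lebesgue_on \<Omega>) f \<longleftrightarrow> integrable (lebesgue_on S) f"
    "(\<integral>x. f x \<partial>lebesgue_on \<Omega>) = (\<integral>x. f x \<partial>lebesgue_on S)"
    "(\<integral>x. f x \<partial>lebesgue_on \<Omega>) = (\<integral>x. f x \<partial>lebesgue)"
    using assms(2,3) by (simp_all only: integrable_restrict_space integral_restrict_space sets.Int_space_eq2 sets_completionI_sets)
qed

lemma test_functions_pderiv_bounded:
  assumes "\<psi> \<in> test_functions \<Omega>" "i \<in> Basis"
  shows "\<exists>B>0. \<forall>x. \<bar>pderiv_dir i \<psi> x\<bar> \<le> B"
  using test_functions_bounded[OF test_functions_pderiv_dir[OF assms]] by metis

lemma wgrad_imp_has_weak_grad:
  assumes "wgrad \<Omega> u G" "\<Omega> \<in> sets lebesgue"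
  shows "has_weak_grad \<Omega> u G"
proof -
  have "locally_integrable \<Omega> f" if "integrable (lebesgue_on \<Omega>) f" for f
    unfolding locally_integrable_def
    using integrable_lebesgue_on_subset[OF that _ _ assms(2)] lmeasurable_compact fmeasurableD by blast
  then show ?thesis using assms(1) by (simp add: wgrad_def has_weak_grad_def)
qed

lemma has_weak_grad_imp_wgrad:
  assumes "has_weak_grad \<Omega> u G" "integrable (lebesgue_on \<Omega>) u"
    "\<And>i. i \<in> Basis \<Longrightarrow> integrable (lebesgue_on \<Omega>) (\<lambda>x. G x \<bullet> i)"
  shows "wgrad \<Omega> u G"
  using assms by (simp add: wgrad_def has_weak_grad_def)

lemma locally_integrable_mult_test:
  assumes D: "locally_integrable \<Omega> D" and \<psi>: "\<psi> \<in> test_functions \<Omega>" and \<Omega>: "\<Omega> \<in> sets lebesgue"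
  shows "integrable (lebesgue_on \<Omega>) (\<lambda>x. D x * \<psi> x)"
proof -
  obtain K where K: "compact K" "K \<subseteq> \<Omega>" "\<And>x. x \<notin> K \<Longrightarrow> \<psi> x = 0"
    using test_functions_support[OF \<psi>] by blast
  obtain B where B: "\<And>x. \<bar>\<psi> x\<bar> \<le> B" using test_functions_bounded[OF \<psi>] by metis
  have "integrable (lebesgue_on K) (\<lambda>x. D x * \<psi> x)"
    using D K B by (intro integrable_mult_bounded[where B=B] test_functions_borel_measurable[OF \<psi>])
      (auto simp: locally_integrable_def)
  then show ?thesis
    using lebesgue_on_support(1)[of K \<Omega> "\<lambda>x. D x * \<psi> x"] K \<Omega> by (simp add: lmeasurable_compact fmeasurableD)
qed

text \<open>The fundamental lemma of the calculus of variations. A reflected bump is a test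
  function, so mollifications vanish at interior points for small radii, while they converge to
  \<open>D\<close> almost everywhere.\<close>

lemma locally_integrable_ae_zero:
  assumes \<Omega>: "open \<Omega>" and D: "locally_integrable \<Omega> D"
    and zero: "\<And>\<psi>. \<psi> \<in> test_functions \<Omega> \<Longrightarrow> (\<integral>x. D x * \<psi> x \<partial>lebesgue_on \<Omega>) = 0"
  shows "AE x in lebesgue_on \<Omega>. D x = 0"
proof -
  have \<Omega>m: "\<Omega> \<in> sets lebesgue" using \<Omega> by simp
  \<comment> \<open>\<open>D\<close> is only locally integrable, so it is mollified on a closed ball
    inside the domain, where it is integrable.\<close>
  have ball: "AE y in lebesgue. y \<in> ball x R \<longrightarrow> D y = 0" if R: "R > 0" "cball x R \<subseteq> \<Omega>" for x R
  proof -
    let ?S = "cball x R"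
    have Sm: "?S \<in> sets lebesgue" by simp
    have iS: "integrable (lebesgue_on ?S) D" using D R by (simp add: locally_integrable_def)
    obtain r where r: "\<And>n. 0 < r n" "r \<longlonglongrightarrow> 0"
      "AE y in lebesgue_on ?S. (\<lambda>n. moll (r n) ?S D y) \<longlonglongrightarrow> D y"
      using moll_sequence[OF Sm, of "{()}" "\<lambda>_. D" 1] iS by auto
    have z: "moll \<rho> ?S D y = 0" if "\<rho> > 0" "cball y \<rho> \<subseteq> ?S" for y \<rho>
    proof -
      have "(\<lambda>z. bump \<rho> (y - z)) \<in> test_functions \<Omega>"
        using bump_reflect_test_function[OF that(1)] that(2) R(2) by blast
      then have "(\<integral>z. D z * bump \<rho> (y - z) \<partial>lebesgue_on \<Omega>) = 0" by (rule zero)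
      moreover have "bump \<rho> (y - z) = 0" if "z \<notin> ?S" for z
      proof -
        have "z \<notin> cball y \<rho>" using that \<open>cball y \<rho> \<subseteq> ?S\<close> by blast
        then show ?thesis by (intro bump_eq_0 \<open>\<rho> > 0\<close>) (simp add: dist_norm[of y z])
      qed
      ultimately show ?thesis
        unfolding moll_def using lebesgue_on_support(2)[OF R(2) Sm \<Omega>m, of "\<lambda>z. D z * bump \<rho> (y - z)"] by simp
    qed
    have "AE y in lebesgue. y \<in> ?S \<longrightarrow> (\<lambda>n. moll (r n) ?S D y) \<longlonglongrightarrow> D y"
      using r(3) Sm by (simp add: AE_restrict_space_iff)
    then show ?thesis
    proof eventually_elim
      case (elim y)
      show ?case
      proof
        assume y: "y \<in> ball x R"
        then have lim: "(\<lambda>n. moll (r n) ?S D y) \<longlonglongrightarrow> D y" using elim by auto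
        have "\<forall>\<^sub>F n in sequentially. r n < R - dist x y"
          using order_tendstoD(2)[OF r(2), of "R - dist x y"] y by simp
        then have "\<forall>\<^sub>F n in sequentially. moll (r n) ?S D y = 0"
        proof eventually_elim
          case (elim n)
          have "cball y (r n) \<subseteq> ?S"
          proof
            fix z assume "z \<in> cball y (r n)"
            then show "z \<in> ?S" using dist_triangle[of x z y] elim by simp
          qed
          then show ?case using z r(1) by blast
        qed
        then have "(\<lambda>n. moll (r n) ?S D y) \<longlonglongrightarrow> 0" by (rule tendsto_eventually)
        with lim show "D y = 0" by (rule LIMSEQ_unique)
      qed
    qed
  qed
  \<comment> \<open>Exceptional null sets can be united over countably many balls only, so a
    countable subcover is extracted first.\<close>
  let ?F = "{ball x R | x R. R > 0 \<and> cball x R \<subseteq> \<Omega>}"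
  have "\<And>S. S \<in> ?F \<Longrightarrow> open S" by auto
  then obtain F where F: "F \<subseteq> ?F" "countable F" "\<Union>F = \<Union>?F" by (rule Lindelof)
  have ae: "AE y in lebesgue. \<forall>S\<in>F. y \<in> S \<longrightarrow> D y = 0"
    using F(1,2) ball by (subst AE_ball_countable) auto
  have sub: "\<Omega> \<subseteq> \<Union>F"
  proof
    fix x assume "x \<in> \<Omega>"
    then obtain R where "R > 0" "cball x R \<subseteq> \<Omega>" using \<Omega> unfolding open_contains_cball by blast
    then show "x \<in> \<Union>F" unfolding F(3) by (auto intro!: exI[of _ "ball x R"])
  qed
  have "AE y in lebesgue. y \<in> \<Omega> \<longrightarrow> D y = 0"
    using ae
  proof eventually_elim
    case (elim y)
    then show ?case using sub by blast
  qed
  then show ?thesis using \<Omega>m by (simp add: AE_restrict_space_iff)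
qed

section \<open>Uniqueness of the weak gradient\<close>

lemma has_weak_grad_unique:
  assumes \<Omega>: "open \<Omega>" and G: "has_weak_grad \<Omega> u G" and H: "has_weak_grad \<Omega> u H"
  shows "AE x in lebesgue_on \<Omega>. G x = H x"
proof -
  have \<Omega>m: "\<Omega> \<in> sets lebesgue" using \<Omega> by simp
  have "AE x in lebesgue_on \<Omega>. (G x \<bullet> i) - (H x \<bullet> i) = 0" if i: "i \<in> Basis" for i
  proof (rule locally_integrable_ae_zero[OF \<Omega>])
    show "locally_integrable \<Omega> (\<lambda>x. G x \<bullet> i - H x \<bullet> i)"
      using G H i by (auto simp: has_weak_grad_def locally_integrable_def)
    fix \<psi> assume \<psi>: "\<psi> \<in> test_functions \<Omega>"
    have "integrable (lebesgue_on \<Omega>) (\<lambda>x. (G x \<bullet> i) * \<psi> x)" "integrable (lebesgue_on \<Omega>) (\<lambda>x. (H x \<bullet> i) * \<psi> x)"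
      using G H i \<psi> \<Omega>m by (auto simp: has_weak_grad_def intro!: locally_integrable_mult_test)
    moreover have "(\<integral>x. u x * pderiv_dir i \<psi> x \<partial>lebesgue_on \<Omega>) = - (\<integral>x. (G x \<bullet> i) * \<psi> x \<partial>lebesgue_on \<Omega>)"
      using G i \<psi> unfolding has_weak_grad_def by blast
    moreover have "(\<integral>x. u x * pderiv_dir i \<psi> x \<partial>lebesgue_on \<Omega>) = - (\<integral>x. (H x \<bullet> i) * \<psi> x \<partial>lebesgue_on \<Omega>)"
      using H i \<psi> unfolding has_weak_grad_def by blast
    ultimately show "(\<integral>x. (G x \<bullet> i - H x \<bullet> i) * \<psi> x \<partial>lebesgue_on \<Omega>) = 0"
      by (simp add: left_diff_distrib)
  qed
  then have "AE x in lebesgue_on \<Omega>. \<forall>i\<in>Basis. (G x \<bullet> i) - (H x \<bullet> i) = 0"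
    by (intro AE_finite_allI) auto
  then show ?thesis by eventually_elim (auto intro: euclidean_eqI)
qed

text \<open>Since \<open>weak_grad\<close> is a choice, an explicitly computed gradient can replace
  it only almost everywhere; this is the bridge between the two.\<close>

lemma weak_grad_eq:
  assumes "open \<Omega>" "wgrad \<Omega> u G"
  shows "AE x in lebesgue_on \<Omega>. weak_grad \<Omega> u x = G x"
proof -
  have G: "has_weak_grad \<Omega> u G" using assms by (simp add: wgrad_imp_has_weak_grad)
  then have "has_weak_grad \<Omega> u (weak_grad \<Omega> u)" unfolding weak_grad_def by (rule someI[of "has_weak_grad \<Omega> u"])
  then show ?thesis using G by (rule has_weak_grad_unique[OF assms(1)])
qed

lemma wgrad_unique:
  assumes "open \<Omega>" "wgrad \<Omega> u G" "wgrad \<Omega> u H"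
  shows "AE x in lebesgue_on \<Omega>. G x = H x"
  using assms by (intro has_weak_grad_unique[OF assms(1), of u] wgrad_imp_has_weak_grad) auto

section \<open>Linearity of weak gradients and stability under limits\<close>

lemma integrable_mult_test_function:
  assumes "integrable (lebesgue_on \<Omega>) u" "\<psi> \<in> test_functions \<Omega>'"
  shows "integrable (lebesgue_on \<Omega>) (\<lambda>x. u x * \<psi> x)"
proof -
  obtain B where B: "\<And>x. \<bar>\<psi> x\<bar> \<le> B" using test_functions_bounded[OF assms(2)] by metis
  show ?thesis by (rule integrable_mult_bounded[OF assms(1) test_functions_borel_measurable[OF assms(2)], of B]) (simp add: B)
qed

lemma wgrad_lincomb:
  assumes u: "wgrad \<Omega> u G" and v: "wgrad \<Omega> v H"
  shows "wgrad \<Omega> (\<lambda>x. a * u x + b * v x) (\<lambda>x. a *\<^sub>R G x + b *\<^sub>R H x)"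
  unfolding wgrad_def
proof (intro conjI ballI)
  show "integrable (lebesgue_on \<Omega>) (\<lambda>x. a * u x + b * v x)" using wgradD(1)[OF u] wgradD(1)[OF v] by auto
  fix i :: 'a assume i: "i \<in> Basis"
  show "integrable (lebesgue_on \<Omega>) (\<lambda>x. (a *\<^sub>R G x + b *\<^sub>R H x) \<bullet> i)"
    using wgradD(2)[OF u i] wgradD(2)[OF v i] by (auto simp: inner_add_left)
  fix \<psi> assume \<psi>: "\<psi> \<in> test_functions \<Omega>"
  note i1 = integrable_mult_test_function[OF _ \<psi>] integrable_mult_test_function[OF _ test_functions_pderiv_dir[OF \<psi> i]]
  have "(\<integral>x. (a * u x + b * v x) * pderiv_dir i \<psi> x \<partial>lebesgue_on \<Omega>)
     = (\<integral>x. a * (u x * pderiv_dir i \<psi> x) + b * (v x * pderiv_dir i \<psi> x) \<partial>lebesgue_on \<Omega>)"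
    by (simp add: algebra_simps)
  also have "\<dots> = a * (\<integral>x. u x * pderiv_dir i \<psi> x \<partial>lebesgue_on \<Omega>) + b * (\<integral>x. v x * pderiv_dir i \<psi> x \<partial>lebesgue_on \<Omega>)"
    using i1(2)[OF wgradD(1)[OF u]] i1(2)[OF wgradD(1)[OF v]] by simp
  also have "\<dots> = - (a * (\<integral>x. (G x \<bullet> i) * \<psi> x \<partial>lebesgue_on \<Omega>) + b * (\<integral>x. (H x \<bullet> i) * \<psi> x \<partial>lebesgue_on \<Omega>))"
    using wgradD(3)[OF u i \<psi>] wgradD(3)[OF v i \<psi>] by simp
  also have "\<dots> = - (\<integral>x. a * ((G x \<bullet> i) * \<psi> x) + b * ((H x \<bullet> i) * \<psi> x) \<partial>lebesgue_on \<Omega>)"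
    using i1(1)[OF wgradD(2)[OF u i]] i1(1)[OF wgradD(2)[OF v i]] by simp
  also have "\<dots> = - (\<integral>x. ((a *\<^sub>R G x + b *\<^sub>R H x) \<bullet> i) * \<psi> x \<partial>lebesgue_on \<Omega>)"
    by (simp add: algebra_simps)
  finally show "(\<integral>x. (a * u x + b * v x) * pderiv_dir i \<psi> x \<partial>lebesgue_on \<Omega>)
     = - (\<integral>x. ((a *\<^sub>R G x + b *\<^sub>R H x) \<bullet> i) * \<psi> x \<partial>lebesgue_on \<Omega>)" .
qed

lemma wgrad_cong_AE:
  assumes u: "wgrad \<Omega> u G" and eq: "AE x in lebesgue_on \<Omega>. u x = v x" "AE x in lebesgue_on \<Omega>. G x = H x"
    and m: "v \<in> borel_measurable (lebesgue_on \<Omega>)" "\<And>i. i \<in> Basis \<Longrightarrow> (\<lambda>x. H x \<bullet> i) \<in> borel_measurable (lebesgue_on \<Omega>)"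
  shows "wgrad \<Omega> v H"
  unfolding wgrad_def
proof (intro conjI ballI)
  show "integrable (lebesgue_on \<Omega>) v" using wgradD(1)[OF u] m(1) eq(1) by (rule integrable_cong_AE_imp) 
  fix i :: 'a assume i: "i \<in> Basis"
  have eqi: "AE x in lebesgue_on \<Omega>. G x \<bullet> i = H x \<bullet> i" using eq(2) by eventually_elim simp
  show "integrable (lebesgue_on \<Omega>) (\<lambda>x. H x \<bullet> i)"
    using wgradD(2)[OF u i] m(2)[OF i] eqi by (rule integrable_cong_AE_imp)
  fix \<psi> assume \<psi>: "\<psi> \<in> test_functions \<Omega>"
  note [measurable] = test_functions_borel_measurable[OF \<psi>, of \<Omega>]
    test_functions_borel_measurable[OF test_functions_pderiv_dir[OF \<psi> i], of \<Omega>] m(1)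
    borel_measurable_integrable[OF wgradD(1)[OF u]]
  have "(\<integral>x. v x * pderiv_dir i \<psi> x \<partial>lebesgue_on \<Omega>) = (\<integral>x. u x * pderiv_dir i \<psi> x \<partial>lebesgue_on \<Omega>)"
    by (rule integral_cong_AE) (measurable, use eq(1) in eventually_elim, simp)
  also have "\<dots> = - (\<integral>x. (G x \<bullet> i) * \<psi> x \<partial>lebesgue_on \<Omega>)" by (rule wgradD(3)[OF u i \<psi>])
  also have "(\<integral>x. (G x \<bullet> i) * \<psi> x \<partial>lebesgue_on \<Omega>) = (\<integral>x. (H x \<bullet> i) * \<psi> x \<partial>lebesgue_on \<Omega>)"
  proof (rule integral_cong_AE)
    show "(\<lambda>x. (G x \<bullet> i) * \<psi> x) \<in> borel_measurable (lebesgue_on \<Omega>)"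
      by (rule borel_measurable_times[OF borel_measurable_integrable[OF wgradD(2)[OF u i]] test_functions_borel_measurable[OF \<psi>]])
    show "(\<lambda>x. (H x \<bullet> i) * \<psi> x) \<in> borel_measurable (lebesgue_on \<Omega>)"
      by (rule borel_measurable_times[OF m(2)[OF i] test_functions_borel_measurable[OF \<psi>]])
    show "AE x in lebesgue_on \<Omega>. (G x \<bullet> i) * \<psi> x = (H x \<bullet> i) * \<psi> x"
      using eqi by eventually_elim simp
  qed
  finally show "(\<integral>x. v x * pderiv_dir i \<psi> x \<partial>lebesgue_on \<Omega>) = - (\<integral>x. (H x \<bullet> i) * \<psi> x \<partial>lebesgue_on \<Omega>)" .
qed

text \<open>Test functions and their derivatives are bounded, so dominated convergence passes to the
  limit on both sides of the defining identity. Functions with a corner or a singular point are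
  reached from smoother ones in this way.\<close>

lemma wgrad_dominated_limit:
  assumes u: "\<And>n. wgrad \<Omega> (U n) (G n)"
    and lim: "AE x in lebesgue_on \<Omega>. (\<lambda>n. U n x) \<longlonglongrightarrow> u x" "AE x in lebesgue_on \<Omega>. (\<lambda>n. G n x) \<longlonglongrightarrow> H x"
    and w: "integrable (lebesgue_on \<Omega>) w" "integrable (lebesgue_on \<Omega>) w'"
    and bound: "\<And>n. AE x in lebesgue_on \<Omega>. \<bar>U n x\<bar> \<le> w x"
      "\<And>n. AE x in lebesgue_on \<Omega>. norm (G n x) \<le> w' x"
    and m: "u \<in> borel_measurable (lebesgue_on \<Omega>)" "\<And>i. i \<in> Basis \<Longrightarrow> (\<lambda>x. H x \<bullet> i) \<in> borel_measurable (lebesgue_on \<Omega>)"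
  shows "wgrad \<Omega> u H"
  unfolding wgrad_def
proof (intro conjI ballI)
  let ?M = "lebesgue_on \<Omega>"
  have um: "U n \<in> borel_measurable ?M" for n using wgradD(1)[OF u] by auto
  show "integrable ?M u"
    by (rule integrable_dominated_convergence[OF m(1) um w(1) lim(1)]) (use bound(1) in simp)
  fix i :: 'a assume i: "i \<in> Basis"
  have gm: "(\<lambda>x. G n x \<bullet> i) \<in> borel_measurable ?M" for n using wgradD(2)[OF u i] by auto
  have limi: "AE x in ?M. (\<lambda>n. G n x \<bullet> i) \<longlonglongrightarrow> H x \<bullet> i"
    using lim(2) by eventually_elim (rule tendsto_inner[OF _ tendsto_const])
  have boundi: "AE x in ?M. norm (G n x \<bullet> i) \<le> w' x" for n
    using bound(2)[of n] by eventually_elim (use Basis_le_norm[OF i] in \<open>auto intro: order_trans\<close>)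
  show "integrable ?M (\<lambda>x. H x \<bullet> i)"
    by (rule integrable_dominated_convergence[OF m(2)[OF i] gm w(2) limi boundi])
  fix \<psi> assume \<psi>: "\<psi> \<in> test_functions \<Omega>"
  obtain B where B: "\<And>x. \<bar>\<psi> x\<bar> \<le> B" using test_functions_bounded[OF \<psi>] by metis
  obtain B' where B': "\<And>x. \<bar>pderiv_dir i \<psi> x\<bar> \<le> B'" using test_functions_pderiv_bounded[OF \<psi> i] by metis
  note [measurable] = test_functions_borel_measurable[OF \<psi>, of \<Omega>] m(1) m(2)[OF i] um gm
    test_functions_borel_measurable[OF test_functions_pderiv_dir[OF \<psi> i], of \<Omega>]
  have 1: "(\<lambda>n. \<integral>x. U n x * pderiv_dir i \<psi> x \<partial>?M) \<longlonglongrightarrow> (\<integral>x. u x * pderiv_dir i \<psi> x \<partial>?M)"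
  proof (rule integral_dominated_convergence[where w="\<lambda>x. w x * B'"])
    show "AE x in ?M. (\<lambda>n. U n x * pderiv_dir i \<psi> x) \<longlonglongrightarrow> u x * pderiv_dir i \<psi> x"
      using lim(1) by eventually_elim (intro tendsto_intros)
    show "AE x in ?M. norm (U n x * pderiv_dir i \<psi> x) \<le> w x * B'" for n
      using bound(1)[of n]
    proof eventually_elim
      case (elim x)
      then show ?case unfolding real_norm_def abs_mult using B'[of x] by (intro mult_mono) auto
    qed
  qed (use w in auto)
  have 2: "(\<lambda>n. \<integral>x. (G n x \<bullet> i) * \<psi> x \<partial>?M) \<longlonglongrightarrow> (\<integral>x. (H x \<bullet> i) * \<psi> x \<partial>?M)"
  proof (rule integral_dominated_convergence[where w="\<lambda>x. w' x * B"])
    show "AE x in ?M. (\<lambda>n. (G n x \<bullet> i) * \<psi> x) \<longlonglongrightarrow> (H x \<bullet> i) * \<psi> x"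
      using limi by eventually_elim (rule tendsto_mult[OF _ tendsto_const])
    show "AE x in ?M. norm ((G n x \<bullet> i) * \<psi> x) \<le> w' x * B" for n
      using boundi[of n]
    proof eventually_elim
      case (elim x)
      then show ?case unfolding real_norm_def abs_mult using B[of x] by (intro mult_mono) auto
    qed
  qed (use w in auto)
  from 1 have "(\<lambda>n. - (\<integral>x. (G n x \<bullet> i) * \<psi> x \<partial>?M)) \<longlonglongrightarrow> (\<integral>x. u x * pderiv_dir i \<psi> x \<partial>?M)"
    unfolding wgradD(3)[OF u i \<psi>] .
  from LIMSEQ_unique[OF this tendsto_minus[OF 2]]
  show "(\<integral>x. u x * pderiv_dir i \<psi> x \<partial>?M) = - (\<integral>x. (H x \<bullet> i) * \<psi> x \<partial>?M)" .
qed

section \<open>The chain rule\<close>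

text \<open>When the ball lies in the domain, the reflected kernel is an admissible test function;
  the sign from reflecting its derivative cancels the sign in the definition of the weak
  gradient.\<close>

lemma moll_pderiv_dir:
  assumes u: "wgrad \<Omega> u G" and r: "r > 0" "cball x r \<subseteq> \<Omega>" and i: "i \<in> Basis"
  shows "pderiv_dir i (moll r \<Omega> u) x = moll r \<Omega> (\<lambda>y. G y \<bullet> i) x"
proof -
  let ?\<psi> = "\<lambda>y. bump r (x - y)"
  have d: "pderiv_dir i ?\<psi> y = - pderiv_dir i (bump r) (x - y)" for y
    by (intro pderiv_dir_reflect Cinf_on_differentiable Cinf_on_bump)
  have "pderiv_dir i (moll r \<Omega> u) x = (\<integral>y. u y * pderiv_dir i (bump r) (x - y) \<partial>lebesgue_on \<Omega>)"
    unfolding moll_def[abs_def]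
    by (subst conv_pderiv_dir[OF wgradD(1)[OF u] Cinf_on_bump compact_cball[of 0 r] bump_eq_0[OF r(1)] i]) auto
  also have "\<dots> = - (\<integral>y. u y * pderiv_dir i ?\<psi> y \<partial>lebesgue_on \<Omega>)"
    unfolding d by simp
  also have "\<dots> = moll r \<Omega> (\<lambda>y. G y \<bullet> i) x"
    using wgradD(3)[OF u i bump_reflect_test_function[OF r]] by (simp add: moll_def)
  finally show ?thesis .
qed

lemma bump_mass:
  assumes r: "r > 0" "cball x r \<subseteq> \<Omega>" and \<Omega>: "\<Omega> \<in> sets lebesgue"
  shows "(\<integral>y. bump r (x - y) \<partial>lebesgue_on \<Omega>) = 1"
proof -
  have "(\<integral>y. bump r (x - y) \<partial>lebesgue_on \<Omega>) = (\<integral>y. bump r (x - y) \<partial>lebesgue)"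
    by (rule lebesgue_on_support(3)[OF r(2) _ \<Omega>]) (auto simp: dist_norm[of x] intro!: bump_eq_0 r(1))
  also have "\<dots> = (\<integral>y. bump r (x - y) \<partial>lborel)" by (rule integral_completion) measurable
  also have "\<dots> = 1" using integral_bump[OF r(1)] by (subst lborel_integral_reflect) auto
  finally show ?thesis .
qed

lemma moll_ge_const:
  assumes r: "r > 0" "cball x r \<subseteq> \<Omega>" and \<Omega>: "\<Omega> \<in> sets lebesgue"
    and f: "integrable (lebesgue_on \<Omega>) f" and le: "AE y in lebesgue_on \<Omega>. b \<le> f y"
  shows "b \<le> moll r \<Omega> f x"
proof -
  have ib: "integrable (lebesgue_on \<Omega>) (\<lambda>y. bump r (x - y))"
    using bump_mass[OF r \<Omega>] not_integrable_integral_eq by fastforce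
  have "b = (\<integral>y. b * bump r (x - y) \<partial>lebesgue_on \<Omega>)" using bump_mass[OF r \<Omega>] by simp
  also have "\<dots> \<le> moll r \<Omega> f x"
    unfolding moll_def
  proof (rule integral_mono_AE)
    show "AE y in lebesgue_on \<Omega>. b * bump r (x - y) \<le> f y * bump r (x - y)"
      using le by eventually_elim (intro mult_right_mono bump_nonneg r)
  qed (use ib moll_integrand_integrable[OF r(1) f] in auto)
  finally show ?thesis .
qed

lemma moll_lincomb:
  assumes "r > 0" "integrable (lebesgue_on \<Omega>) f" "integrable (lebesgue_on \<Omega>) g"
  shows "moll r \<Omega> (\<lambda>y. a * f y + b * g y) x = a * moll r \<Omega> f x + b * moll r \<Omega> g x"
proof -
  have "(a * f y + b * g y) * bump r (x - y) = a * (f y * bump r (x - y)) + b * (g y * bump r (x - y))" for y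
    by (simp add: algebra_simps)
  then show ?thesis
    using moll_integrand_integrable[OF assms(1,2)] moll_integrand_integrable[OF assms(1,3)] by (simp add: moll_def)
qed

text \<open>Averages of values in a closed convex set stay in it: a separating half-plane reduces
  this to the scalar bound \<open>moll_ge_const\<close>. The chain rule depends on it, as its outer
  function is controlled on \<open>C\<close> only.\<close>

lemma moll_in_closed_convex:
  fixes C :: "(real \<times> real) set"
  assumes r: "r > 0" "cball x r \<subseteq> \<Omega>" and \<Omega>: "\<Omega> \<in> sets lebesgue"
    and f: "integrable (lebesgue_on \<Omega>) f" and g: "integrable (lebesgue_on \<Omega>) g"
    and C: "closed C" "convex C" "AE y in lebesgue_on \<Omega>. (f y, g y) \<in> C"
  shows "(moll r \<Omega> f x, moll r \<Omega> g x) \<in> C"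
proof (rule ccontr)
  let ?z = "(moll r \<Omega> f x, moll r \<Omega> g x)"
  assume "?z \<notin> C"
  then obtain a b where ab: "a \<bullet> ?z < b" "\<And>p. p \<in> C \<Longrightarrow> b < a \<bullet> p"
    using separating_hyperplane_closed_point[OF C(2,1)] by metis
  have "b \<le> moll r \<Omega> (\<lambda>y. fst a * f y + snd a * g y) x"
  proof (rule moll_ge_const[OF r \<Omega>])
    show "AE y in lebesgue_on \<Omega>. b \<le> fst a * f y + snd a * g y"
      using C(3)
    proof eventually_elim
      case (elim y)
      from ab(2)[OF elim] show ?case by (cases a) auto
    qed
  qed (use f g in auto)
  also have "\<dots> = a \<bullet> ?z" using moll_lincomb[OF r(1) f g] by (cases a) auto
  finally show False using ab(1) by simp
qed

section \<open>Integration by parts against a test function\<close>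

lemma continuous_on_mult_support:
  fixes a b :: "'a::euclidean_space \<Rightarrow> real"
  assumes "continuous_on V a" "continuous_on UNIV b" "open V" "closed K" "K \<subseteq> V" "\<And>x. x \<notin> K \<Longrightarrow> b x = 0"
  shows "continuous_on UNIV (\<lambda>x. a x * b x)"
proof -
  have "continuous_on V (\<lambda>x. a x * b x)"
    using assms(1,2) by (intro continuous_intros) (auto intro: continuous_on_subset)
  moreover have "continuous_on (-K) (\<lambda>x. a x * b x)"
    by (rule continuous_on_eq[where f="\<lambda>_. 0"]) (auto simp: assms(6))
  ultimately have "continuous_on (V \<union> -K) (\<lambda>x. a x * b x)"
    using assms(3,4) by (intro continuous_on_open_Un) auto
  moreover have "V \<union> -K = UNIV" using assms(5) by auto
  ultimately show ?thesis by simp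
qed

text \<open>Although \<open>g\<close> is regular only near the support of \<open>\<psi>\<close>, the
  product of both is differentiable everywhere, with a continuous compactly supported derivative in
  direction \<open>i\<close>, and that derivative integrates to 0.\<close>

lemma test_function_integration_by_parts:
  assumes \<Omega>: "\<Omega> \<in> sets lebesgue" and \<psi>: "\<psi> \<in> test_functions \<Omega>" and i: "i \<in> Basis"
    and K: "compact K" "K \<subseteq> \<Omega>" "\<And>x. x \<notin> K \<Longrightarrow> \<psi> x = 0" and V: "open V" "K \<subseteq> V"
    and g: "\<And>x. x \<in> V \<Longrightarrow> g differentiable (at x)" "continuous_on V (pderiv_dir i g)"
  shows "(\<integral>x. g x * pderiv_dir i \<psi> x \<partial>lebesgue_on \<Omega>) = - (\<integral>x. pderiv_dir i g x * \<psi> x \<partial>lebesgue_on \<Omega>)"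
proof -
  have Kc: "closed K" using K(1) by (rule compact_imp_closed)
  have Km: "K \<in> sets lebesgue" using K(1) by (simp add: lmeasurable_compact fmeasurableD)
  note \<psi>C = test_functions_Cinf[OF \<psi>]
  let ?F = "\<lambda>x. g x * \<psi> x"
  have D\<psi>0: "pderiv_dir i \<psi> x = 0" if "x \<notin> K" for x
    using K(3) Kc that by (rule pderiv_dir_zero_outside)
  have contg: "continuous_on V g"
    using g(1) V(1) by (auto simp: continuous_on_eq_continuous_at intro: differentiable_imp_continuous_within)
  have F0: "pderiv_dir i ?F x = 0" if "x \<notin> K" for x
    by (rule pderiv_dir_zero_outside[of K]) (use K(3) Kc that in auto)
  have DF: "pderiv_dir i ?F x = g x * pderiv_dir i \<psi> x + pderiv_dir i g x * \<psi> x" for x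
  proof (cases "x \<in> V")
    case True
    then show ?thesis using g(1) Cinf_on_differentiable[OF \<psi>C] by (intro pderiv_dir_mult)
  next
    case False
    then have "x \<notin> K" using V by auto
    then show ?thesis using F0 D\<psi>0 K(3) by simp
  qed
  have Fd: "?F differentiable (at x)" for x
  proof (cases "x \<in> V")
    case True
    then show ?thesis using g(1) Cinf_on_differentiable[OF \<psi>C] by (intro differentiable_mult)
  next
    case False
    then have x: "x \<notin> K" using V by auto
    have "((\<lambda>_. 0::real) has_derivative (\<lambda>_. 0)) (at x)" by (rule has_derivative_const)
    then have "(?F has_derivative (\<lambda>_. 0)) (at x)"
      by (rule has_derivative_transform_within_open[where s="-K"]) (use Kc x K(3) in auto)
    then show ?thesis by (auto simp: differentiable_def)
  qed
  have c1: "continuous_on UNIV (\<lambda>x. g x * pderiv_dir i \<psi> x)"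
    by (rule continuous_on_mult_support[OF contg Cinf_on_continuous[OF Cinf_on_pderiv_dir[OF \<psi>C i]] V(1) Kc V(2) D\<psi>0])
  have c2: "continuous_on UNIV (\<lambda>x. pderiv_dir i g x * \<psi> x)"
    by (rule continuous_on_mult_support[OF g(2) Cinf_on_continuous[OF \<psi>C] V(1) Kc V(2) K(3)])
  have 0: "(\<integral>x. pderiv_dir i ?F x \<partial>lborel) = 0"
  proof (rule integral_pderiv_dir_eq_0[OF Fd _ K(1) _ i])
    show "continuous_on UNIV (pderiv_dir i ?F)"
      unfolding DF[abs_def] by (rule continuous_on_add[OF c1 c2])
  qed (use K(3) in auto)
  have int: "(\<integral>x. f x \<partial>lebesgue_on \<Omega>) = (\<integral>x. f x \<partial>lborel)" "integrable lborel f"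
    if "continuous_on UNIV f" "\<And>x. x \<notin> K \<Longrightarrow> f x = 0" for f :: "'a \<Rightarrow> real"
  proof -
    show "integrable lborel f" using that K(1) by (intro continuous_compact_support_integrable)
    then have "(\<integral>x. f x \<partial>lebesgue) = (\<integral>x. f x \<partial>lborel)" by (intro integral_completion) auto
    then show "(\<integral>x. f x \<partial>lebesgue_on \<Omega>) = (\<integral>x. f x \<partial>lborel)"
      using lebesgue_on_support(3)[OF K(2) Km \<Omega> that(2)] by simp
  qed
  have "(\<integral>x. g x * pderiv_dir i \<psi> x \<partial>lborel) + (\<integral>x. pderiv_dir i g x * \<psi> x \<partial>lborel) = 0"
    using 0 int(2)[OF c1] int(2)[OF c2] D\<psi>0 K(3) unfolding DF by simp
  then show ?thesis using int(1)[OF c1] int(1)[OF c2] D\<psi>0 K(3) by simp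
qed

lemma convex_Lipschitz_of_gradient_bound:
  fixes h ha hb :: "real \<times> real \<Rightarrow> real"
  assumes C: "convex C"
    and der: "\<And>p. p \<in> C \<Longrightarrow> (h has_derivative (\<lambda>q. ha p * fst q + hb p * snd q)) (at p)"
    and bound: "\<And>p. p \<in> C \<Longrightarrow> \<bar>ha p\<bar> \<le> L" "\<And>p. p \<in> C \<Longrightarrow> \<bar>hb p\<bar> \<le> L"
    and pq: "p \<in> C" "q \<in> C"
  shows "\<bar>h p - h q\<bar> \<le> 2 * L * (\<bar>fst p - fst q\<bar> + \<bar>snd p - snd q\<bar>)"
proof -
  have L: "L \<ge> 0" using bound(1)[OF pq(1)] by linarith
  \<comment> \<open>Each of the two partial derivatives contributes at most \<open>L\<close> to the
    operator norm.\<close>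
  have "norm (h p - h q) \<le> (2 * L) * norm (p - q)"
  proof (rule differentiable_bound[OF C _ _ pq])
    fix x assume x: "x \<in> C"
    show "(h has_derivative (\<lambda>q. ha x * fst q + hb x * snd q)) (at x within C)"
      using der[OF x] by (rule has_derivative_at_withinI)
    show "onorm (\<lambda>q. ha x * fst q + hb x * snd q) \<le> 2 * L"
    proof (rule onorm_le)
      fix q :: "real \<times> real"
      have "\<bar>ha x * fst q\<bar> \<le> L * norm q" "\<bar>hb x * snd q\<bar> \<le> L * norm q"
        unfolding abs_mult using bound[OF x] norm_fst_le[of "fst q" "snd q"] norm_snd_le[of "snd q" "fst q"] L
        by (auto intro!: mult_mono)
      then show "norm (ha x * fst q + hb x * snd q) \<le> 2 * L * norm q" by simp
    qed
  qed
  moreover have "norm (p - q) \<le> \<bar>fst p - fst q\<bar> + \<bar>snd p - snd q\<bar>"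
    using norm_Pair_le[of "fst p - fst q" "snd p - snd q"] by (simp add: minus_prod_def)
  ultimately show ?thesis using L mult_left_mono[of "norm (p - q)" _ "2 * L"] by fastforce
qed

text \<open>Both functions are mollified, the classical chain rule and integration by parts are used
  near the support of the test function, and the radius tends to 0. The majorants contain the
  mollified functions and hence vary with \<open>n\<close>; they converge in the mean, as
  \<open>generalized_dominated_convergence\<close> requires.\<close>

lemma wgrad_chain:
  fixes \<Omega> :: "'a::euclidean_space set" and h ha hb :: "real \<times> real \<Rightarrow> real"
  assumes \<Omega>: "open \<Omega>" "bounded \<Omega>" and u: "wgrad \<Omega> u G" and v: "wgrad \<Omega> v H"
    and C: "closed C" "convex C" "AE x in lebesgue_on \<Omega>. (u x, v x) \<in> C" "p0 \<in> C"
    and der: "\<And>p. p \<in> C \<Longrightarrow> (h has_derivative (\<lambda>q. ha p * fst q + hb p * snd q)) (at p)"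
    and cont: "continuous_on C ha" "continuous_on C hb"
    and bound: "\<And>p. p \<in> C \<Longrightarrow> \<bar>ha p\<bar> \<le> L" "\<And>p. p \<in> C \<Longrightarrow> \<bar>hb p\<bar> \<le> L"
    and meas: "h \<in> borel_measurable borel" "ha \<in> borel_measurable borel" "hb \<in> borel_measurable borel"
  shows "wgrad \<Omega> (\<lambda>x. h (u x, v x)) (\<lambda>x. ha (u x, v x) *\<^sub>R G x + hb (u x, v x) *\<^sub>R H x)"
  unfolding wgrad_def
proof (intro conjI ballI)
  let ?M = "lebesgue_on \<Omega>"
  have \<Omega>m: "\<Omega> \<in> sets lebesgue" using \<Omega>(1) by simp
  have "\<Omega> \<in> lmeasurable" using \<Omega> by (simp add: lmeasurable_open)
  then have "finite_measure ?M" by (rule finite_measure_lebesgue_on)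
  then interpret finite_measure ?M .
  have L: "L \<ge> 0" using bound(1)[OF C(4)] by linarith
  have lip: "\<bar>h p - h q\<bar> \<le> 2 * L * (\<bar>fst p - fst q\<bar> + \<bar>snd p - snd q\<bar>)" if "p \<in> C" "q \<in> C" for p q
    by (rule convex_Lipschitz_of_gradient_bound[OF C(2), of h ha hb L]) (use der bound that in auto)
  have iu: "integrable ?M u" and iv: "integrable ?M v" using wgradD(1) u v by auto
  note um = borel_measurable_integrable[OF iu] and vm = borel_measurable_integrable[OF iv]
  have comp_m: "(\<lambda>x. k (a x, b x)) \<in> borel_measurable ?M"
    if "k \<in> borel_measurable borel" "a \<in> borel_measurable ?M" "b \<in> borel_measurable ?M"
    for k :: "real \<times> real \<Rightarrow> real" and a b
    using measurable_compose[OF borel_measurable_Pair[OF that(2,3)] that(1)] by simp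
  \<comment> \<open>An affine majorant of \<open>h\<close> along the pair \<open>(a, b)\<close>,
    from the Lipschitz bound based at \<open>p0\<close>. It is used for \<open>(u, v)\<close> and
    for the mollified pairs alike.\<close>
  define w where "w a b x = \<bar>h p0\<bar> + 2 * L * (\<bar>a x\<bar> + \<bar>b x\<bar> + \<bar>fst p0\<bar> + \<bar>snd p0\<bar>)" for a b :: "'a \<Rightarrow> real" and x
  have h_le_w: "\<bar>h (a x, b x)\<bar> \<le> w a b x" if "(a x, b x) \<in> C" for a b x
  proof -
    have "\<bar>h (a x, b x) - h p0\<bar> \<le> 2 * L * (\<bar>a x - fst p0\<bar> + \<bar>b x - snd p0\<bar>)"
      using lip[OF that C(4)] by simp
    moreover have "2 * L * (\<bar>a x - fst p0\<bar> + \<bar>b x - snd p0\<bar>) \<le> 2 * L * (\<bar>a x\<bar> + \<bar>b x\<bar> + \<bar>fst p0\<bar> + \<bar>snd p0\<bar>)"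
      using L by (intro mult_left_mono) auto
    ultimately show ?thesis unfolding w_def by linarith
  qed
  have iw: "integrable ?M (w a b)" if "integrable ?M a" "integrable ?M b" for a b
    unfolding w_def[abs_def] using that by auto
  show ih: "integrable ?M (\<lambda>x. h (u x, v x))"
  proof (rule Bochner_Integration.integrable_bound[OF iw[OF iu iv]])
    show "AE x in ?M. norm (h (u x, v x)) \<le> norm (w u v x)"
      using C(3)
    proof eventually_elim
      case (elim x)
      from h_le_w[of u x v, OF elim] show ?case by simp
    qed
  qed (rule comp_m[OF meas(1) um vm])
  fix i :: 'a assume i: "i \<in> Basis"
  let ?Gi = "\<lambda>x. G x \<bullet> i" and ?Hi = "\<lambda>x. H x \<bullet> i"
  have iG: "integrable ?M ?Gi" and iH: "integrable ?M ?Hi" using wgradD(2)[OF u i] wgradD(2)[OF v i] by auto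
  note Gm = borel_measurable_integrable[OF iG] and Hm = borel_measurable_integrable[OF iH]
  have coef: "(\<lambda>x. k (a x, b x) * g x) \<in> borel_measurable ?M"
    if "k \<in> borel_measurable borel" "a \<in> borel_measurable ?M" "b \<in> borel_measurable ?M" "g \<in> borel_measurable ?M"
    for k :: "real \<times> real \<Rightarrow> real" and a b g
    using comp_m[OF that(1-3)] that(4) by (rule borel_measurable_times)
  have grad_le: "\<bar>ha p * s + hb p * t\<bar> \<le> L * (\<bar>s\<bar> + \<bar>t\<bar>)" if "p \<in> C" for p s t
  proof -
    have "\<bar>ha p * s\<bar> \<le> L * \<bar>s\<bar>" "\<bar>hb p * t\<bar> \<le> L * \<bar>t\<bar>"
      unfolding abs_mult using bound[OF that] by (auto intro!: mult_right_mono)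
    then show ?thesis by (simp add: distrib_left)
  qed
  let ?D = "\<lambda>x. ha (u x, v x) * ?Gi x + hb (u x, v x) * ?Hi x"
  have Dm: "?D \<in> borel_measurable ?M"
    by (intro borel_measurable_add coef meas um vm Gm Hm)
  have "integrable ?M ?D"
  proof (rule Bochner_Integration.integrable_bound)
    show "integrable ?M (\<lambda>x. L * (\<bar>?Gi x\<bar> + \<bar>?Hi x\<bar>))" using iG iH by auto
    show "AE x in ?M. norm (?D x) \<le> norm (L * (\<bar>?Gi x\<bar> + \<bar>?Hi x\<bar>))"
      using C(3)
    proof eventually_elim
      case (elim x)
      from grad_le[OF elim, of "?Gi x" "?Hi x"] show ?case by simp
    qed
  qed (rule Dm)
  moreover have D_eq: "(ha (u x, v x) *\<^sub>R G x + hb (u x, v x) *\<^sub>R H x) \<bullet> i = ?D x" for x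
    by (simp add: inner_add_left)
  ultimately show "integrable ?M (\<lambda>x. (ha (u x, v x) *\<^sub>R G x + hb (u x, v x) *\<^sub>R H x) \<bullet> i)" by simp
  fix \<psi> assume \<psi>: "\<psi> \<in> test_functions \<Omega>"
  obtain K where K: "compact K" "K \<subseteq> \<Omega>" "\<And>x. x \<notin> K \<Longrightarrow> \<psi> x = 0"
    using test_functions_support[OF \<psi>] by blast
  have D\<psi>0: "pderiv_dir i \<psi> x = 0" if "x \<notin> K" for x
    using K(3) compact_imp_closed[OF K(1)] that by (rule pderiv_dir_zero_outside)
  obtain e where e: "e > 0" "(\<Union>x\<in>K. ball x e) \<subseteq> \<Omega>"
    using compact_subset_open_imp_ball_epsilon_subset[OF K(1) \<Omega>(1) K(2)] by blast
  \<comment> \<open>Half of the margin \<open>e\<close> is spent on the neighbourhood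
    \<open>V\<close> and half on the radii, so balls around points of \<open>V\<close> remain in the
    domain.\<close>
  define V where "V = (\<Union>x\<in>K. ball x (e/2))"
  have V: "open V" "K \<subseteq> V" using e(1) by (auto simp: V_def)
  have cb: "cball x r \<subseteq> \<Omega>" if xV: "x \<in> V" and re: "r < e/2" for x r
  proof
    fix y assume y: "y \<in> cball x r"
    obtain z where z: "z \<in> K" "dist z x < e/2" using xV unfolding V_def by auto
    have "dist z y < e" using dist_triangle[of z y x] y z(2) re by simp
    then have "y \<in> (\<Union>x\<in>K. ball x e)" using z(1) by auto
    then show "y \<in> \<Omega>" using e(2) by blast
  qed
  let ?I = "{u, v, ?Gi, ?Hi}"
  have "\<And>f. f \<in> ?I \<Longrightarrow> integrable ?M f" using iu iv iG iH by auto
  moreover have "0 < e/2" "finite ?I" using e(1) by auto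
  ultimately have "\<exists>r. (\<forall>n. 0 < r n \<and> r n < e/2) \<and> r \<longlonglongrightarrow> 0 \<and> (\<forall>f\<in>?I.
      (AE x in ?M. (\<lambda>n. moll (r n) \<Omega> f x) \<longlonglongrightarrow> f x) \<and>
      (\<lambda>n. \<integral>x. \<bar>moll (r n) \<Omega> f x - f x\<bar> \<partial>?M) \<longlonglongrightarrow> 0 \<and>
      (\<forall>n. integrable ?M (moll (r n) \<Omega> f)))"
    by (intro moll_sequence[OF \<Omega>m, of ?I "\<lambda>f. f" "e/2"])
  then obtain r where r': "\<forall>n. 0 < r n \<and> r n < e/2" "r \<longlonglongrightarrow> 0" and rI: "\<forall>f\<in>?I.
      (AE x in ?M. (\<lambda>n. moll (r n) \<Omega> f x) \<longlonglongrightarrow> f x) \<and>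
      (\<lambda>n. \<integral>x. \<bar>moll (r n) \<Omega> f x - f x\<bar> \<partial>?M) \<longlonglongrightarrow> 0 \<and>
      (\<forall>n. integrable ?M (moll (r n) \<Omega> f))"
    by (elim exE conjE)
  have r: "0 < r n" "r n < e/2" for n using r'(1) by auto
  have rAE: "AE x in ?M. (\<lambda>n. moll (r n) \<Omega> f x) \<longlonglongrightarrow> f x"
    and rL1: "(\<lambda>n. \<integral>x. \<bar>moll (r n) \<Omega> f x - f x\<bar> \<partial>?M) \<longlonglongrightarrow> 0"
    and rint: "integrable ?M (moll (r n) \<Omega> f)" if "f \<in> ?I" for f n
    using rI that by blast+
  define un where "un n = moll (r n) \<Omega> u" for n
  define vn where "vn n = moll (r n) \<Omega> v" for n
  define Gn where "Gn n = moll (r n) \<Omega> ?Gi" for n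
  define Hn where "Hn n = moll (r n) \<Omega> ?Hi" for n
  note rdefs = un_def vn_def Gn_def Hn_def
  have ints: "integrable ?M (un n)" "integrable ?M (vn n)" "integrable ?M (Gn n)" "integrable ?M (Hn n)" for n
    unfolding rdefs by (rule rint, simp)+
  note ms = ints[THEN borel_measurable_integrable]
  have inC: "(un n x, vn n x) \<in> C" if "x \<in> V" for n x
    unfolding rdefs by (rule moll_in_closed_convex[OF r(1) cb[OF that r(2)] \<Omega>m iu iv C(1-3)])
  define g where "g n x = h (un n x, vn n x)" for n x
  have cinf: "Cinf_on UNIV (un n)" "Cinf_on UNIV (vn n)" for n
    unfolding rdefs by (rule Cinf_on_moll[OF r(1)], fact)+
  have pu: "pderiv_dir i (un n) x = Gn n x" "pderiv_dir i (vn n) x = Hn n x" if "x \<in> V" for n x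
    unfolding rdefs by (rule moll_pderiv_dir[OF _ r(1) cb[OF that r(2)] i], fact)+
  have dg: "g n differentiable (at x)"
    "pderiv_dir i (g n) x = ha (un n x, vn n x) * Gn n x + hb (un n x, vn n x) * Hn n x" if x: "x \<in> V" for n x
  proof -
    obtain A B where AB: "(un n has_derivative A) (at x)" "(vn n has_derivative B) (at x)"
      using cinf[of n, THEN Cinf_on_differentiable, of x] by (auto simp: differentiable_def)
    have "((\<lambda>x. (un n x, vn n x)) has_derivative (\<lambda>q. (A q, B q))) (at x)"
      using AB by (rule has_derivative_Pair)
    from has_derivative_compose[OF this der[OF inC[OF x]]]
    have D: "(g n has_derivative (\<lambda>q. ha (un n x, vn n x) * A q + hb (un n x, vn n x) * B q)) (at x)"
      by (simp add: g_def[abs_def])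
    then show "g n differentiable (at x)" by (auto simp: differentiable_def)
    show "pderiv_dir i (g n) x = ha (un n x, vn n x) * Gn n x + hb (un n x, vn n x) * Hn n x"
      using pderiv_dir_eq[OF D, of i] pderiv_dir_eq[OF AB(1), of i] pderiv_dir_eq[OF AB(2), of i] pu[OF x, of n] by simp
  qed
  have cg: "continuous_on V (pderiv_dir i (g n))" for n
  proof (rule continuous_on_eq)
    have P: "continuous_on V (\<lambda>x. (un n x, vn n x))"
      by (intro continuous_on_Pair Cinf_on_continuous cinf)
    have "(\<lambda>x. (un n x, vn n x)) ` V \<subseteq> C" using inC by auto
    then have "continuous_on V (\<lambda>x. ha (un n x, vn n x))" "continuous_on V (\<lambda>x. hb (un n x, vn n x))"
      using continuous_on_compose2[OF cont(1) P] continuous_on_compose2[OF cont(2) P] by auto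
    moreover have "continuous_on V (Gn n)" "continuous_on V (Hn n)"
      unfolding rdefs by (intro Cinf_on_continuous Cinf_on_moll r(1) iG iH)+
    ultimately show "continuous_on V (\<lambda>x. ha (un n x, vn n x) * Gn n x + hb (un n x, vn n x) * Hn n x)"
      by (intro continuous_on_add continuous_on_mult)
  qed (simp add: dg(2))
  have ibp: "(\<integral>x. g n x * pderiv_dir i \<psi> x \<partial>?M) = - (\<integral>x. (ha (un n x, vn n x) * Gn n x + hb (un n x, vn n x) * Hn n x) * \<psi> x \<partial>?M)" for n
  proof -
    have "(\<integral>x. g n x * pderiv_dir i \<psi> x \<partial>?M) = - (\<integral>x. pderiv_dir i (g n) x * \<psi> x \<partial>?M)"
      by (rule test_function_integration_by_parts[OF \<Omega>m \<psi> i K V dg(1) cg])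
    also have "(\<integral>x. pderiv_dir i (g n) x * \<psi> x \<partial>?M) = (\<integral>x. (ha (un n x, vn n x) * Gn n x + hb (un n x, vn n x) * Hn n x) * \<psi> x \<partial>?M)"
    proof (rule Bochner_Integration.integral_cong[OF refl])
      fix x
      show "pderiv_dir i (g n) x * \<psi> x = (ha (un n x, vn n x) * Gn n x + hb (un n x, vn n x) * Hn n x) * \<psi> x"
        using dg(2)[of x n] K(3)[of x] V(2) by (cases "x \<in> K") auto
    qed
    finally show ?thesis .
  qed
  obtain B where B: "B > 0" "\<And>x. \<bar>\<psi> x\<bar> \<le> B" using test_functions_bounded[OF \<psi>] by metis
  obtain B' where B': "B' > 0" "\<And>x. \<bar>pderiv_dir i \<psi> x\<bar> \<le> B'" using test_functions_pderiv_bounded[OF \<psi> i] by metis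
  note \<psi>m = test_functions_borel_measurable[OF \<psi>, of \<Omega>]
    test_functions_borel_measurable[OF test_functions_pderiv_dir[OF \<psi> i], of \<Omega>]
  have lims: "AE x in ?M. (u x, v x) \<in> C \<and> (\<lambda>n. un n x) \<longlonglongrightarrow> u x \<and> (\<lambda>n. vn n x) \<longlonglongrightarrow> v x \<and>
      (\<lambda>n. Gn n x) \<longlonglongrightarrow> ?Gi x \<and> (\<lambda>n. Hn n x) \<longlonglongrightarrow> ?Hi x"
    unfolding rdefs using C(3) rAE[of u] rAE[of v] rAE[of ?Gi] rAE[of ?Hi] by auto
  have sum0: "(\<lambda>n. c * ((\<integral>x. \<bar>an n x - a x\<bar> \<partial>?M) + (\<integral>x. \<bar>bn n x - b x\<bar> \<partial>?M))) \<longlonglongrightarrow> 0"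
    if "(\<lambda>n. \<integral>x. \<bar>an n x - a x\<bar> \<partial>?M) \<longlonglongrightarrow> 0" "(\<lambda>n. \<integral>x. \<bar>bn n x - b x\<bar> \<partial>?M) \<longlonglongrightarrow> 0"
    for an bn :: "nat \<Rightarrow> 'a \<Rightarrow> real" and a b and c :: real
    using tendsto_mult_right_zero[OF tendsto_add_zero[OF that]] .
  \<comment> \<open>Mean convergence passes to the majorants by the reverse triangle inequality; the
    constant \<open>d\<close> cancels.\<close>
  have abs_sum0: "(\<lambda>n. \<integral>x. \<bar>c * (\<bar>an n x\<bar> + \<bar>bn n x\<bar> + d) - c * (\<bar>a x\<bar> + \<bar>b x\<bar> + d)\<bar> \<partial>?M) \<longlonglongrightarrow> 0"
    if c: "c \<ge> 0" and an: "(\<lambda>n. \<integral>x. \<bar>an n x - a x\<bar> \<partial>?M) \<longlonglongrightarrow> 0" "\<And>n. integrable ?M (an n)" "integrable ?M a"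
      and bn: "(\<lambda>n. \<integral>x. \<bar>bn n x - b x\<bar> \<partial>?M) \<longlonglongrightarrow> 0" "\<And>n. integrable ?M (bn n)" "integrable ?M b"
    for an bn :: "nat \<Rightarrow> 'a \<Rightarrow> real" and a b and c d :: real
  proof (rule tendsto_sandwich[OF _ _ tendsto_const sum0[OF an(1) bn(1), of c]])
    have "(\<integral>x. \<bar>c * (\<bar>an n x\<bar> + \<bar>bn n x\<bar> + d) - c * (\<bar>a x\<bar> + \<bar>b x\<bar> + d)\<bar> \<partial>?M)
      \<le> c * ((\<integral>x. \<bar>an n x - a x\<bar> \<partial>?M) + (\<integral>x. \<bar>bn n x - b x\<bar> \<partial>?M))" for n
    proof -
      have "(\<integral>x. \<bar>c * (\<bar>an n x\<bar> + \<bar>bn n x\<bar> + d) - c * (\<bar>a x\<bar> + \<bar>b x\<bar> + d)\<bar> \<partial>?M)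
        \<le> (\<integral>x. c * (\<bar>an n x - a x\<bar> + \<bar>bn n x - b x\<bar>) \<partial>?M)"
      proof (rule integral_mono)
        show "integrable ?M (\<lambda>x. \<bar>c * (\<bar>an n x\<bar> + \<bar>bn n x\<bar> + d) - c * (\<bar>a x\<bar> + \<bar>b x\<bar> + d)\<bar>)"
          using an(2)[of n] an(3) bn(2)[of n] bn(3) by auto
        show "integrable ?M (\<lambda>x. c * (\<bar>an n x - a x\<bar> + \<bar>bn n x - b x\<bar>))"
          using an(2)[of n] an(3) bn(2)[of n] bn(3) by auto
        fix x
        have "c * (\<bar>an n x\<bar> + \<bar>bn n x\<bar> + d) - c * (\<bar>a x\<bar> + \<bar>b x\<bar> + d) = c * (\<bar>an n x\<bar> + \<bar>bn n x\<bar> - \<bar>a x\<bar> - \<bar>b x\<bar>)"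
          by (simp add: algebra_simps)
        then have "\<bar>c * (\<bar>an n x\<bar> + \<bar>bn n x\<bar> + d) - c * (\<bar>a x\<bar> + \<bar>b x\<bar> + d)\<bar> = c * \<bar>\<bar>an n x\<bar> + \<bar>bn n x\<bar> - \<bar>a x\<bar> - \<bar>b x\<bar>\<bar>"
          using c by (simp add: abs_mult)
        also have "\<dots> \<le> c * (\<bar>an n x - a x\<bar> + \<bar>bn n x - b x\<bar>)"
          using c by (intro mult_left_mono) arith+
        finally show "\<bar>c * (\<bar>an n x\<bar> + \<bar>bn n x\<bar> + d) - c * (\<bar>a x\<bar> + \<bar>b x\<bar> + d)\<bar> \<le> c * (\<bar>an n x - a x\<bar> + \<bar>bn n x - b x\<bar>)" .
      qed
      also have "\<dots> = c * ((\<integral>x. \<bar>an n x - a x\<bar> \<partial>?M) + (\<integral>x. \<bar>bn n x - b x\<bar> \<partial>?M))"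
        using an(2)[of n] an(3) bn(2)[of n] bn(3) by simp
      finally show ?thesis .
    qed
    then show "\<forall>\<^sub>F n in sequentially. (\<integral>x. \<bar>c * (\<bar>an n x\<bar> + \<bar>bn n x\<bar> + d) - c * (\<bar>a x\<bar> + \<bar>b x\<bar> + d)\<bar> \<partial>?M)
      \<le> c * ((\<integral>x. \<bar>an n x - a x\<bar> \<partial>?M) + (\<integral>x. \<bar>bn n x - b x\<bar> \<partial>?M))"
      by (rule always_eventually[OF allI])
  qed auto
  have conv_coef: "(\<lambda>n. k (un n x, vn n x)) \<longlonglongrightarrow> k (u x, v x)"
    if "continuous_on C k" "x \<in> K" "(u x, v x) \<in> C" "(\<lambda>n. un n x) \<longlonglongrightarrow> u x" "(\<lambda>n. vn n x) \<longlonglongrightarrow> v x"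
    for k :: "real \<times> real \<Rightarrow> real" and x
  proof (rule continuous_on_tendsto_compose[OF that(1) tendsto_Pair[OF that(4,5)] that(3)])
    show "\<forall>\<^sub>F n in sequentially. (un n x, vn n x) \<in> C" using inC V(2) that(2) by auto
  qed
  have hcont: "continuous_on C h"
    unfolding continuous_on_eq_continuous_within
    by (rule ballI, rule has_derivative_continuous, rule has_derivative_at_withinI, erule der)
  have lim1: "(\<lambda>n. \<integral>x. g n x * pderiv_dir i \<psi> x \<partial>?M) \<longlonglongrightarrow> (\<integral>x. h (u x, v x) * pderiv_dir i \<psi> x \<partial>?M)"
  proof (rule generalized_dominated_convergence(3)[where W="\<lambda>n x. B' * w (un n) (vn n) x" and w="\<lambda>x. B' * w u v x"])
    show "(\<lambda>x. g n x * pderiv_dir i \<psi> x) \<in> borel_measurable ?M" for n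
      unfolding g_def by (rule borel_measurable_times[OF comp_m[OF meas(1) ms(1,2)] \<psi>m(2)])
    show "(\<lambda>x. h (u x, v x) * pderiv_dir i \<psi> x) \<in> borel_measurable ?M"
      by (rule borel_measurable_times[OF comp_m[OF meas(1) um vm] \<psi>m(2)])
    show "integrable ?M (\<lambda>x. B' * w u v x)" "integrable ?M (\<lambda>x. B' * w (un n) (vn n) x)" for n
      using iw[OF iu iv] iw[OF ints(1,2)] by auto
    \<comment> \<open>The constant part of the majorant drops out of the difference, which leaves
      the form of \<open>abs_sum0\<close> with \<open>d = 0\<close>.\<close>
    have eqw: "\<bar>B' * w a b x - B' * w c d x\<bar> = \<bar>(2 * B' * L) * (\<bar>a x\<bar> + \<bar>b x\<bar> + 0) - (2 * B' * L) * (\<bar>c x\<bar> + \<bar>d x\<bar> + 0)\<bar>"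
      for a b c d x by (simp add: w_def algebra_simps)
    show "(\<lambda>n. \<integral>x. \<bar>B' * w (un n) (vn n) x - B' * w u v x\<bar> \<partial>?M) \<longlonglongrightarrow> 0"
      unfolding eqw using B'(1) L
      by (intro abs_sum0 ints iu iv) (auto simp: rdefs intro!: rL1)
    show "AE x in ?M. (\<lambda>n. g n x * pderiv_dir i \<psi> x) \<longlonglongrightarrow> h (u x, v x) * pderiv_dir i \<psi> x"
      using lims
    proof eventually_elim
      case (elim x)
      show ?case
      proof (cases "x \<in> K")
        case True
        show ?thesis unfolding g_def
          by (rule tendsto_mult[OF conv_coef[OF hcont True] tendsto_const]) (use elim in auto)
      qed (simp add: D\<psi>0)
    qed
    show "AE x in ?M. \<bar>g n x * pderiv_dir i \<psi> x\<bar> \<le> B' * w (un n) (vn n) x" for n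
    proof (rule AE_I2)
      fix x
      have w0: "0 \<le> w (un n) (vn n) x" using L by (simp add: w_def)
      show "\<bar>g n x * pderiv_dir i \<psi> x\<bar> \<le> B' * w (un n) (vn n) x"
      proof (cases "x \<in> K")
        case True
        then have "\<bar>g n x\<bar> \<le> w (un n) (vn n) x" unfolding g_def using V(2) by (intro h_le_w inC) auto
        then have "\<bar>g n x\<bar> * \<bar>pderiv_dir i \<psi> x\<bar> \<le> w (un n) (vn n) x * B'"
          using B'(2)[of x] w0 by (intro mult_mono) auto
        then show ?thesis by (simp add: abs_mult mult.commute)
      next
        case False
        then show ?thesis using D\<psi>0 w0 B'(1) by simp
      qed
    qed
    show "AE x in ?M. \<bar>h (u x, v x) * pderiv_dir i \<psi> x\<bar> \<le> B' * w u v x"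
      using C(3)
    proof eventually_elim
      case (elim x)
      have w0: "0 \<le> w u v x" using L by (simp add: w_def)
      have "\<bar>h (u x, v x)\<bar> * \<bar>pderiv_dir i \<psi> x\<bar> \<le> w u v x * B'"
        using B'(2)[of x] w0 h_le_w[of u x v, OF elim] by (intro mult_mono) auto
      then show ?case by (simp add: abs_mult mult.commute)
    qed
  qed
  have lim2: "(\<lambda>n. \<integral>x. (ha (un n x, vn n x) * Gn n x + hb (un n x, vn n x) * Hn n x) * \<psi> x \<partial>?M) \<longlonglongrightarrow> (\<integral>x. ?D x * \<psi> x \<partial>?M)"
  proof (rule generalized_dominated_convergence(3)[where W="\<lambda>n x. (B * L) * (\<bar>Gn n x\<bar> + \<bar>Hn n x\<bar> + 0)" and w="\<lambda>x. (B * L) * (\<bar>?Gi x\<bar> + \<bar>?Hi x\<bar> + 0)"])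
    show "(\<lambda>x. (ha (un n x, vn n x) * Gn n x + hb (un n x, vn n x) * Hn n x) * \<psi> x) \<in> borel_measurable ?M" for n
      by (intro borel_measurable_times[OF _ \<psi>m(1)] borel_measurable_add coef meas ms)
    show "(\<lambda>x. ?D x * \<psi> x) \<in> borel_measurable ?M" by (rule borel_measurable_times[OF Dm \<psi>m(1)])
    show "integrable ?M (\<lambda>x. (B * L) * (\<bar>?Gi x\<bar> + \<bar>?Hi x\<bar> + 0))" "integrable ?M (\<lambda>x. (B * L) * (\<bar>Gn n x\<bar> + \<bar>Hn n x\<bar> + 0))" for n
      using iG iH ints(3,4)[of n] by auto
    show "(\<lambda>n. \<integral>x. \<bar>(B * L) * (\<bar>Gn n x\<bar> + \<bar>Hn n x\<bar> + 0) - (B * L) * (\<bar>?Gi x\<bar> + \<bar>?Hi x\<bar> + 0)\<bar> \<partial>?M) \<longlonglongrightarrow> 0"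
      using B(1) L by (intro abs_sum0 ints iG iH) (auto simp: rdefs intro!: rL1)
    show "AE x in ?M. (\<lambda>n. (ha (un n x, vn n x) * Gn n x + hb (un n x, vn n x) * Hn n x) * \<psi> x) \<longlonglongrightarrow> ?D x * \<psi> x"
      using lims
    proof eventually_elim
      case (elim x)
      show ?case
      proof (cases "x \<in> K")
        case True
        have "(\<lambda>n. ha (un n x, vn n x)) \<longlonglongrightarrow> ha (u x, v x)" "(\<lambda>n. hb (un n x, vn n x)) \<longlonglongrightarrow> hb (u x, v x)"
          using conv_coef[OF cont(1) True] conv_coef[OF cont(2) True] elim by auto
        then show ?thesis using elim
          by (intro tendsto_mult[OF _ tendsto_const] tendsto_add tendsto_mult) auto
      qed (simp add: K(3))
    qed
    show "AE x in ?M. \<bar>(ha (un n x, vn n x) * Gn n x + hb (un n x, vn n x) * Hn n x) * \<psi> x\<bar> \<le> (B * L) * (\<bar>Gn n x\<bar> + \<bar>Hn n x\<bar> + 0)" for n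
    proof (rule AE_I2)
      fix x
      show "\<bar>(ha (un n x, vn n x) * Gn n x + hb (un n x, vn n x) * Hn n x) * \<psi> x\<bar> \<le> (B * L) * (\<bar>Gn n x\<bar> + \<bar>Hn n x\<bar> + 0)"
      proof (cases "x \<in> K")
        case True
        then have "(un n x, vn n x) \<in> C" using V(2) inC by auto
        from mult_mono[OF grad_le[OF this, of "Gn n x" "Hn n x"] B(2)[of x]] L
        show ?thesis by (simp add: abs_mult mult_ac)
      next
        case False
        then show ?thesis using K(3) L B(1) by simp
      qed
    qed
    show "AE x in ?M. \<bar>?D x * \<psi> x\<bar> \<le> (B * L) * (\<bar>?Gi x\<bar> + \<bar>?Hi x\<bar> + 0)"
      using C(3)
    proof eventually_elim
      case (elim x)
      from mult_mono[OF grad_le[OF elim, of "?Gi x" "?Hi x"] B(2)[of x]] L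
      show ?case by (simp add: abs_mult mult_ac)
    qed
  qed
  have l1: "(\<lambda>n. - (\<integral>x. (ha (un n x, vn n x) * Gn n x + hb (un n x, vn n x) * Hn n x) * \<psi> x \<partial>?M)) \<longlonglongrightarrow> (\<integral>x. h (u x, v x) * pderiv_dir i \<psi> x \<partial>?M)"
    using lim1 by (simp only: ibp)
  have l2: "(\<lambda>n. - (\<integral>x. (ha (un n x, vn n x) * Gn n x + hb (un n x, vn n x) * Hn n x) * \<psi> x \<partial>?M)) \<longlonglongrightarrow> - (\<integral>x. ?D x * \<psi> x \<partial>?M)"
    by (rule tendsto_minus[OF lim2])
  show "(\<integral>x. h (u x, v x) * pderiv_dir i \<psi> x \<partial>?M) = - (\<integral>x. ((ha (u x, v x) *\<^sub>R G x + hb (u x, v x) *\<^sub>R H x) \<bullet> i) * \<psi> x \<partial>?M)"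
    using LIMSEQ_unique[OF l1 l2] by (simp only: D_eq)
qed

section \<open>Truncations\<close>

lemma wgrad_l1_integrable:
  assumes "wgrad \<Omega> u G"
  shows "integrable (lebesgue_on \<Omega>) (\<lambda>x. \<Sum>i\<in>Basis. \<bar>G x \<bullet> i\<bar>)"
  using wgradD(2)[OF assms] by (intro Bochner_Integration.integrable_sum integrable_abs)

text \<open>Squaring removes the corner of the positive part at 0, which makes the regularised
  positive parts in \<open>wgrad_max0\<close> differentiable.\<close>

lemma has_real_derivative_max0_square:
  "((\<lambda>a::real. (max a 0)\<^sup>2) has_real_derivative 2 * max a 0) (at a)"
proof -
  consider "a > 0" | "a < 0" | "a = 0" by linarith
  then show ?thesis
  proof cases
    case 1
    have "((\<lambda>a::real. a\<^sup>2) has_real_derivative 2 * max a 0) (at a)"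
      using 1 by (auto intro!: derivative_eq_intros)
    then show ?thesis
      by (rule has_field_derivative_transform_within_open[where S="{0<..}"]) (use 1 in auto)
  next
    case 2
    have "((\<lambda>a::real. 0) has_real_derivative 2 * max a 0) (at a)"
      using 2 by auto
    then show ?thesis
      by (rule has_field_derivative_transform_within_open[where S="{..<0}"]) (use 2 in auto)
  next
    case 3
    have "((\<lambda>h::real. (max h 0)\<^sup>2 / h) \<longlongrightarrow> 0) (at 0)"
    proof (rule Lim_null_comparison[where g="\<lambda>h. \<bar>h\<bar>"])
      have "norm ((max h 0)\<^sup>2 / h) \<le> \<bar>h\<bar>" for h :: real
        by (cases "h > 0") (auto simp: power2_eq_square max_def)
      then show "\<forall>\<^sub>F h::real in at 0. norm ((max h 0)\<^sup>2 / h) \<le> \<bar>h\<bar>"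
        by (rule always_eventually[OF allI])
      show "((\<lambda>h::real. \<bar>h\<bar>) \<longlongrightarrow> 0) (at 0)" by (rule tendsto_rabs_zero[OF tendsto_ident_at])
    qed
    then show ?thesis using 3 by (simp add: DERIV_def)
  qed
qed

text \<open>The regularisations \<open>sqrt ((max a 0)\<^sup>2 + (e n)\<^sup>2) - e n\<close> have
  slopes between 0 and 1. For \<open>a \<le> 0\<close> the slope is exactly 0, so the limiting
  gradient is 0 on the zero set of \<open>u\<close> as well.\<close>

lemma wgrad_max0:
  assumes \<Omega>: "open \<Omega>" "bounded \<Omega>" and u: "wgrad \<Omega> u G"
  shows "wgrad \<Omega> (\<lambda>x. max (u x) 0) (\<lambda>x. if u x > 0 then G x else 0)"
proof -
  let ?M = "lebesgue_on \<Omega>"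
  define e where "e n = inverse (real (Suc n))" for n
  have e: "e n > 0" for n by (simp add: e_def)
  have e0: "e \<longlonglongrightarrow> 0" unfolding e_def by (rule LIMSEQ_inverse_real_of_nat)
  let ?s = "\<lambda>n a. sqrt ((max a 0)\<^sup>2 + (e n)\<^sup>2)"
  have pos: "(max a 0)\<^sup>2 + (e n)\<^sup>2 > 0" for a n
    using e[of n] by (simp add: add_nonneg_pos)
  have spos: "?s n a > 0" for n a using pos by simp
  have s_ge: "?s n a \<ge> e n" "?s n a \<ge> max a 0" "?s n a \<le> max a 0 + e n" for n a
  proof -
    show "?s n a \<ge> e n" "?s n a \<ge> max a 0"
      using e[of n] by (auto intro!: real_le_rsqrt)
    have "(max a 0)\<^sup>2 + (e n)\<^sup>2 \<le> (max a 0 + e n)\<^sup>2"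
      using e[of n] by (simp add: power2_sum)
    then show "?s n a \<le> max a 0 + e n"
      using e[of n] by (intro real_le_lsqrt) auto
  qed
  define h where "h n p = ?s n (fst p) - e n" for n and p :: "real \<times> real"
  define ha where "ha n p = max (fst p) 0 / ?s n (fst p)" for n and p :: "real \<times> real"
  have ha01: "0 \<le> ha n p" "ha n p \<le> 1" for n p
    using s_ge(2)[of "fst p" n] spos[of "fst p" n] by (auto simp: ha_def simp del: real_sqrt_gt_0_iff)
  have conts: "continuous_on UNIV (h n)" "continuous_on UNIV (ha n)" for n
    unfolding h_def[abs_def] ha_def[abs_def] using e[of n]
    by (auto intro!: continuous_intros)
  \<comment> \<open>The chain rule for two arguments is applied to the pair \<open>(u, u)\<close>
    with a vanishing second partial derivative.\<close>
  have w: "wgrad \<Omega> (\<lambda>x. h n (u x, u x)) (\<lambda>x. ha n (u x, u x) *\<^sub>R G x + 0 *\<^sub>R G x)" for n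
  proof (rule wgrad_chain[OF \<Omega> u u, of UNIV "(0,0)" "h n" "ha n" "\<lambda>_. 0" 1])
    fix p :: "real \<times> real"
    have "((\<lambda>a. ?s n a - e n) has_real_derivative ha n p) (at (fst p))"
    proof -
      have "((\<lambda>a. (max a 0)\<^sup>2 + (e n)\<^sup>2) has_real_derivative 2 * max (fst p) 0) (at (fst p))"
        using DERIV_add[OF has_real_derivative_max0_square DERIV_const] by simp
      from DERIV_diff[OF DERIV_chain2[OF DERIV_real_sqrt[OF pos] this] DERIV_const[of "e n"]]
      have "((\<lambda>a. ?s n a - e n) has_real_derivative
        (inverse (?s n (fst p)) / 2 * (2 * max (fst p) 0) - 0)) (at (fst p))" .
      moreover have "inverse (?s n (fst p)) / 2 * (2 * max (fst p) 0) - 0 = ha n p"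
      proof -
        have "inverse S / 2 * (2 * X) - 0 = X / S" for S X :: real by (simp add: field_simps)
        then show ?thesis unfolding ha_def .
      qed
      ultimately show ?thesis by (simp only:)
    qed
    then have "((\<lambda>a. ?s n a - e n) has_derivative (*) (ha n p)) (at (fst p))"
      by (simp add: has_field_derivative_def)
    from has_derivative_compose[OF has_derivative_fst[OF has_derivative_ident] this, of UNIV]
    show "(h n has_derivative (\<lambda>q. ha n p * fst q + 0 * snd q)) (at p)"
      by (simp add: h_def[abs_def])
  qed (use ha01 conts in \<open>auto intro: borel_measurable_continuous_onI\<close>)
  have m0: "(\<lambda>x. max (u x) 0) \<in> borel_measurable ?M"
    using wgradD(1)[OF u] by auto
  show ?thesis
  proof (rule wgrad_dominated_limit[OF w, where w="\<lambda>x. \<bar>u x\<bar>" and w'="\<lambda>x. \<Sum>i\<in>Basis. \<bar>G x \<bullet> i\<bar>"])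
    show "AE x in ?M. (\<lambda>n. h n (u x, u x)) \<longlonglongrightarrow> max (u x) 0"
    proof (rule AE_I2)
      fix x
      have "(\<lambda>n. ?s n (u x) - e n) \<longlonglongrightarrow> sqrt ((max (u x) 0)\<^sup>2 + 0\<^sup>2) - 0"
        by (intro tendsto_intros e0)
      then show "(\<lambda>n. h n (u x, u x)) \<longlonglongrightarrow> max (u x) 0" by (simp add: h_def)
    qed
    show "AE x in ?M. (\<lambda>n. ha n (u x, u x) *\<^sub>R G x + 0 *\<^sub>R G x) \<longlonglongrightarrow> (if u x > 0 then G x else 0)"
    proof (rule AE_I2)
      fix x
      show "(\<lambda>n. ha n (u x, u x) *\<^sub>R G x + 0 *\<^sub>R G x) \<longlonglongrightarrow> (if u x > 0 then G x else 0)"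
      proof (cases "u x > 0")
        case True
        have "(\<lambda>n. max (u x) 0 / ?s n (u x)) \<longlonglongrightarrow> max (u x) 0 / sqrt ((max (u x) 0)\<^sup>2 + 0\<^sup>2)"
          using True by (intro tendsto_intros e0) auto
        then have "(\<lambda>n. ha n (u x, u x)) \<longlonglongrightarrow> 1" using True by (simp add: ha_def)
        then have "(\<lambda>n. ha n (u x, u x) *\<^sub>R G x) \<longlonglongrightarrow> 1 *\<^sub>R G x" by (intro tendsto_intros)
        then show ?thesis using True by simp
      qed (simp add: ha_def)
    qed
    show "AE x in ?M. \<bar>h n (u x, u x)\<bar> \<le> \<bar>u x\<bar>" for n
    proof (rule AE_I2)
      fix x show "\<bar>h n (u x, u x)\<bar> \<le> \<bar>u x\<bar>"
        using s_ge(1)[of n "u x"] s_ge(3)[of "u x" n] by (simp add: h_def)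
    qed
    show "AE x in ?M. norm (ha n (u x, u x) *\<^sub>R G x + 0 *\<^sub>R G x) \<le> (\<Sum>i\<in>Basis. \<bar>G x \<bullet> i\<bar>)" for n
    proof (rule AE_I2)
      fix x
      have "norm (ha n (u x, u x) *\<^sub>R G x + 0 *\<^sub>R G x) \<le> norm (G x)"
        using ha01[of n "(u x, u x)"] by (simp add: mult_left_le_one_le)
      then show "norm (ha n (u x, u x) *\<^sub>R G x + 0 *\<^sub>R G x) \<le> (\<Sum>i\<in>Basis. \<bar>G x \<bullet> i\<bar>)"
        using norm_le_l1[of "G x"] by linarith
    qed
    fix i :: 'a assume i: "i \<in> Basis"
    have um: "u \<in> borel_measurable ?M" using wgradD(1)[OF u] by auto
    have "{x \<in> space ?M. 0 < u x} \<in> sets ?M" using um by measurable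
    then have "(\<lambda>x. if 0 < u x then G x \<bullet> i else 0) \<in> borel_measurable ?M"
      using borel_measurable_integrable[OF wgradD(2)[OF u i]] by (intro measurable_If) auto
    moreover have "(\<lambda>x. (if 0 < u x then G x else 0) \<bullet> i) = (\<lambda>x. if 0 < u x then G x \<bullet> i else 0)" by auto
    ultimately show "(\<lambda>x. (if 0 < u x then G x else 0) \<bullet> i) \<in> borel_measurable ?M" by simp
  qed (use wgradD(1)[OF u] wgrad_l1_integrable[OF u] m0 in auto)
qed

lemma wgrad_scale: "wgrad \<Omega> u G \<Longrightarrow> wgrad \<Omega> (\<lambda>x. c * u x) (\<lambda>x. c *\<^sub>R G x)"
  using wgrad_lincomb[of \<Omega> u G u G c 0] by simp

lemma wgrad_diff: "wgrad \<Omega> u G \<Longrightarrow> wgrad \<Omega> v H \<Longrightarrow> wgrad \<Omega> (\<lambda>x. u x - v x) (\<lambda>x. G x - H x)"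
  using wgrad_lincomb[of \<Omega> u G v H 1 "-1"] by simp

text \<open>The gradients of the positive part of \<open>u\<close> and of \<open>- u\<close> both vanish on the zero set of \<open>u\<close>.\<close>

lemma wgrad_zero_set:
  assumes \<Omega>: "open \<Omega>" "bounded \<Omega>" and u: "wgrad \<Omega> u G"
  shows "AE x in lebesgue_on \<Omega>. u x = 0 \<longrightarrow> G x = 0"
proof -
  have p: "wgrad \<Omega> (\<lambda>x. max (u x) 0) (\<lambda>x. if u x > 0 then G x else 0)"
    by (rule wgrad_max0[OF \<Omega> u])
  have q: "wgrad \<Omega> (\<lambda>x. max (-1 * u x) 0) (\<lambda>x. if -1 * u x > 0 then -1 *\<^sub>R G x else 0)"
    by (rule wgrad_max0[OF \<Omega> wgrad_scale[OF u]])
  have "wgrad \<Omega> (\<lambda>x. max (u x) 0 - max (-1 * u x) 0) (\<lambda>x. (if u x > 0 then G x else 0) - (if -1 * u x > 0 then -1 *\<^sub>R G x else 0))"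
    by (rule wgrad_diff[OF p q])
  moreover have "(\<lambda>x. max (u x) 0 - max (-1 * u x) 0) = u" by (auto simp: max_def)
  ultimately have "wgrad \<Omega> u (\<lambda>x. (if u x > 0 then G x else 0) - (if -1 * u x > 0 then -1 *\<^sub>R G x else 0))" by simp
  from wgrad_unique[OF \<Omega>(1) u this] show ?thesis
    by eventually_elim auto
qed

lemma wgrad_min:
  assumes \<Omega>: "open \<Omega>" "bounded \<Omega>" and u: "wgrad \<Omega> u G" and v: "wgrad \<Omega> v H"
  shows "wgrad \<Omega> (\<lambda>x. min (u x) (v x)) (\<lambda>x. if u x > v x then H x else G x)"
proof -
  have "wgrad \<Omega> (\<lambda>x. u x - max (u x - v x) 0) (\<lambda>x. G x - (if u x - v x > 0 then G x - H x else 0))"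
    by (rule wgrad_diff[OF u wgrad_max0[OF \<Omega> wgrad_diff[OF u v]]])
  moreover have "(\<lambda>x. u x - max (u x - v x) 0) = (\<lambda>x. min (u x) (v x))" by (auto simp: max_def min_def)
  moreover have "(\<lambda>x. G x - (if u x - v x > 0 then G x - H x else 0)) = (\<lambda>x. if u x > v x then H x else G x)" by auto
  ultimately show ?thesis by simp
qed

section \<open>The Young function\<close>

locale young_function =
  fixes \<phi> :: "real \<Rightarrow> real" and l m :: real
  assumes phi_pos: "\<And>s. s > 0 \<Longrightarrow> \<phi> s > 0"
    and phi_C1: "\<phi> C1_differentiable_on {0<..}"
    and phi_lim0: "((\<lambda>s. s * \<phi> s) \<longlongrightarrow> 0) (at_right 0)"
    and phi_mono: "strict_mono_on {0<..} (\<lambda>s. s * \<phi> s)"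
    and l_gt: "1 < l" and m_gt: "1 < m"
    and phi_low: "\<And>s. s > 0 \<Longrightarrow> l - 1 \<le> deriv (\<lambda>s. s * \<phi> s) s / \<phi> s"
    and phi_high: "\<And>s. s > 0 \<Longrightarrow> deriv (\<lambda>s. s * \<phi> s) s / \<phi> s \<le> m - 1"
begin

text \<open>The derivative of \<open>Phi \<phi>\<close> on the whole line; it is odd.\<close>

definition p :: "real \<Rightarrow> real" where "p s = s * \<phi> \<bar>s\<bar>"

lemma p_0 [simp]: "p 0 = 0" by (simp add: p_def)

lemma p_minus: "p (- s) = - p s" by (simp add: p_def)

lemma p_pos: "s > 0 \<Longrightarrow> p s > 0" by (simp add: p_def phi_pos)

text \<open>Both growth bounds with the denominator cleared. In this form they compare
  \<open>p\<close> with the powers of exponent \<open>l - 1\<close> and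
  \<open>m - 1\<close>.\<close>

lemma p_has_derivative:
  assumes "s > 0"
  shows "\<exists>D. (p has_real_derivative D) (at s) \<and> (l - 1) * p s \<le> s * D \<and> s * D \<le> (m - 1) * p s"
proof -
  have "\<phi> differentiable (at s)"
    using phi_C1 assms by (auto simp: C1_differentiable_on_eq)
  then obtain d where d: "(\<phi> has_real_derivative d) (at s)"
    using real_differentiable_def by blast
  have D: "((\<lambda>s. s * \<phi> s) has_real_derivative (\<phi> s + s * d)) (at s)"
    using d by (auto intro!: derivative_eq_intros)
  then have dd: "deriv (\<lambda>s. s * \<phi> s) s = \<phi> s + s * d" by (rule DERIV_imp_deriv)
  have "(p has_real_derivative (\<phi> s + s * d)) (at s)"
    using D by (rule has_field_derivative_transform_within_open[where S="{0<..}"])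
      (use assms in \<open>auto simp: p_def\<close>)
  moreover have "(l - 1) * \<phi> s \<le> \<phi> s + s * d" "\<phi> s + s * d \<le> (m - 1) * \<phi> s"
    using phi_low[OF assms] phi_high[OF assms] phi_pos[OF assms] unfolding dd
    by (auto simp: le_divide_eq divide_le_eq)
  ultimately show ?thesis
    using assms mult_left_mono[of "(l - 1) * \<phi> s" "\<phi> s + s * d" s] mult_left_mono[of "\<phi> s + s * d" "(m - 1) * \<phi> s" s]
    by (intro exI[of _ "\<phi> s + s * d"]) (auto simp: p_def mult_ac)
qed

lemma p_tendsto_0: "(p \<longlongrightarrow> 0) (at 0)"
proof -
  have r: "(p \<longlongrightarrow> 0) (at_right 0)"
    using phi_lim0 by (rule Lim_transform_eventually) (auto simp: p_def eventually_at_right_field intro!: exI[of _ 1])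
  then have "((\<lambda>s. p (- s)) \<longlongrightarrow> 0) (at_right (- 0))"
    using tendsto_minus[OF r] by (simp add: p_minus)
  then have "(p \<longlongrightarrow> 0) (at_left 0)" by (simp only: filterlim_at_left_to_right[of p _ 0])
  with r show ?thesis by (simp add: filterlim_split_at)
qed

lemma p_isCont: "isCont p s"
proof -
  consider "s > 0" | "s < 0" | "s = 0" by linarith
  then show ?thesis
  proof cases
    case 1
    then show ?thesis using p_has_derivative DERIV_isCont by blast
  next
    case 2
    then have "isCont p (- s)" using p_has_derivative[of "- s"] DERIV_isCont by auto
    then have "isCont (\<lambda>x. - p (- x)) s" by (auto intro!: continuous_intros isCont_o2[of _ uminus p])
    then show ?thesis by (simp add: p_minus)
  next
    case 3
    then show ?thesis using p_tendsto_0 by (simp add: isCont_def)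
  qed
qed

lemma Phi_has_derivative: "(Phi \<phi> has_real_derivative p t) (at t)"
proof -
  let ?a = "- \<bar>t\<bar> - 1" and ?b = "\<bar>t\<bar> + 1"
  have "((\<lambda>u. LBINT y=(0::real)..u. p y) has_vector_derivative (p t)) (at t within {?a..?b})"
    by (rule interval_integral_FTC2) (auto intro!: continuous_at_imp_continuous_on p_isCont)
  then have "((\<lambda>u. LBINT y=(0::real)..u. p y) has_vector_derivative (p t)) (at t)"
    by (subst (asm) at_within_interior) (auto simp: interior_atLeastAtMost_real)
  moreover have "(\<lambda>u. LBINT y=(0::real)..u. p y) = Phi \<phi>"
    by (auto simp: Phi_def[abs_def] p_def zero_ereal_def)
  ultimately show ?thesis by (simp add: has_real_derivative_iff_has_vector_derivative)
qed

lemma Phi_0 [simp]: "Phi \<phi> 0 = 0"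
  by (simp add: Phi_def zero_ereal_def)

lemma Phi_isCont: "isCont (Phi \<phi>) t"
  using Phi_has_derivative DERIV_isCont by blast

lemma Phi_measurable [measurable]: "Phi \<phi> \<in> borel_measurable borel"
  by (intro borel_measurable_continuous_onI continuous_at_imp_continuous_on ballI Phi_isCont)

lemma Phi_minus: "Phi \<phi> (- t) = Phi \<phi> t"
proof -
  have "((\<lambda>t. Phi \<phi> (- t) - Phi \<phi> t) has_real_derivative 0) (at t)" for t
  proof -
    have "((\<lambda>t. Phi \<phi> (- t)) has_real_derivative p (- t) * (-1)) (at t)"
      by (rule DERIV_chain2[OF Phi_has_derivative]) (auto intro!: derivative_eq_intros)
    from DERIV_diff[OF this Phi_has_derivative[of t]] show ?thesis by (simp add: p_minus)
  qed
  from DERIV_isconst_all[of "\<lambda>t. Phi \<phi> (- t) - Phi \<phi> t" t 0] this show ?thesis by simp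
qed

lemma Phi_abs: "Phi \<phi> \<bar>t\<bar> = Phi \<phi> t"
  by (simp add: abs_if Phi_minus)

section \<open>Convexity and growth of the Young function\<close>

lemma p_mono: "s \<le> t \<Longrightarrow> p s \<le> p t"
proof -
  have pos: "p s \<le> p t" if "0 \<le> s" "s \<le> t" for s t
  proof (cases "s = 0 \<or> s = t")
    case True then show ?thesis using that p_pos[of t] by (cases "t = 0") auto
  next
    case False
    then have "s * \<phi> s < t * \<phi> t" using that by (intro strict_mono_onD[OF phi_mono]) auto
    then show ?thesis using that by (simp add: p_def)
  qed
  assume st: "s \<le> t"
  consider "0 \<le> s" | "t \<le> 0" | "s < 0" "0 < t" by linarith
  then show ?thesis
  proof cases
    case 1 then show ?thesis using pos st by blast
  next
    case 2 then show ?thesis using pos[of "-t" "-s"] st by (simp add: p_minus)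
  next
    case 3 then show ?thesis using p_pos[of t] p_pos[of "-s"] by (simp add: p_minus)
  qed
qed

text \<open>Convexity in the form of tangent lines. Nonnegativity, monotonicity, the scaling by
  factors below 1 and Jensen's inequality are all read off from it.\<close>

lemma Phi_support_line: "Phi \<phi> s + p s * (t - s) \<le> Phi \<phi> t"
proof -
  consider "s < t" | "t < s" | "s = t" by linarith
  then show ?thesis
  proof cases
    case 1
    from MVT2[OF 1, of "Phi \<phi>" p] Phi_has_derivative
    obtain z where z: "s < z" "Phi \<phi> t - Phi \<phi> s = (t - s) * p z" by auto
    have "(t - s) * p s \<le> (t - s) * p z" using 1 z(1) by (intro mult_left_mono p_mono) auto
    then show ?thesis using z(2) by (simp add: mult.commute)
  next
    case 2
    from MVT2[OF 2, of "Phi \<phi>" p] Phi_has_derivative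
    obtain z where z: "z < s" "Phi \<phi> s - Phi \<phi> t = (s - t) * p z" by auto
    have "(s - t) * p z \<le> (s - t) * p s" using 2 z(1) by (intro mult_left_mono p_mono) auto
    then show ?thesis using z(2) by (simp add: algebra_simps)
  qed simp
qed

lemma Phi_nonneg: "0 \<le> Phi \<phi> t"
  using Phi_support_line[of 0 t] by simp

lemma Phi_mono: "\<bar>s\<bar> \<le> \<bar>t\<bar> \<Longrightarrow> Phi \<phi> s \<le> Phi \<phi> t"
proof -
  assume "\<bar>s\<bar> \<le> \<bar>t\<bar>"
  moreover have "p \<bar>s\<bar> \<ge> 0" using p_mono[of 0 "\<bar>s\<bar>"] by simp
  ultimately have "0 \<le> p \<bar>s\<bar> * (\<bar>t\<bar> - \<bar>s\<bar>)" by simp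
  then have "Phi \<phi> \<bar>s\<bar> \<le> Phi \<phi> \<bar>t\<bar>"
    using Phi_support_line[of "\<bar>s\<bar>" "\<bar>t\<bar>"] by linarith
  then show ?thesis by (simp add: Phi_abs)
qed

lemma Phi_le_mult_p: "Phi \<phi> t \<le> t * p t"
  using Phi_support_line[of t 0] by (simp add: mult.commute)

text \<open>At positive arguments the difference of the two sides has derivative
  \<open>(m - 1) * p x - x * D\<close>, where \<open>D\<close> is the derivative of
  \<open>p\<close>, and the upper growth bound makes it nonnegative.\<close>

lemma mult_p_le_Phi: "t * p t \<le> m * Phi \<phi> t"
proof -
  have pos: "t * p t \<le> m * Phi \<phi> t" if "0 \<le> t" for t
  proof -
    have "(\<lambda>t. m * Phi \<phi> t - t * p t) 0 \<le> (\<lambda>t. m * Phi \<phi> t - t * p t) t"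
    proof (rule DERIV_nonneg_imp_increasing_open[OF that])
      fix x assume x: "0 < x" "x < t"
      obtain D where D: "(p has_real_derivative D) (at x)" "x * D \<le> (m - 1) * p x"
        using p_has_derivative[OF x(1)] by blast
      have "((\<lambda>t. m * Phi \<phi> t - t * p t) has_real_derivative (m * p x - (p x + x * D))) (at x)"
        using D(1) Phi_has_derivative[of x] by (auto intro!: derivative_eq_intros)
      moreover have "m * p x - (p x + x * D) \<ge> 0" using D(2) by (simp add: algebra_simps)
      ultimately show "\<exists>y. ((\<lambda>t. m * Phi \<phi> t - t * p t) has_real_derivative y) (at x) \<and> 0 \<le> y" by blast
    next
      show "continuous_on {0..t} (\<lambda>t. m * Phi \<phi> t - t * p t)"
        by (intro continuous_at_imp_continuous_on ballI continuous_intros Phi_isCont p_isCont)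
    qed
    then show ?thesis by simp
  qed
  show ?thesis
  proof (cases "0 \<le> t")
    case False
    then show ?thesis using pos[of "- t"] by (simp add: p_minus Phi_minus)
  qed (rule pos)
qed

text \<open>\<open>p\<close> grows at most like the power \<open>m - 1\<close>; this is the source
  of the doubling condition for \<open>Phi \<phi>\<close>.\<close>

lemma p_powr_antimono:
  assumes "0 < s" "s \<le> t"
  shows "p t * t powr (1 - m) \<le> p s * s powr (1 - m)"
proof (rule DERIV_nonpos_imp_nonincreasing[OF assms(2)])
  fix x assume "s \<le> x" "x \<le> t"
  then have x: "0 < x" using assms by simp
  obtain D where D: "(p has_real_derivative D) (at x)" "x * D \<le> (m - 1) * p x"
    using p_has_derivative[OF x] by blast
  have "((\<lambda>x. p x * x powr (1 - m)) has_real_derivative (D * x powr (1 - m) + ((1 - m) * x powr (1 - m - 1)) * p x)) (at x)"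
    using D(1) x by (auto intro!: DERIV_mult' derivative_eq_intros)
  moreover have "D * x powr (1 - m) + ((1 - m) * x powr (1 - m - 1)) * p x = x powr (- m) * (x * D - (m - 1) * p x)"
  proof -
    have "x powr (1 - m) = x * x powr (- m)"
      using x powr_add[of x 1 "- m"] by simp
    moreover have "x powr (1 - m - 1) = x powr (- m)" by (simp add: algebra_simps)
    ultimately show ?thesis by (simp add: algebra_simps)
  qed
  moreover have "x powr (- m) * (x * D - (m - 1) * p x) \<le> 0"
    using D(2) by (intro mult_nonneg_nonpos) auto
  ultimately show "\<exists>y. ((\<lambda>x. p x * x powr (1 - m)) has_real_derivative y) (at x) \<and> y \<le> 0" by auto
qed

text \<open>The product is \<open>\<phi> s / s powr (l - 2)\<close>, so this is the monotonicity on
  which \<open>flux_inequality\<close> rests.\<close>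

lemma p_powr_mono:
  assumes "0 < s" "s \<le> t"
  shows "p s * s powr (1 - l) \<le> p t * t powr (1 - l)"
proof (rule DERIV_nonneg_imp_nondecreasing[OF assms(2)])
  fix x assume "s \<le> x" "x \<le> t"
  then have x: "0 < x" using assms by simp
  obtain D where D: "(p has_real_derivative D) (at x)" "(l - 1) * p x \<le> x * D"
    using p_has_derivative[OF x] by blast
  have "((\<lambda>x. p x * x powr (1 - l)) has_real_derivative (D * x powr (1 - l) + ((1 - l) * x powr (1 - l - 1)) * p x)) (at x)"
    using D(1) x by (auto intro!: DERIV_mult' derivative_eq_intros)
  moreover have "D * x powr (1 - l) + ((1 - l) * x powr (1 - l - 1)) * p x = x powr (- l) * (x * D - (l - 1) * p x)"
  proof -
    have "x powr (1 - l) = x * x powr (- l)"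
      using x powr_add[of x 1 "- l"] by simp
    moreover have "x powr (1 - l - 1) = x powr (- l)" by (simp add: algebra_simps)
    ultimately show ?thesis by (simp add: algebra_simps)
  qed
  moreover have "0 \<le> x powr (- l) * (x * D - (l - 1) * p x)"
    using D(2) by (intro mult_nonneg_nonneg) auto
  ultimately show "\<exists>y. ((\<lambda>x. p x * x powr (1 - l)) has_real_derivative y) (at x) \<and> 0 \<le> y" by auto
qed

lemma p_scale: "0 \<le> s \<Longrightarrow> 1 \<le> c \<Longrightarrow> p (c * s) \<le> c powr (m - 1) * p s"
proof (cases "s = 0")
  case False
  assume "0 \<le> s" "1 \<le> c"
  with False have s: "0 < s" and c: "1 \<le> c" by auto
  have "p (c * s) * (c * s) powr (1 - m) \<le> p s * s powr (1 - m)"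
    using s c mult_right_mono[of 1 c s] by (intro p_powr_antimono) auto
  then have "p (c * s) * c powr (1 - m) * s powr (1 - m) \<le> p s * s powr (1 - m)"
    using s c by (simp add: powr_mult mult.assoc)
  then have "p (c * s) * c powr (1 - m) \<le> p s" using s by simp
  then have "c powr (m - 1) * (p (c * s) * c powr (1 - m)) \<le> c powr (m - 1) * p s"
    by (intro mult_left_mono) auto
  moreover have "c powr (m - 1) * c powr (1 - m) = 1"
    using c by (simp add: powr_add[symmetric])
  ultimately show ?thesis by (simp add: mult.left_commute)
qed simp

text \<open>The doubling condition with an explicit constant: \<open>p_scale\<close> gives it for
  the derivatives, and both sides agree at 0.\<close>

lemma Phi_scale_ge1: "1 \<le> c \<Longrightarrow> Phi \<phi> (c * t) \<le> c powr m * Phi \<phi> t"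
proof -
  assume c: "1 \<le> c"
  have pos: "Phi \<phi> (c * t) \<le> c powr m * Phi \<phi> t" if "0 \<le> t" for t
  proof -
    have "(\<lambda>t. c powr m * Phi \<phi> t - Phi \<phi> (c * t)) 0 \<le> (\<lambda>t. c powr m * Phi \<phi> t - Phi \<phi> (c * t)) t"
    proof (rule DERIV_nonneg_imp_nondecreasing[OF that])
      fix x assume x: "0 \<le> x" "x \<le> t"
      have "((\<lambda>t. Phi \<phi> (c * t)) has_real_derivative p (c * x) * c) (at x)"
        by (rule DERIV_chain2[OF Phi_has_derivative]) (auto intro!: derivative_eq_intros)
      then have D: "((\<lambda>t. c powr m * Phi \<phi> t - Phi \<phi> (c * t)) has_real_derivative (c powr m * p x - p (c * x) * c)) (at x)"
        using Phi_has_derivative[of x] by (auto intro!: derivative_eq_intros)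
      have c1: "c * c powr (m - 1) = c powr m"
        using c powr_add[of c 1 "m - 1"] by simp
      have "p (c * x) * c \<le> (c powr (m - 1) * p x) * c"
        using p_scale[OF x(1) c] c by (intro mult_right_mono) auto
      also have "\<dots> = (c * c powr (m - 1)) * p x" by (simp only: mult_ac)
      finally have "0 \<le> c powr m * p x - p (c * x) * c" unfolding c1 by simp
      with D show "\<exists>y. ((\<lambda>t. c powr m * Phi \<phi> t - Phi \<phi> (c * t)) has_real_derivative y) (at x) \<and> 0 \<le> y"
        by blast
    qed
    then show ?thesis by simp
  qed
  show ?thesis
  proof (cases "0 \<le> t")
    case False
    then show ?thesis using pos[of "- t"] by (simp add: Phi_minus)
  qed (rule pos)
qed

lemma Phi_scale_le1: "0 \<le> c \<Longrightarrow> c \<le> 1 \<Longrightarrow> Phi \<phi> (c * t) \<le> c * Phi \<phi> t"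
proof -
  assume c: "0 \<le> c" "c \<le> 1"
  \<comment> \<open>The tangent at \<open>c * t\<close> is evaluated at \<open>t\<close> with weight
    \<open>c\<close> and at 0 with weight \<open>1 - c\<close>; the linear terms then
    cancel.\<close>
  have "c * (Phi \<phi> (c * t) + p (c * t) * (t - c * t)) \<le> c * Phi \<phi> t"
    by (intro mult_left_mono Phi_support_line c)
  moreover have "(1 - c) * (Phi \<phi> (c * t) + p (c * t) * (0 - c * t)) \<le> (1 - c) * Phi \<phi> 0"
    using c by (intro mult_left_mono Phi_support_line) auto
  ultimately show ?thesis by (simp add: algebra_simps)
qed

lemma Phi_scale: "Phi \<phi> (c * t) \<le> (max 1 \<bar>c\<bar>) powr m * Phi \<phi> t"
proof -
  have "Phi \<phi> (c * t) \<le> Phi \<phi> (max 1 \<bar>c\<bar> * t)"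
    by (intro Phi_mono) (auto simp: abs_mult intro!: mult_right_mono)
  also have "\<dots> \<le> (max 1 \<bar>c\<bar>) powr m * Phi \<phi> t" by (rule Phi_scale_ge1) simp
  finally show ?thesis .
qed

lemma Phi_add: "Phi \<phi> (s + t) \<le> 2 powr m * (Phi \<phi> s + Phi \<phi> t)"
proof -
  have "Phi \<phi> (s + t) \<le> Phi \<phi> (2 * max \<bar>s\<bar> \<bar>t\<bar>)" by (rule Phi_mono) auto
  also have "\<dots> \<le> 2 powr m * Phi \<phi> (max \<bar>s\<bar> \<bar>t\<bar>)" by (rule Phi_scale_ge1) simp
  also have "\<dots> \<le> 2 powr m * (Phi \<phi> s + Phi \<phi> t)"
    using Phi_nonneg[of s] Phi_nonneg[of t] by (intro mult_left_mono) (auto simp: max_def Phi_abs)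
  finally show ?thesis .
qed

text \<open>The tangent at 1 shows at least linear growth. On a set of finite measure this embeds
  the Orlicz space into the integrable functions.\<close>

lemma abs_le_Phi: "\<bar>t\<bar> \<le> 1 + Phi \<phi> t / p 1"
proof -
  have "p 1 * (\<bar>t\<bar> - 1) \<le> Phi \<phi> \<bar>t\<bar>"
    using Phi_support_line[of 1 "\<bar>t\<bar>"] Phi_nonneg[of 1] by simp
  then show ?thesis using p_pos[of 1] by (simp add: Phi_abs field_simps)
qed

lemma Phi_pos: "t \<noteq> 0 \<Longrightarrow> 0 < Phi \<phi> t"
proof -
  assume "t \<noteq> 0"
  then have "0 < \<bar>t\<bar> * p \<bar>t\<bar>" by (intro mult_pos_pos p_pos) auto
  then have "0 < m * Phi \<phi> \<bar>t\<bar>" using mult_p_le_Phi[of "\<bar>t\<bar>"] by linarith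
  then show ?thesis using m_gt by (simp add: Phi_abs zero_less_mult_iff)
qed

text \<open>\<open>Phi \<phi>\<close> is positive away from 0 and increases with the absolute value.
  Used to turn convergence of modular integrands into pointwise convergence of the
  functions.\<close>

lemma Phi_tendsto_0_imp:
  assumes "(\<lambda>n. Phi \<phi> (t n)) \<longlonglongrightarrow> 0" shows "t \<longlonglongrightarrow> 0"
proof (rule LIMSEQ_I)
  fix e :: real assume e: "0 < e"
  then have "\<forall>\<^sub>F n in sequentially. Phi \<phi> (t n) < Phi \<phi> e"
    using Phi_pos[of e] by (intro order_tendstoD(2)[OF assms]) auto
  then have "\<forall>\<^sub>F n in sequentially. norm (t n - 0) < e"
  proof eventually_elim
    case (elim n)
    show ?case
    proof (rule ccontr)
      assume "\<not> norm (t n - 0) < e"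
      then have "Phi \<phi> e \<le> Phi \<phi> (t n)" using e by (intro Phi_mono) auto
      with elim show False by simp
    qed
  qed
  then show "\<exists>N. \<forall>n\<ge>N. norm (t n - 0) < e" by (simp add: eventually_sequentially)
qed

end

section \<open>Orlicz spaces\<close>

text \<open>Completeness of Lebesgue measure. It gives measurability on the whole domain to the
  chosen \<open>weak_grad\<close>, known to agree almost everywhere with a measurable
  gradient.\<close>

lemma borel_measurable_lebesgue_on_cong_AE:
  fixes f g :: "'a::euclidean_space \<Rightarrow> real"
  assumes \<Omega>: "\<Omega> \<in> sets lebesgue" and f: "f \<in> borel_measurable (lebesgue_on \<Omega>)"
    and eq: "AE x in lebesgue_on \<Omega>. f x = g x"
  shows "g \<in> borel_measurable (lebesgue_on \<Omega>)"
proof -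
  have "(\<lambda>x. f x * indicator \<Omega> x) \<in> borel_measurable lebesgue"
    using f \<Omega> by (simp add: borel_measurable_restrict_space_iff mult.commute)
  moreover have "AE x in lebesgue. f x * indicator \<Omega> x = g x * indicator \<Omega> x"
  proof -
    have "AE x in lebesgue. x \<in> \<Omega> \<longrightarrow> f x = g x"
      using eq \<Omega> by (simp add: AE_restrict_space_iff)
    then show ?thesis by eventually_elim (auto simp: indicator_def)
  qed
  ultimately have "(\<lambda>x. g x * indicator \<Omega> x) \<in> borel_measurable lebesgue"
    by (rule borel_measurable_AE)
  then show ?thesis using \<Omega> by (simp add: borel_measurable_restrict_space_iff mult.commute)
qed

definition test_grad :: "('a::euclidean_space \<Rightarrow> real) \<Rightarrow> 'a \<Rightarrow> 'a" where
  "test_grad \<psi> x = (\<Sum>i\<in>Basis. pderiv_dir i \<psi> x *\<^sub>R i)"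

lemma test_grad_inner [simp]: "i \<in> Basis \<Longrightarrow> test_grad \<psi> x \<bullet> i = pderiv_dir i \<psi> x"
  by (simp add: test_grad_def)

lemma finite_measure_lebesgue_on_bounded_open:
  fixes \<Omega> :: "'a::euclidean_space set"
  assumes "open \<Omega>" "bounded \<Omega>" shows "finite_measure (lebesgue_on \<Omega>)"
  using assms by (intro finite_measure_lebesgue_on) (simp add: lmeasurable_open)

lemma test_functions_integrable:
  assumes "\<psi> \<in> test_functions \<Omega>" "finite_measure (lebesgue_on S)"
  shows "integrable (lebesgue_on S) \<psi>"
proof -
  interpret finite_measure "lebesgue_on S" by fact
  obtain B where "\<And>x. \<bar>\<psi> x\<bar> \<le> B" using test_functions_bounded[OF assms(1)] by metis
  then show ?thesis
    by (intro integrable_const_bound[of _ B] test_functions_borel_measurable[OF assms(1)]) auto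
qed

lemma wgrad_test_function:
  assumes \<Omega>: "open \<Omega>" "bounded \<Omega>" and \<psi>: "\<psi> \<in> test_functions \<Omega>"
  shows "wgrad \<Omega> \<psi> (test_grad \<psi>)"
  unfolding wgrad_def
proof (intro conjI ballI)
  have fin: "finite_measure (lebesgue_on \<Omega>)" using \<Omega> by (rule finite_measure_lebesgue_on_bounded_open)
  show "integrable (lebesgue_on \<Omega>) \<psi>" using \<psi> fin by (rule test_functions_integrable)
  fix i :: 'a assume i: "i \<in> Basis"
  then show "integrable (lebesgue_on \<Omega>) (\<lambda>x. test_grad \<psi> x \<bullet> i)"
    using test_functions_integrable[OF test_functions_pderiv_dir[OF \<psi> i] fin] by simp
  fix \<theta> assume \<theta>: "\<theta> \<in> test_functions \<Omega>"
  obtain K where K: "compact K" "K \<subseteq> \<Omega>" "\<And>x. x \<notin> K \<Longrightarrow> \<theta> x = 0"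
    using test_functions_support[OF \<theta>] by blast
  show "(\<integral>x. \<psi> x * pderiv_dir i \<theta> x \<partial>lebesgue_on \<Omega>) = - (\<integral>x. (test_grad \<psi> x \<bullet> i) * \<theta> x \<partial>lebesgue_on \<Omega>)"
    unfolding test_grad_inner[OF i]
    by (rule test_function_integration_by_parts[OF _ \<theta> i K open_UNIV])
      (use \<Omega>(1) \<psi> i in \<open>auto intro: Cinf_on_differentiable Cinf_on_continuous Cinf_on_pderiv_dir test_functions_Cinf\<close>)
qed

locale young_domain = young_function +
  fixes \<Omega> :: "'a::euclidean_space set"
  assumes open_\<Omega>: "open \<Omega>" and bounded_\<Omega>: "bounded \<Omega>"
begin

abbreviation M where "M \<equiv> lebesgue_on \<Omega>"

lemma sets_\<Omega>: "\<Omega> \<in> sets lebesgue" using open_\<Omega> by simp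

lemma finite_M: "finite_measure M"
  using open_\<Omega> bounded_\<Omega> by (rule finite_measure_lebesgue_on_bounded_open)

lemma Phi_comp_measurable: "u \<in> borel_measurable M \<Longrightarrow> (\<lambda>x. Phi \<phi> (u x)) \<in> borel_measurable M"
  using measurable_compose[OF _ Phi_measurable] by blast

lemma integrable_Phi_iff:
  assumes "u \<in> borel_measurable M"
  shows "integrable M (\<lambda>x. Phi \<phi> (u x)) \<longleftrightarrow> modular \<phi> \<Omega> u < \<infinity>"
  using Phi_comp_measurable[OF assms] by (simp add: integrable_iff_bounded modular_def Phi_nonneg)

lemma modular_eq:
  assumes "integrable M (\<lambda>x. Phi \<phi> (u x))"
  shows "modular \<phi> \<Omega> u = ennreal (\<integral>x. Phi \<phi> (u x) \<partial>M)"
  using assms unfolding modular_def by (intro nn_integral_eq_integral) (auto simp: Phi_nonneg)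

lemma integrable_Phi_scale:
  assumes "u \<in> borel_measurable M" "integrable M (\<lambda>x. Phi \<phi> (u x))"
  shows "integrable M (\<lambda>x. Phi \<phi> (c * u x))"
    "(\<integral>x. Phi \<phi> (c * u x) \<partial>M) \<le> (max 1 \<bar>c\<bar>) powr m * (\<integral>x. Phi \<phi> (u x) \<partial>M)"
proof -
  have i: "integrable M (\<lambda>x. (max 1 \<bar>c\<bar>) powr m * Phi \<phi> (u x))" using assms(2) by simp
  show 1: "integrable M (\<lambda>x. Phi \<phi> (c * u x))"
  proof (rule Bochner_Integration.integrable_bound[OF i])
    show "(\<lambda>x. Phi \<phi> (c * u x)) \<in> borel_measurable M"
      using assms(1) by (intro Phi_comp_measurable) auto
    show "AE x in M. norm (Phi \<phi> (c * u x)) \<le> norm ((max 1 \<bar>c\<bar>) powr m * Phi \<phi> (u x))"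
      using Phi_scale by (intro AE_I2) (simp add: Phi_nonneg)
  qed
  have "(\<integral>x. Phi \<phi> (c * u x) \<partial>M) \<le> (\<integral>x. (max 1 \<bar>c\<bar>) powr m * Phi \<phi> (u x) \<partial>M)"
    by (rule integral_mono[OF 1 i Phi_scale])
  then show "(\<integral>x. Phi \<phi> (c * u x) \<partial>M) \<le> (max 1 \<bar>c\<bar>) powr m * (\<integral>x. Phi \<phi> (u x) \<partial>M)" by simp
qed

text \<open>By the doubling condition the scaling constant in the definition can be removed, so
  later estimates concern ordinary integrals of \<open>Phi \<phi> (u x)\<close>.\<close>

lemma Orlicz_iff:
  "u \<in> Orlicz \<phi> \<Omega> \<longleftrightarrow> u \<in> borel_measurable M \<and> integrable M (\<lambda>x. Phi \<phi> (u x))"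
proof
  assume "u \<in> Orlicz \<phi> \<Omega>"
  then obtain c where u: "u \<in> borel_measurable M" and c: "c > 0" "modular \<phi> \<Omega> (\<lambda>x. u x / c) < \<infinity>"
    by (auto simp: Orlicz_def)
  have m: "(\<lambda>x. u x / c) \<in> borel_measurable M" using u by auto
  then have "integrable M (\<lambda>x. Phi \<phi> (u x / c))" using c(2) by (simp add: integrable_Phi_iff)
  from integrable_Phi_scale(1)[OF m this, of c] show "u \<in> borel_measurable M \<and> integrable M (\<lambda>x. Phi \<phi> (u x))"
    using u c(1) by simp
next
  assume u: "u \<in> borel_measurable M \<and> integrable M (\<lambda>x. Phi \<phi> (u x))"
  then have "modular \<phi> \<Omega> u < \<infinity>" using integrable_Phi_iff[of u] by blast
  then have "modular \<phi> \<Omega> (\<lambda>x. u x / 1) < \<infinity>" by simp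
  then have "\<exists>c>0. modular \<phi> \<Omega> (\<lambda>x. u x / c) < \<infinity>" using zero_less_one by blast
  then show "u \<in> Orlicz \<phi> \<Omega>" using u by (simp only: Orlicz_def mem_Collect_eq simp_thms)
qed

lemma Orlicz_dominated:
  assumes "v \<in> Orlicz \<phi> \<Omega>" "u \<in> borel_measurable M" "AE x in M. \<bar>u x\<bar> \<le> \<bar>v x\<bar>"
  shows "u \<in> Orlicz \<phi> \<Omega>"
proof -
  have "integrable M (\<lambda>x. Phi \<phi> (u x))"
  proof (rule Bochner_Integration.integrable_bound)
    show "integrable M (\<lambda>x. Phi \<phi> (v x))" using assms(1) by (simp add: Orlicz_iff)
    show "(\<lambda>x. Phi \<phi> (u x)) \<in> borel_measurable M" by (rule Phi_comp_measurable[OF assms(2)])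
    show "AE x in M. norm (Phi \<phi> (u x)) \<le> norm (Phi \<phi> (v x))"
      using assms(3)
    proof eventually_elim
      case (elim x)
      from Phi_mono[OF elim] show ?case by (simp add: Phi_nonneg)
    qed
  qed
  then show ?thesis using assms(2) by (simp add: Orlicz_iff)
qed

lemma Orlicz_scale: "u \<in> Orlicz \<phi> \<Omega> \<Longrightarrow> (\<lambda>x. c * u x) \<in> Orlicz \<phi> \<Omega>"
  using integrable_Phi_scale(1)[of u c] by (auto simp: Orlicz_iff)

lemma Orlicz_add:
  assumes "u \<in> Orlicz \<phi> \<Omega>" "v \<in> Orlicz \<phi> \<Omega>"
  shows "(\<lambda>x. u x + v x) \<in> Orlicz \<phi> \<Omega>"
    "(\<integral>x. Phi \<phi> (u x + v x) \<partial>M) \<le> 2 powr m * ((\<integral>x. Phi \<phi> (u x) \<partial>M) + (\<integral>x. Phi \<phi> (v x) \<partial>M))"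
proof -
  have m: "(\<lambda>x. u x + v x) \<in> borel_measurable M" using assms by (auto simp: Orlicz_iff)
  have i: "integrable M (\<lambda>x. 2 powr m * (Phi \<phi> (u x) + Phi \<phi> (v x)))" using assms by (simp add: Orlicz_iff)
  have 1: "integrable M (\<lambda>x. Phi \<phi> (u x + v x))"
  proof (rule Bochner_Integration.integrable_bound[OF i Phi_comp_measurable[OF m]])
    show "AE x in M. norm (Phi \<phi> (u x + v x)) \<le> norm (2 powr m * (Phi \<phi> (u x) + Phi \<phi> (v x)))"
      using Phi_add by (intro AE_I2) (simp add: Phi_nonneg)
  qed
  then show "(\<lambda>x. u x + v x) \<in> Orlicz \<phi> \<Omega>" using m by (simp add: Orlicz_iff)
  have "(\<integral>x. Phi \<phi> (u x + v x) \<partial>M) \<le> (\<integral>x. 2 powr m * (Phi \<phi> (u x) + Phi \<phi> (v x)) \<partial>M)"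
    by (rule integral_mono[OF 1 i Phi_add])
  then show "(\<integral>x. Phi \<phi> (u x + v x) \<partial>M) \<le> 2 powr m * ((\<integral>x. Phi \<phi> (u x) \<partial>M) + (\<integral>x. Phi \<phi> (v x) \<partial>M))"
    using assms by (simp add: Orlicz_iff)
qed

lemma Orlicz_diff:
  assumes "u \<in> Orlicz \<phi> \<Omega>" "v \<in> Orlicz \<phi> \<Omega>"
  shows "(\<lambda>x. u x - v x) \<in> Orlicz \<phi> \<Omega>"
  using Orlicz_add(1)[OF assms(1) Orlicz_scale[OF assms(2), of "-1"]] by simp

lemma Orlicz_abs: "u \<in> Orlicz \<phi> \<Omega> \<Longrightarrow> (\<lambda>x. \<bar>u x\<bar>) \<in> Orlicz \<phi> \<Omega>"
  by (rule Orlicz_dominated[of u]) (auto simp: Orlicz_iff)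

lemma Orlicz_integrable:
  assumes "u \<in> Orlicz \<phi> \<Omega>" shows "integrable M u"
proof -
  interpret finite_measure M by (rule finite_M)
  show ?thesis
  proof (rule Bochner_Integration.integrable_bound)
    show "integrable M (\<lambda>x. 1 + Phi \<phi> (u x) / p 1)" using assms by (simp add: Orlicz_iff)
    show "AE x in M. norm (u x) \<le> norm (1 + Phi \<phi> (u x) / p 1)"
    proof (rule AE_I2)
      fix x
      show "norm (u x) \<le> norm (1 + Phi \<phi> (u x) / p 1)" using abs_le_Phi[of "u x"] by simp
    qed
  qed (use assms in \<open>simp add: Orlicz_iff\<close>)
qed

lemma bounded_Orlicz:
  assumes "u \<in> borel_measurable M" "\<And>x. \<bar>u x\<bar> \<le> B"
  shows "u \<in> Orlicz \<phi> \<Omega>"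
proof (rule Orlicz_dominated[OF _ assms(1)])
  interpret finite_measure M by (rule finite_M)
  show "(\<lambda>_. B) \<in> Orlicz \<phi> \<Omega>" by (simp add: Orlicz_iff)
  show "AE x in M. \<bar>u x\<bar> \<le> \<bar>B\<bar>" by (intro AE_I2 order_trans[OF assms(2)]) simp
qed

lemma test_function_Orlicz:
  assumes "\<psi> \<in> test_functions \<Omega>" shows "\<psi> \<in> Orlicz \<phi> \<Omega>"
proof -
  obtain B where "\<And>x. \<bar>\<psi> x\<bar> \<le> B" using test_functions_bounded[OF assms] by metis
  then show ?thesis by (rule bounded_Orlicz[OF test_functions_borel_measurable[OF assms]])
qed

section \<open>Modular convergence and the Luxemburg norm\<close>

text \<open>Scaling the argument by \<open>1/c\<close> costs only the fixed doubling factor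
  \<open>K\<close>, so the threshold \<open>1 / K\<close> is the same for all
  \<open>u\<close>.\<close>

lemma luxemburg_norm_small:
  assumes "\<epsilon> > 0"
  shows "\<exists>\<delta>>0. \<forall>u\<in>Orlicz \<phi> \<Omega>. (\<integral>x. Phi \<phi> (u x) \<partial>M) \<le> \<delta> \<longrightarrow> luxemburg_norm \<phi> \<Omega> u < \<epsilon>"
proof -
  \<comment> \<open>Half of \<open>\<epsilon>\<close>, because the infimum is shown to be at most
    \<open>c\<close> while the claim is strict.\<close>
  define c where "c = \<epsilon> / 2"
  have c: "0 < c" "c < \<epsilon>" using assms by (auto simp: c_def)
  define K where "K = (max 1 \<bar>1/c\<bar>) powr m"
  have K: "K > 0" by (simp add: K_def)
  have "luxemburg_norm \<phi> \<Omega> u < \<epsilon>" if u: "u \<in> Orlicz \<phi> \<Omega>" and le: "(\<integral>x. Phi \<phi> (u x) \<partial>M) \<le> 1 / K" for u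
  proof -
    have um: "u \<in> borel_measurable M" "integrable M (\<lambda>x. Phi \<phi> (u x))" using u by (auto simp: Orlicz_iff)
    note sc = integrable_Phi_scale[OF um, of "1/c"]
    have "modular \<phi> \<Omega> (\<lambda>x. 1 / c * u x) = ennreal (\<integral>x. Phi \<phi> (1 / c * u x) \<partial>M)"
      by (rule modular_eq[OF sc(1)])
    also have "\<dots> \<le> ennreal 1"
    proof (rule ennreal_leI)
      have "(\<integral>x. Phi \<phi> (1 / c * u x) \<partial>M) \<le> K * (\<integral>x. Phi \<phi> (u x) \<partial>M)" using sc(2) by (simp add: K_def)
      also have "\<dots> \<le> K * (1 / K)" using K le by (intro mult_left_mono) auto
      finally show "(\<integral>x. Phi \<phi> (1 / c * u x) \<partial>M) \<le> 1" using K by simp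
    qed
    finally have "modular \<phi> \<Omega> (\<lambda>x. u x / c) \<le> 1" by simp
    then have "luxemburg_norm \<phi> \<Omega> u \<le> c"
      unfolding luxemburg_norm_def using c(1) by (intro cInf_lower bdd_belowI[of _ 0]) auto
    then show ?thesis using c(2) by simp
  qed
  then show ?thesis using K by (intro exI[of _ "1/K"]) auto
qed

text \<open>An infimum of reals is meaningful only over a nonempty set. By convexity, division by a
  \<open>c \<ge> 1\<close> divides the modular at least by \<open>c\<close>, so a \<open>c\<close>
  above the modular is a witness.\<close>

lemma luxemburg_set_nonempty:
  assumes "u \<in> Orlicz \<phi> \<Omega>"
  shows "\<exists>c>0. modular \<phi> \<Omega> (\<lambda>x. u x / c) \<le> 1"
proof -
  let ?I = "\<integral>x. Phi \<phi> (u x) \<partial>M"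
  define c where "c = max 1 ?I"
  have c: "c \<ge> 1" "c \<ge> ?I" by (auto simp: c_def)
  have um: "u \<in> borel_measurable M" "integrable M (\<lambda>x. Phi \<phi> (u x))" using assms by (auto simp: Orlicz_iff)
  note sc = integrable_Phi_scale(1)[OF um, of "1/c"]
  have "modular \<phi> \<Omega> (\<lambda>x. 1 / c * u x) = ennreal (\<integral>x. Phi \<phi> (1 / c * u x) \<partial>M)"
    by (rule modular_eq[OF sc])
  also have "\<dots> \<le> ennreal 1"
  proof (rule ennreal_leI)
    have "(\<integral>x. Phi \<phi> (1 / c * u x) \<partial>M) \<le> (\<integral>x. 1 / c * Phi \<phi> (u x) \<partial>M)"
      using c(1) um(2) by (intro integral_mono[OF sc] Phi_scale_le1) auto
    also have "\<dots> = ?I / c" by simp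
    also have "\<dots> \<le> 1" using c by (simp add: divide_le_eq)
    finally show "(\<integral>x. Phi \<phi> (1 / c * u x) \<partial>M) \<le> 1" .
  qed
  finally show ?thesis using c(1) by (intro exI[of _ c]) auto
qed

lemma luxemburg_norm_nonneg:
  assumes "u \<in> Orlicz \<phi> \<Omega>" shows "0 \<le> luxemburg_norm \<phi> \<Omega> u"
  unfolding luxemburg_norm_def using luxemburg_set_nonempty[OF assms] by (intro cInf_greatest) auto

text \<open>A norm below \<open>\<epsilon>\<close> gives an admissible scaling factor
  \<open>c < \<epsilon>\<close>. As \<open>c\<close> is then below 1, convexity yields
  \<open>Phi \<phi> t \<le> c * Phi \<phi> (t / c)\<close>, and the modular is at most
  \<open>c\<close>.\<close>

lemma luxemburg_norm_less_imp:
  assumes u: "u \<in> Orlicz \<phi> \<Omega>" and less: "luxemburg_norm \<phi> \<Omega> u < \<epsilon>" and \<epsilon>: "\<epsilon> \<le> 1"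
  shows "(\<integral>x. Phi \<phi> (u x) \<partial>M) \<le> \<epsilon>"
proof -
  let ?S = "{c. c > 0 \<and> modular \<phi> \<Omega> (\<lambda>x. u x / c) \<le> 1}"
  have "?S \<noteq> {}" using luxemburg_set_nonempty[OF u] by auto
  from cInf_lessD[OF this less[unfolded luxemburg_norm_def]]
  obtain c where c: "0 < c" "modular \<phi> \<Omega> (\<lambda>x. u x / c) \<le> 1" "c < \<epsilon>" by auto
  have um: "u \<in> borel_measurable M" "integrable M (\<lambda>x. Phi \<phi> (u x))" using u by (auto simp: Orlicz_iff)
  note sc = integrable_Phi_scale(1)[OF um, of "1/c"]
  have "ennreal (\<integral>x. Phi \<phi> (1 / c * u x) \<partial>M) \<le> ennreal 1"
    using c(2) modular_eq[OF sc] by simp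
  then have le: "(\<integral>x. Phi \<phi> (1 / c * u x) \<partial>M) \<le> 1" by (simp add: ennreal_le_iff)
  have "(\<integral>x. Phi \<phi> (u x) \<partial>M) \<le> (\<integral>x. c * Phi \<phi> (1 / c * u x) \<partial>M)"
  proof (rule integral_mono[OF um(2)])
    fix x
    show "Phi \<phi> (u x) \<le> c * Phi \<phi> (1 / c * u x)"
      using Phi_scale_le1[of c "1 / c * u x"] c \<epsilon> by simp
  qed (use sc in simp)
  also have "\<dots> \<le> c * 1" using le c(1) by simp
  finally show ?thesis using c(3) by simp
qed

section \<open>Sobolev functions and the closure of the test functions in modular form\<close>

lemma W1D:
  assumes "u \<in> W1 \<phi> \<Omega>"
  shows "u \<in> Orlicz \<phi> \<Omega>" "wgrad \<Omega> u (weak_grad \<Omega> u)"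
    "i \<in> Basis \<Longrightarrow> (\<lambda>x. weak_grad \<Omega> u x \<bullet> i) \<in> Orlicz \<phi> \<Omega>"
proof -
  show u: "u \<in> Orlicz \<phi> \<Omega>" using assms by (simp add: W1_def)
  obtain G where G: "has_weak_grad \<Omega> u G" "\<And>i. i \<in> Basis \<Longrightarrow> (\<lambda>x. G x \<bullet> i) \<in> Orlicz \<phi> \<Omega>"
    using assms by (auto simp: W1_def)
  have w: "wgrad \<Omega> u G"
    by (rule has_weak_grad_imp_wgrad[OF G(1) Orlicz_integrable[OF u] Orlicz_integrable[OF G(2)]])
  have ae: "AE x in M. G x = weak_grad \<Omega> u x"
    using weak_grad_eq[OF open_\<Omega> w] by eventually_elim simp
  have aei: "AE x in M. G x \<bullet> i = weak_grad \<Omega> u x \<bullet> i" for i using ae by eventually_elim simp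
  have m: "(\<lambda>x. weak_grad \<Omega> u x \<bullet> i) \<in> borel_measurable M" if "i \<in> Basis" for i
    using G(2)[OF that] by (intro borel_measurable_lebesgue_on_cong_AE[OF sets_\<Omega> _ aei]) (simp add: Orlicz_iff)
  show "wgrad \<Omega> u (weak_grad \<Omega> u)"
    by (rule wgrad_cong_AE[OF w _ ae _ m]) (use u in \<open>auto simp: Orlicz_iff\<close>)
  show "(\<lambda>x. weak_grad \<Omega> u x \<bullet> i) \<in> Orlicz \<phi> \<Omega>" if "i \<in> Basis"
  proof (rule Orlicz_dominated[OF G(2)[OF that] m[OF that]])
    show "AE x in M. \<bar>weak_grad \<Omega> u x \<bullet> i\<bar> \<le> \<bar>G x \<bullet> i\<bar>" using aei[of i] by eventually_elim simp
  qed
qed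

lemma W1I:
  assumes "u \<in> Orlicz \<phi> \<Omega>" "wgrad \<Omega> u G" "\<And>i. i \<in> Basis \<Longrightarrow> (\<lambda>x. G x \<bullet> i) \<in> Orlicz \<phi> \<Omega>"
  shows "u \<in> W1 \<phi> \<Omega>"
  using assms wgrad_imp_has_weak_grad[OF assms(2) sets_\<Omega>] unfolding W1_def by blast

lemma weak_grad_diff_test:
  assumes u: "u \<in> W1 \<phi> \<Omega>" and \<psi>: "\<psi> \<in> test_functions \<Omega>"
  shows "(\<lambda>x. u x - \<psi> x) \<in> W1 \<phi> \<Omega>"
    "AE x in M. weak_grad \<Omega> (\<lambda>x. u x - \<psi> x) x = weak_grad \<Omega> u x - test_grad \<psi> x"
proof -
  have w: "wgrad \<Omega> (\<lambda>x. u x - \<psi> x) (\<lambda>x. weak_grad \<Omega> u x - test_grad \<psi> x)"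
    by (rule wgrad_diff[OF W1D(2)[OF u] wgrad_test_function[OF open_\<Omega> bounded_\<Omega> \<psi>]])
  show "(\<lambda>x. u x - \<psi> x) \<in> W1 \<phi> \<Omega>"
  proof (rule W1I[OF _ w])
    show "(\<lambda>x. u x - \<psi> x) \<in> Orlicz \<phi> \<Omega>" by (rule Orlicz_diff[OF W1D(1)[OF u] test_function_Orlicz[OF \<psi>]])
    fix i :: 'a assume i: "i \<in> Basis"
    show "(\<lambda>x. (weak_grad \<Omega> u x - test_grad \<psi> x) \<bullet> i) \<in> Orlicz \<phi> \<Omega>"
      using Orlicz_diff[OF W1D(3)[OF u i] test_function_Orlicz[OF test_functions_pderiv_dir[OF \<psi> i]]] i
      by (simp add: inner_diff_left)
  qed
  show "AE x in M. weak_grad \<Omega> (\<lambda>x. u x - \<psi> x) x = weak_grad \<Omega> u x - test_grad \<psi> x"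
    by (rule weak_grad_eq[OF open_\<Omega> w])
qed

lemma integral_Phi_weak_grad_diff_test:
  assumes u: "u \<in> W1 \<phi> \<Omega>" and \<psi>: "\<psi> \<in> test_functions \<Omega>" and i: "i \<in> Basis"
  shows "(\<integral>x. Phi \<phi> (weak_grad \<Omega> (\<lambda>x. u x - \<psi> x) x \<bullet> i) \<partial>M) = (\<integral>x. Phi \<phi> (weak_grad \<Omega> u x \<bullet> i - pderiv_dir i \<psi> x) \<partial>M)"
proof (rule integral_cong_AE)
  note D = weak_grad_diff_test[OF u \<psi>]
  show "(\<lambda>x. Phi \<phi> (weak_grad \<Omega> (\<lambda>x. u x - \<psi> x) x \<bullet> i)) \<in> borel_measurable M"
    using W1D(3)[OF D(1) i] by (intro Phi_comp_measurable) (simp add: Orlicz_iff)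
  have "(\<lambda>x. weak_grad \<Omega> u x \<bullet> i - pderiv_dir i \<psi> x) \<in> Orlicz \<phi> \<Omega>"
    by (rule Orlicz_diff[OF W1D(3)[OF u i] test_function_Orlicz[OF test_functions_pderiv_dir[OF \<psi> i]]])
  then show "(\<lambda>x. Phi \<phi> (weak_grad \<Omega> u x \<bullet> i - pderiv_dir i \<psi> x)) \<in> borel_measurable M"
    by (intro Phi_comp_measurable) (simp add: Orlicz_iff)
  show "AE x in M. Phi \<phi> (weak_grad \<Omega> (\<lambda>x. u x - \<psi> x) x \<bullet> i) = Phi \<phi> (weak_grad \<Omega> u x \<bullet> i - pderiv_dir i \<psi> x)"
    using D(2) by eventually_elim (simp add: i inner_diff_left)
qed

text \<open>Together with \<open>W10I\<close> this replaces norm approximation by smallness of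
  integrals, to which pointwise estimates and dominated convergence apply.\<close>

lemma W10_approx:
  assumes v: "v \<in> W10 \<phi> \<Omega>" and "\<epsilon> > 0"
  shows "\<exists>\<psi>\<in>test_functions \<Omega>. (\<integral>x. Phi \<phi> (v x - \<psi> x) \<partial>M) \<le> \<epsilon> \<and>
    (\<forall>i\<in>Basis. (\<integral>x. Phi \<phi> (weak_grad \<Omega> v x \<bullet> i - pderiv_dir i \<psi> x) \<partial>M) \<le> \<epsilon>)"
proof -
  have v1: "v \<in> W1 \<phi> \<Omega>" using v by (simp add: W10_def)
  \<comment> \<open>Norm smallness is converted into modular smallness only for bounds up to
    1.\<close>
  define e where "e = min 1 \<epsilon>"
  have e: "0 < e" "e \<le> 1" "e \<le> \<epsilon>" using assms(2) by (auto simp: e_def)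
  obtain \<psi> where \<psi>: "\<psi> \<in> test_functions \<Omega>" "W1_norm \<phi> \<Omega> (\<lambda>x. v x - \<psi> x) < e"
    using v e(1) unfolding W10_def by blast
  note D = weak_grad_diff_test[OF v1 \<psi>(1)]
  let ?d = "\<lambda>x. v x - \<psi> x"
  have n0: "0 \<le> luxemburg_norm \<phi> \<Omega> ?d" by (rule luxemburg_norm_nonneg[OF W1D(1)[OF D(1)]])
  have ni: "0 \<le> luxemburg_norm \<phi> \<Omega> (\<lambda>x. weak_grad \<Omega> ?d x \<bullet> i)" if "i \<in> Basis" for i
    by (rule luxemburg_norm_nonneg[OF W1D(3)[OF D(1) that]])
  have s: "luxemburg_norm \<phi> \<Omega> ?d + (\<Sum>i\<in>Basis. luxemburg_norm \<phi> \<Omega> (\<lambda>x. weak_grad \<Omega> ?d x \<bullet> i)) < e"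
    using \<psi>(2) by (simp add: W1_norm_def)
  have "luxemburg_norm \<phi> \<Omega> ?d < e"
    using s sum_nonneg[of Basis "\<lambda>i. luxemburg_norm \<phi> \<Omega> (\<lambda>x. weak_grad \<Omega> ?d x \<bullet> i)", OF ni] by linarith
  then have 1: "(\<integral>x. Phi \<phi> (v x - \<psi> x) \<partial>M) \<le> \<epsilon>"
    using luxemburg_norm_less_imp[OF W1D(1)[OF D(1)] _ e(2)] e(3) by fastforce
  have 2: "(\<integral>x. Phi \<phi> (weak_grad \<Omega> v x \<bullet> i - pderiv_dir i \<psi> x) \<partial>M) \<le> \<epsilon>" if i: "i \<in> Basis" for i
  proof -
    have "luxemburg_norm \<phi> \<Omega> (\<lambda>x. weak_grad \<Omega> ?d x \<bullet> i) \<le> (\<Sum>i\<in>Basis. luxemburg_norm \<phi> \<Omega> (\<lambda>x. weak_grad \<Omega> ?d x \<bullet> i))"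
      using ni i by (intro member_le_sum) auto
    then have "luxemburg_norm \<phi> \<Omega> (\<lambda>x. weak_grad \<Omega> ?d x \<bullet> i) < e" using s n0 by linarith
    from luxemburg_norm_less_imp[OF W1D(3)[OF D(1) i] this e(2)] show ?thesis
      using e(3) by (simp add: integral_Phi_weak_grad_diff_test[OF v1 \<psi>(1) i])
  qed
  show ?thesis using \<psi>(1) 1 2 by blast
qed

lemma W10I:
  assumes w: "w \<in> W1 \<phi> \<Omega>"
    and approx: "\<And>\<delta>. \<delta> > 0 \<Longrightarrow> \<exists>\<psi>\<in>test_functions \<Omega>. (\<integral>x. Phi \<phi> (w x - \<psi> x) \<partial>M) \<le> \<delta> \<and>
      (\<forall>i\<in>Basis. (\<integral>x. Phi \<phi> (weak_grad \<Omega> w x \<bullet> i - pderiv_dir i \<psi> x) \<partial>M) \<le> \<delta>)"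
  shows "w \<in> W10 \<phi> \<Omega>"
  unfolding W10_def
proof (intro CollectI conjI w allI impI)
  fix \<epsilon> :: real assume "\<epsilon> > 0"
  \<comment> \<open>One share for the function itself and one for each partial derivative.\<close>
  define e where "e = \<epsilon> / (real DIM('a) + 1)"
  have e: "e > 0" using \<open>\<epsilon> > 0\<close> by (simp add: e_def add_nonneg_pos)
  obtain \<delta> where \<delta>: "\<delta> > 0" "\<And>u. u \<in> Orlicz \<phi> \<Omega> \<Longrightarrow> (\<integral>x. Phi \<phi> (u x) \<partial>M) \<le> \<delta> \<Longrightarrow> luxemburg_norm \<phi> \<Omega> u < e"
    using luxemburg_norm_small[OF e] by blast
  obtain \<psi> where \<psi>: "\<psi> \<in> test_functions \<Omega>" "(\<integral>x. Phi \<phi> (w x - \<psi> x) \<partial>M) \<le> \<delta>"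
      "\<And>i. i \<in> Basis \<Longrightarrow> (\<integral>x. Phi \<phi> (weak_grad \<Omega> w x \<bullet> i - pderiv_dir i \<psi> x) \<partial>M) \<le> \<delta>"
    using approx[OF \<delta>(1)] by blast
  note D = weak_grad_diff_test[OF w \<psi>(1)]
  let ?d = "\<lambda>x. w x - \<psi> x"
  have 1: "luxemburg_norm \<phi> \<Omega> ?d < e" by (rule \<delta>(2)[OF W1D(1)[OF D(1)] \<psi>(2)])
  have "luxemburg_norm \<phi> \<Omega> (\<lambda>x. weak_grad \<Omega> ?d x \<bullet> i) < e" if i: "i \<in> Basis" for i
    by (rule \<delta>(2)[OF W1D(3)[OF D(1) i]]) (simp add: integral_Phi_weak_grad_diff_test[OF w \<psi>(1) i] \<psi>(3)[OF i])
  then have "(\<Sum>i\<in>Basis. luxemburg_norm \<phi> \<Omega> (\<lambda>x. weak_grad \<Omega> ?d x \<bullet> i)) \<le> (\<Sum>i\<in>(Basis::'a set). e)"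
    by (intro sum_mono less_imp_le) auto
  with 1 have "W1_norm \<phi> \<Omega> ?d < e + real DIM('a) * e" unfolding W1_norm_def by simp
  also have "\<dots> = (real DIM('a) + 1) * e" by (simp add: algebra_simps)
  also have "\<dots> = \<epsilon>" by (simp add: e_def)
  finally show "\<exists>\<psi>\<in>test_functions \<Omega>. W1_norm \<phi> \<Omega> (\<lambda>x. w x - \<psi> x) < \<epsilon>" using \<psi>(1) by blast
qed

section \<open>Mollification in Orlicz spaces\<close>

text \<open>Jensen's inequality. Near the boundary the kernel may have mass less than 1 in \<open>\<Omega>\<close>, which does no
  harm because \<open>Phi \<phi> a \<le> a * p a\<close>.\<close>

lemma Phi_moll_le:
  assumes r: "r > 0" and f: "integrable M f" and Pf: "integrable M (\<lambda>y. Phi \<phi> (f y))"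
  shows "Phi \<phi> (moll r \<Omega> f x) \<le> moll r \<Omega> (\<lambda>y. Phi \<phi> (f y)) x"
proof -
  let ?a = "moll r \<Omega> f x" and ?b = "\<lambda>y. bump r (x - y)"
  interpret finite_measure M by (rule finite_M)
  have ib: "integrable M ?b" using moll_integrand_integrable[OF r, of \<Omega> "\<lambda>_. 1" x] by simp
  define \<mu> where "\<mu> = (\<integral>y. ?b y \<partial>M)"
  have "integrable lborel (\<lambda>y. ?b y)"
    by (rule continuous_compact_support_integrable[of _ "cball x r"])
      (auto simp: dist_norm[of x] intro!: bump_eq_0 r continuous_on_compose2[OF Cinf_on_continuous[OF Cinf_on_bump, of UNIV]] continuous_intros)
  then have ibl: "integrable lebesgue ?b" by (subst integrable_completion) auto
  have "\<mu> = (\<integral>y. indicator \<Omega> y *\<^sub>R ?b y \<partial>lebesgue)"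
    unfolding \<mu>_def using sets_\<Omega> by (simp add: integral_restrict_space)
  also have "\<dots> \<le> (\<integral>y. ?b y \<partial>lebesgue)"
    by (rule integral_mono[OF integrable_mult_indicator[OF sets_\<Omega> ibl] ibl]) (simp add: indicator_def bump_nonneg[OF r])
  also have "\<dots> = (\<integral>y. ?b y \<partial>lborel)" by (rule integral_completion) measurable
  also have "\<dots> = 1" using integral_bump[OF r] by (subst lborel_integral_reflect) auto
  finally have \<mu>: "\<mu> \<le> 1" .
  have "(Phi \<phi> ?a - p ?a * ?a) * \<mu> + p ?a * ?a = (\<integral>y. (Phi \<phi> ?a - p ?a * ?a) * ?b y + p ?a * (f y * ?b y) \<partial>M)"
    using ib moll_integrand_integrable[OF r f, of x] by (simp add: \<mu>_def moll_def)
  also have "\<dots> \<le> (\<integral>y. Phi \<phi> (f y) * ?b y \<partial>M)"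
  proof (rule integral_mono)
    fix y
    have "(Phi \<phi> ?a + p ?a * (f y - ?a)) * ?b y \<le> Phi \<phi> (f y) * ?b y"
      by (intro mult_right_mono Phi_support_line bump_nonneg r)
    then show "(Phi \<phi> ?a - p ?a * ?a) * ?b y + p ?a * (f y * ?b y) \<le> Phi \<phi> (f y) * ?b y"
      by (simp add: algebra_simps)
  qed (use ib moll_integrand_integrable[OF r f, of x] moll_integrand_integrable[OF r Pf, of x] in auto)
  finally have "(Phi \<phi> ?a - p ?a * ?a) * \<mu> + p ?a * ?a \<le> moll r \<Omega> (\<lambda>y. Phi \<phi> (f y)) x" by (simp add: moll_def)
  moreover have "(Phi \<phi> ?a - p ?a * ?a) * 1 \<le> (Phi \<phi> ?a - p ?a * ?a) * \<mu>"
    using \<mu> Phi_le_mult_p[of ?a] by (intro mult_left_mono_neg) (auto simp: mult.commute)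
  ultimately show ?thesis by simp
qed

text \<open>Jensen's inequality and \<open>Phi_add\<close> bound the integrand by
  \<open>Phi \<phi> (f x)\<close> plus the mollification of \<open>Phi \<phi> (f y)\<close>, up to a
  constant. This majorant depends on \<open>n\<close> but converges in the mean.\<close>

lemma moll_Phi_convergence:
  assumes r: "\<And>n. 0 < r n" and f: "f \<in> Orlicz \<phi> \<Omega>"
    and lim: "AE x in M. (\<lambda>n. moll (r n) \<Omega> f x) \<longlonglongrightarrow> f x"
    and L1: "(\<lambda>n. \<integral>x. \<bar>moll (r n) \<Omega> (\<lambda>y. Phi \<phi> (f y)) x - Phi \<phi> (f x)\<bar> \<partial>M) \<longlonglongrightarrow> 0"
    and int: "\<And>n. integrable M (moll (r n) \<Omega> (\<lambda>y. Phi \<phi> (f y)))"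
  shows "(\<lambda>n. \<integral>x. Phi \<phi> (f x - moll (r n) \<Omega> f x) \<partial>M) \<longlonglongrightarrow> 0"
proof -
  have fm: "f \<in> borel_measurable M" and Pf: "integrable M (\<lambda>x. Phi \<phi> (f x))" using f by (auto simp: Orlicz_iff)
  have fi: "integrable M f" by (rule Orlicz_integrable[OF f])
  have mm: "moll (r n) \<Omega> f \<in> borel_measurable M" for n by (rule moll_measurable[OF r fi])
  let ?K = "2 powr m"
  have "(\<lambda>n. \<integral>x. Phi \<phi> (f x - moll (r n) \<Omega> f x) \<partial>M) \<longlonglongrightarrow> (\<integral>x. 0 \<partial>M)"
  proof (rule generalized_dominated_convergence(3)[where W="\<lambda>n x. ?K * (Phi \<phi> (f x) + moll (r n) \<Omega> (\<lambda>y. Phi \<phi> (f y)) x)"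
        and w="\<lambda>x. ?K * (Phi \<phi> (f x) + Phi \<phi> (f x))"])
    show "(\<lambda>x. Phi \<phi> (f x - moll (r n) \<Omega> f x)) \<in> borel_measurable M" for n
      by (intro Phi_comp_measurable borel_measurable_diff fm mm)
    show "integrable M (\<lambda>x. ?K * (Phi \<phi> (f x) + Phi \<phi> (f x)))"
      "integrable M (\<lambda>x. ?K * (Phi \<phi> (f x) + moll (r n) \<Omega> (\<lambda>y. Phi \<phi> (f y)) x))" for n
      using Pf int[of n] by auto
    have eq: "\<bar>?K * (Phi \<phi> (f x) + moll (r n) \<Omega> (\<lambda>y. Phi \<phi> (f y)) x) - ?K * (Phi \<phi> (f x) + Phi \<phi> (f x))\<bar>
      = ?K * \<bar>moll (r n) \<Omega> (\<lambda>y. Phi \<phi> (f y)) x - Phi \<phi> (f x)\<bar>" for n x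
    proof -
      have "?K * (Phi \<phi> (f x) + moll (r n) \<Omega> (\<lambda>y. Phi \<phi> (f y)) x) - ?K * (Phi \<phi> (f x) + Phi \<phi> (f x))
        = ?K * (moll (r n) \<Omega> (\<lambda>y. Phi \<phi> (f y)) x - Phi \<phi> (f x))" by (simp add: algebra_simps)
      then show ?thesis by (simp add: abs_mult)
    qed
    show "(\<lambda>n. \<integral>x. \<bar>?K * (Phi \<phi> (f x) + moll (r n) \<Omega> (\<lambda>y. Phi \<phi> (f y)) x) - ?K * (Phi \<phi> (f x) + Phi \<phi> (f x))\<bar> \<partial>M) \<longlonglongrightarrow> 0"
      unfolding eq using tendsto_mult_right_zero[OF L1, of ?K] by simp
    show "AE x in M. (\<lambda>n. Phi \<phi> (f x - moll (r n) \<Omega> f x)) \<longlonglongrightarrow> 0"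
      using lim
    proof eventually_elim
      case (elim x)
      have "(\<lambda>n. f x - moll (r n) \<Omega> f x) \<longlonglongrightarrow> f x - f x" using elim by (intro tendsto_diff tendsto_const)
      then have "(\<lambda>n. Phi \<phi> (f x - moll (r n) \<Omega> f x)) \<longlonglongrightarrow> Phi \<phi> (f x - f x)"
        by (rule isCont_tendsto_compose[OF Phi_isCont])
      then show ?case by simp
    qed
    show "AE x in M. \<bar>Phi \<phi> (f x - moll (r n) \<Omega> f x)\<bar> \<le> ?K * (Phi \<phi> (f x) + moll (r n) \<Omega> (\<lambda>y. Phi \<phi> (f y)) x)" for n
    proof (rule AE_I2)
      fix x
      have "Phi \<phi> (f x + - moll (r n) \<Omega> f x) \<le> ?K * (Phi \<phi> (f x) + Phi \<phi> (- moll (r n) \<Omega> f x))" by (rule Phi_add)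
      also have "\<dots> \<le> ?K * (Phi \<phi> (f x) + moll (r n) \<Omega> (\<lambda>y. Phi \<phi> (f y)) x)"
        unfolding Phi_minus by (intro mult_left_mono add_left_mono Phi_moll_le r fi Pf) auto
      finally show "\<bar>Phi \<phi> (f x - moll (r n) \<Omega> f x)\<bar> \<le> ?K * (Phi \<phi> (f x) + moll (r n) \<Omega> (\<lambda>y. Phi \<phi> (f y)) x)"
        by (simp add: Phi_nonneg)
    qed
    show "AE x in M. \<bar>0\<bar> \<le> ?K * (Phi \<phi> (f x) + Phi \<phi> (f x))" by (intro AE_I2) (simp add: Phi_nonneg)
  qed auto
  then show ?thesis by simp
qed

text \<open>Mollification with radius below the distance of the support to the boundary gives test
  functions, and it commutes with the gradient. The hypotheses ask \<open>g\<close> and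
  \<open>H\<close> to vanish off \<open>K\<close> at every point, so that supports can be located
  exactly.\<close>

lemma compact_support_approx:
  assumes g: "g \<in> Orlicz \<phi> \<Omega>" "wgrad \<Omega> g H" "\<And>i. i \<in> Basis \<Longrightarrow> (\<lambda>x. H x \<bullet> i) \<in> Orlicz \<phi> \<Omega>"
    and K: "compact K" "K \<subseteq> \<Omega>" "\<And>x. x \<notin> K \<Longrightarrow> g x = 0" "\<And>x. x \<notin> K \<Longrightarrow> H x = 0"
    and \<delta>: "\<delta> > 0"
  shows "\<exists>\<theta>\<in>test_functions \<Omega>. (\<integral>x. Phi \<phi> (g x - \<theta> x) \<partial>M) \<le> \<delta> \<and>
    (\<forall>i\<in>Basis. (\<integral>x. Phi \<phi> (H x \<bullet> i - pderiv_dir i \<theta> x) \<partial>M) \<le> \<delta>)"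
proof -
  obtain e where e: "e > 0" "(\<Union>x\<in>K. ball x e) \<subseteq> \<Omega>"
    using compact_subset_open_imp_ball_epsilon_subset[OF K(1) open_\<Omega> K(2)] by blast
  let ?F = "insert g ((\<lambda>i x. H x \<bullet> i) ` Basis)"
  \<comment> \<open>Besides the functions, their compositions with \<open>Phi \<phi>\<close> must
    converge under the same radii, as \<open>moll_Phi_convergence\<close> uses them for the
    majorants.\<close>
  let ?I = "?F \<union> (\<lambda>f x. Phi \<phi> (f x)) ` ?F"
  have FO: "f \<in> Orlicz \<phi> \<Omega>" if "f \<in> ?F" for f using that g by auto
  have fin: "finite ?I" by simp
  have int: "integrable M f" if "f \<in> ?I" for f
    using that
  proof (rule UnE)
    assume "f \<in> ?F"
    then show ?thesis by (rule Orlicz_integrable[OF FO])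
  next
    assume "f \<in> (\<lambda>f x. Phi \<phi> (f x)) ` ?F"
    then obtain h where "f = (\<lambda>x. Phi \<phi> (h x))" "h \<in> ?F" by (rule imageE)
    then show ?thesis using FO[of h] by (simp only: Orlicz_iff)
  qed
  have "\<exists>r. (\<forall>n. 0 < r n \<and> r n < e/2) \<and> r \<longlonglongrightarrow> 0 \<and> (\<forall>f\<in>?I.
      (AE x in M. (\<lambda>n. moll (r n) \<Omega> f x) \<longlonglongrightarrow> f x) \<and>
      (\<lambda>n. \<integral>x. \<bar>moll (r n) \<Omega> f x - f x\<bar> \<partial>M) \<longlonglongrightarrow> 0 \<and>
      (\<forall>n. integrable M (moll (r n) \<Omega> f)))"
    by (rule moll_sequence[OF sets_\<Omega> fin, of "\<lambda>f. f" "e/2"]) (use int e(1) in simp_all)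
  then obtain r where r': "\<forall>n. 0 < r n \<and> r n < e/2" and rI: "\<forall>f\<in>?I.
      (AE x in M. (\<lambda>n. moll (r n) \<Omega> f x) \<longlonglongrightarrow> f x) \<and>
      (\<lambda>n. \<integral>x. \<bar>moll (r n) \<Omega> f x - f x\<bar> \<partial>M) \<longlonglongrightarrow> 0 \<and>
      (\<forall>n. integrable M (moll (r n) \<Omega> f))"
    by (elim exE conjE)
  have r: "0 < r n" "r n < e/2" for n using r' by auto
  have conv: "(\<lambda>n. \<integral>x. Phi \<phi> (f x - moll (r n) \<Omega> f x) \<partial>M) \<longlonglongrightarrow> 0" if f: "f \<in> ?F" for f
  proof (rule moll_Phi_convergence[OF r(1) FO[OF f]])
    have fI: "f \<in> ?I" using f by (rule UnI1)
    have PI: "(\<lambda>x. Phi \<phi> (f x)) \<in> ?I" using f by (intro UnI2 imageI)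
    show "AE x in M. (\<lambda>n. moll (r n) \<Omega> f x) \<longlonglongrightarrow> f x"
      using bspec[OF rI fI] by (elim conjE)
    show "(\<lambda>n. \<integral>x. \<bar>moll (r n) \<Omega> (\<lambda>y. Phi \<phi> (f y)) x - Phi \<phi> (f x)\<bar> \<partial>M) \<longlonglongrightarrow> 0"
      using bspec[OF rI PI] by (elim conjE)
    show "integrable M (moll (r n) \<Omega> (\<lambda>y. Phi \<phi> (f y)))" for n
      using bspec[OF rI PI] by (elim conjE) (erule spec)
  qed
  have "\<forall>\<^sub>F n in sequentially. \<forall>f\<in>?F. (\<integral>x. Phi \<phi> (f x - moll (r n) \<Omega> f x) \<partial>M) < \<delta>"
    by (intro eventually_ball_finite ballI order_tendstoD(2)[OF conv \<delta>]) auto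
  then obtain n where n: "\<And>f. f \<in> ?F \<Longrightarrow> (\<integral>x. Phi \<phi> (f x - moll (r n) \<Omega> f x) \<partial>M) < \<delta>"
    by (auto simp: eventually_sequentially)
  let ?\<theta> = "moll (r n) \<Omega> g"
  \<comment> \<open>The closed neighbourhood of \<open>K\<close> of radius \<open>r n\<close>: it
    contains the support of the mollified function, and off it both sides of the derivative formula
    are 0.\<close>
  define K' where "K' = {x + y |x y. x \<in> K \<and> y \<in> cball 0 (r n)}"
  have K'c: "compact K'" unfolding K'_def by (rule compact_sums[OF K(1) compact_cball])
  have moll0: "moll (r n) \<Omega> f x = 0" if x: "x \<notin> K'" and f: "\<And>y. y \<notin> K \<Longrightarrow> f y = 0" for f x
  proof -
    have eq0: "f y * bump (r n) (x - y) = 0" for y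
    proof (cases "y \<in> K")
      case True
      have "x = y + (x - y)" by simp
      then have "x - y \<notin> cball 0 (r n)" using x True unfolding K'_def by blast
      then show ?thesis by (simp add: bump_eq_0[OF r(1)])
    qed (simp add: f)
    show ?thesis unfolding moll_def eq0 by simp
  qed
  have K'ball: "cball x (r n) \<subseteq> \<Omega>" "x \<in> \<Omega>" if x: "x \<in> K'" for x
  proof -
    obtain k y where ky': "x = k + y \<and> k \<in> K \<and> y \<in> cball 0 (r n)" using x unfolding K'_def by blast
    then have ky: "x = k + y" "k \<in> K" "norm y \<le> r n" by (simp_all add: mem_cball_0)
    show sub: "cball x (r n) \<subseteq> \<Omega>"
    proof
      fix z assume z: "z \<in> cball x (r n)"
      have "dist k x \<le> r n" using ky by (simp add: dist_norm)
      then have "dist k z < e" using dist_triangle[of k z x] z r(2)[of n] by simp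
      then have "z \<in> (\<Union>x\<in>K. ball x e)" using ky(2) by auto
      then show "z \<in> \<Omega>" using e(2) by blast
    qed
    show "x \<in> \<Omega>" using sub r(1)[of n] by auto
  qed
  have gi: "integrable M g" by (rule Orlicz_integrable[OF g(1)])
  have \<theta>: "?\<theta> \<in> test_functions \<Omega>"
    by (rule test_functionsI[OF Cinf_on_moll[OF r(1) gi] K'c]) (use K'ball(2) moll0 K(3) in auto)
  have d\<theta>: "pderiv_dir i ?\<theta> x = moll (r n) \<Omega> (\<lambda>y. H y \<bullet> i) x" if i: "i \<in> Basis" for i x
  proof (cases "x \<in> K'")
    case True
    show ?thesis by (rule moll_pderiv_dir[OF g(2) r(1) K'ball(1)[OF True] i])
  next
    case False
    have "moll (r n) \<Omega> g y = 0" if "y \<notin> K'" for y using moll0[OF that K(3)] .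
    then have "pderiv_dir i ?\<theta> x = 0"
      using compact_imp_closed[OF K'c] False by (rule pderiv_dir_zero_outside)
    moreover have "moll (r n) \<Omega> (\<lambda>y. H y \<bullet> i) x = 0" by (rule moll0[OF False]) (simp add: K(4))
    ultimately show ?thesis by simp
  qed
  show ?thesis
  proof (intro bexI[OF _ \<theta>] conjI ballI)
    show "(\<integral>x. Phi \<phi> (g x - ?\<theta> x) \<partial>M) \<le> \<delta>" using n[of g] by simp
    fix i :: 'a assume i: "i \<in> Basis"
    then have "(\<lambda>x. H x \<bullet> i) \<in> ?F" by auto
    from n[OF this] show "(\<integral>x. Phi \<phi> (H x \<bullet> i - pderiv_dir i ?\<theta> x) \<partial>M) \<le> \<delta>"
      by (simp add: d\<theta>[OF i])
  qed
qed

text \<open>\<open>w\<close> is the limit of \<open>min w (L * max \<psi> 0)\<close>, where the test functions \<open>\<psi>\<close> approximate \<open>v\<close>;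
  these minima have compact support.\<close>

lemma W10_dominated:
  assumes v: "v \<in> W10 \<phi> \<Omega>" and w: "w \<in> Orlicz \<phi> \<Omega>" "wgrad \<Omega> w Gw" "\<And>i. i \<in> Basis \<Longrightarrow> (\<lambda>x. Gw x \<bullet> i) \<in> Orlicz \<phi> \<Omega>"
    and L: "L > 0" and wv: "AE x in M. 0 \<le> w x \<and> w x \<le> L * v x"
  shows "w \<in> W10 \<phi> \<Omega>"
proof -
  have v1: "v \<in> W1 \<phi> \<Omega>" using v by (simp add: W10_def)
  note vD = W1D[OF v1]
  define Gv where "Gv = weak_grad \<Omega> v"
  have Gv: "wgrad \<Omega> v Gv" "\<And>i. i \<in> Basis \<Longrightarrow> (\<lambda>x. Gv x \<bullet> i) \<in> Orlicz \<phi> \<Omega>" using vD unfolding Gv_def by auto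
  have w1: "w \<in> W1 \<phi> \<Omega>" by (rule W1I[OF w])
  \<comment> \<open>The geometric rate makes the whole sequence of test functions converge to
    \<open>v\<close> almost everywhere.\<close>
  have "\<forall>n::nat. \<exists>\<psi>. \<psi> \<in> test_functions \<Omega> \<and> (\<integral>x. Phi \<phi> (v x - \<psi> x) \<partial>M) \<le> (1/2)^n \<and>
      (\<forall>i\<in>Basis. (\<integral>x. Phi \<phi> (Gv x \<bullet> i - pderiv_dir i \<psi> x) \<partial>M) \<le> (1/2)^n)"
    using W10_approx[OF v] unfolding Gv_def Bex_def by simp
  from choice[OF this] obtain \<psi> where \<psi>': "\<forall>n::nat. \<psi> n \<in> test_functions \<Omega> \<and> (\<integral>x. Phi \<phi> (v x - \<psi> n x) \<partial>M) \<le> (1/2)^n \<and>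
      (\<forall>i\<in>Basis. (\<integral>x. Phi \<phi> (Gv x \<bullet> i - pderiv_dir i (\<psi> n) x) \<partial>M) \<le> (1/2)^n)" by (rule exE)
  have \<psi>: "\<psi> n \<in> test_functions \<Omega>" "(\<integral>x. Phi \<phi> (v x - \<psi> n x) \<partial>M) \<le> (1/2)^n"
    "i \<in> Basis \<Longrightarrow> (\<integral>x. Phi \<phi> (Gv x \<bullet> i - pderiv_dir i (\<psi> n) x) \<partial>M) \<le> (1/2)^n" for n i
    using spec[OF \<psi>', of n] by simp_all
  have p0: "(\<lambda>n. (1/2)^n :: real) \<longlonglongrightarrow> 0" by (rule LIMSEQ_realpow_zero) auto
  have \<psi>O: "\<psi> n \<in> Orlicz \<phi> \<Omega>" "i \<in> Basis \<Longrightarrow> pderiv_dir i (\<psi> n) \<in> Orlicz \<phi> \<Omega>" for n i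
    by (rule test_function_Orlicz[OF \<psi>(1)], rule test_function_Orlicz[OF test_functions_pderiv_dir[OF \<psi>(1)]])
  have dO: "(\<lambda>x. v x - \<psi> n x) \<in> Orlicz \<phi> \<Omega>" for n by (rule Orlicz_diff[OF vD(1) \<psi>O(1)])
  have diO: "(\<lambda>x. Gv x \<bullet> i - pderiv_dir i (\<psi> n) x) \<in> Orlicz \<phi> \<Omega>" if "i \<in> Basis" for i n
    by (rule Orlicz_diff[OF Gv(2)[OF that] \<psi>O(2)[OF that]])
  have \<psi>lim: "AE x in M. (\<lambda>n. \<psi> n x) \<longlonglongrightarrow> v x"
  proof -
    have "AE x in M. (\<lambda>n. Phi \<phi> (v x - \<psi> n x)) \<longlonglongrightarrow> 0"
    proof (rule AE_tendsto_0_of_geometric_L1)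
      fix n
      have i: "integrable M (\<lambda>x. Phi \<phi> (v x - \<psi> n x))" using dO by (simp add: Orlicz_iff)
      show "(\<lambda>x. Phi \<phi> (v x - \<psi> n x)) \<in> borel_measurable M" using i by auto
      show "(\<integral>\<^sup>+x. ennreal \<bar>Phi \<phi> (v x - \<psi> n x)\<bar> \<partial>M) \<le> ennreal ((1/2)^n)"
        unfolding nn_integral_abs_eq_integral[OF i] using \<psi>(2)[of n] by (intro ennreal_leI) (simp add: Phi_nonneg)
    qed
    then show ?thesis
    proof eventually_elim
      case (elim x)
      from Phi_tendsto_0_imp[OF elim] have "(\<lambda>n. v x - (v x - \<psi> n x)) \<longlonglongrightarrow> v x - 0" by (intro tendsto_diff tendsto_const)
      then show ?case by simp
    qed
  qed
  define P where "P n x = max (\<psi> n x) 0" for n x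
  define DP where "DP n x = (if \<psi> n x > 0 then test_grad (\<psi> n) x else 0)" for n x
  have P: "wgrad \<Omega> (P n) (DP n)" for n
    unfolding P_def[abs_def] DP_def[abs_def]
    by (rule wgrad_max0[OF open_\<Omega> bounded_\<Omega> wgrad_test_function[OF open_\<Omega> bounded_\<Omega> \<psi>(1)]])
  define g where "g n x = min (w x) (L * P n x)" for n x
  define \<Gamma> where "\<Gamma> n x = (if w x > L * P n x then L *\<^sub>R DP n x else Gw x)" for n x
  have g\<Gamma>: "wgrad \<Omega> (g n) (\<Gamma> n)" for n
    unfolding g_def[abs_def] \<Gamma>_def[abs_def]
    by (rule wgrad_min[OF open_\<Omega> bounded_\<Omega> w(2) wgrad_scale[OF P]])
  have Pm: "P n \<in> borel_measurable M" for n
    using wgradD(1)[OF P] by auto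
  have wm: "w \<in> borel_measurable M" using w(1) by (simp add: Orlicz_iff)
  have set1: "{x \<in> space M. w x > L * P n x} \<in> sets M" for n
    using wm Pm[of n] by measurable
  have set2: "{x \<in> space M. \<psi> n x > 0} \<in> sets M" for n
    using test_functions_borel_measurable[OF \<psi>(1), of n \<Omega>] by measurable
  have If_Orlicz: "(\<lambda>x. if Q x then a x else b x) \<in> Orlicz \<phi> \<Omega>"
    if "{x \<in> space M. Q x} \<in> sets M" "a \<in> Orlicz \<phi> \<Omega>" "b \<in> Orlicz \<phi> \<Omega>" for Q a b
  proof (rule Orlicz_dominated[OF Orlicz_add(1)[OF Orlicz_abs[OF that(2)] Orlicz_abs[OF that(3)]]])
    show "(\<lambda>x. if Q x then a x else b x) \<in> borel_measurable M"
      using that by (intro measurable_If) (auto simp: Orlicz_iff)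
  qed auto
  have zeroO: "(\<lambda>x. 0) \<in> Orlicz \<phi> \<Omega>" by (rule bounded_Orlicz[of _ 0]) auto
  have PO: "P n \<in> Orlicz \<phi> \<Omega>" for n
    by (rule Orlicz_dominated[OF \<psi>O(1)[of n] Pm]) (auto simp: P_def)
  have gO: "g n \<in> Orlicz \<phi> \<Omega>" for n
  proof -
    have "(\<lambda>x. if w x > L * P n x then L * P n x else w x) \<in> Orlicz \<phi> \<Omega>"
      by (rule If_Orlicz[OF set1 Orlicz_scale[OF PO] w(1)])
    moreover have "(\<lambda>x. if w x > L * P n x then L * P n x else w x) = g n" by (auto simp: g_def)
    ultimately show ?thesis by simp
  qed
  have \<Gamma>eq: "\<Gamma> n x \<bullet> i = (if w x > L * P n x then (if \<psi> n x > 0 then L * pderiv_dir i (\<psi> n) x else 0) else Gw x \<bullet> i)"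
    if "i \<in> Basis" for n x i using that by (simp add: \<Gamma>_def DP_def)
  have \<Gamma>O: "(\<lambda>x. \<Gamma> n x \<bullet> i) \<in> Orlicz \<phi> \<Omega>" if i: "i \<in> Basis" for n i
    unfolding \<Gamma>eq[OF i]
    by (rule If_Orlicz[OF set1 If_Orlicz[OF set2 Orlicz_scale[OF \<psi>O(2)[OF i]] zeroO] w(3)[OF i]])
  have conv_g: "(\<lambda>n. \<integral>x. Phi \<phi> (w x - g n x) \<partial>M) \<longlonglongrightarrow> 0"
  proof (rule tendsto_sandwich[OF _ _ tendsto_const tendsto_mult_right_zero[OF p0, of "(max 1 \<bar>L\<bar>) powr m"]])
    have "(\<integral>x. Phi \<phi> (w x - g n x) \<partial>M) \<le> (max 1 \<bar>L\<bar>) powr m * (1/2)^n" for n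
    proof -
      have dm: "(\<lambda>x. v x - \<psi> n x) \<in> borel_measurable M" "integrable M (\<lambda>x. Phi \<phi> (v x - \<psi> n x))"
        using dO by (auto simp: Orlicz_iff)
      have "(\<integral>x. Phi \<phi> (w x - g n x) \<partial>M) \<le> (\<integral>x. Phi \<phi> (L * (v x - \<psi> n x)) \<partial>M)"
      proof (rule integral_mono_AE)
        show "integrable M (\<lambda>x. Phi \<phi> (w x - g n x))" using Orlicz_diff[OF w(1) gO] by (simp add: Orlicz_iff)
        show "integrable M (\<lambda>x. Phi \<phi> (L * (v x - \<psi> n x)))" by (rule integrable_Phi_scale(1)[OF dm])
        show "AE x in M. Phi \<phi> (w x - g n x) \<le> Phi \<phi> (L * (v x - \<psi> n x))"
          using wv
        proof eventually_elim
          case (elim x)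
          \<comment> \<open>Only the excess of \<open>w\<close> over \<open>L * P n\<close> counts;
            by \<open>w \<le> L * v\<close> and \<open>\<psi> n \<le> P n\<close> it is at most
            \<open>L * (v - \<psi> n)\<close>.\<close>
          have "L * \<psi> n x \<le> L * P n x" using L by (intro mult_left_mono) (auto simp: P_def)
          then have "\<bar>w x - g n x\<bar> \<le> \<bar>L * (v x - \<psi> n x)\<bar>"
            using elim by (auto simp: g_def min_def right_diff_distrib)
          then show ?case by (rule Phi_mono)
        qed
      qed
      also have "\<dots> \<le> (max 1 \<bar>L\<bar>) powr m * (\<integral>x. Phi \<phi> (v x - \<psi> n x) \<partial>M)" by (rule integrable_Phi_scale(2)[OF dm])
      also have "\<dots> \<le> (max 1 \<bar>L\<bar>) powr m * (1/2)^n" by (intro mult_left_mono \<psi>(2)) auto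
      finally show ?thesis .
    qed
    then show "\<forall>\<^sub>F n in sequentially. (\<integral>x. Phi \<phi> (w x - g n x) \<partial>M) \<le> (max 1 \<bar>L\<bar>) powr m * (1/2)^n"
      by (rule always_eventually[OF allI])
    show "\<forall>\<^sub>F n in sequentially. 0 \<le> (\<integral>x. Phi \<phi> (w x - g n x) \<partial>M)"
      by (intro always_eventually allI Bochner_Integration.integral_nonneg) (simp add: Phi_nonneg)
  qed
  have zero_v: "AE x in M. v x = 0 \<longrightarrow> Gv x = 0" by (rule wgrad_zero_set[OF open_\<Omega> bounded_\<Omega> Gv(1)])
  have zero_w: "AE x in M. w x = 0 \<longrightarrow> Gw x = 0" by (rule wgrad_zero_set[OF open_\<Omega> bounded_\<Omega> w(2)])
  have zero_wv: "AE x in M. L * v x - w x = 0 \<longrightarrow> L *\<^sub>R Gv x - Gw x = 0"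
    by (rule wgrad_zero_set[OF open_\<Omega> bounded_\<Omega> wgrad_diff[OF wgrad_scale[OF Gv(1)] w(2)]])
  have conv_\<Gamma>: "(\<lambda>n. \<integral>x. Phi \<phi> (Gw x \<bullet> i - \<Gamma> n x \<bullet> i) \<partial>M) \<longlonglongrightarrow> 0" if i: "i \<in> Basis" for i
  proof -
    \<comment> \<open>\<open>A\<close> is the error of replacing the gradient of \<open>v\<close> by
      that of \<open>\<psi> n\<close>, small at the geometric rate. \<open>R\<close> no longer
      contains a gradient of \<open>\<psi> n\<close>; it has a fixed majorant and is eventually 0 at
      almost every point.\<close>
    define A where "A n x = (if w x > L * P n x then (if \<psi> n x > 0 then L * (Gv x \<bullet> i - pderiv_dir i (\<psi> n) x) else 0) else 0)" for n x
    define R where "R n x = (if w x > L * P n x then Gw x \<bullet> i - (if \<psi> n x > 0 then L * (Gv x \<bullet> i) else 0) else 0)" for n x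
    have split: "Gw x \<bullet> i - \<Gamma> n x \<bullet> i = A n x + R n x" for n x
      unfolding \<Gamma>eq[OF i] A_def R_def by (simp add: right_diff_distrib)
    have AO: "A n \<in> Orlicz \<phi> \<Omega>" for n
      unfolding A_def[abs_def]
      by (rule If_Orlicz[OF set1 If_Orlicz[OF set2 Orlicz_scale[OF diO[OF i]] zeroO] zeroO])
    have RO: "R n \<in> Orlicz \<phi> \<Omega>" for n
      unfolding R_def[abs_def]
      by (rule If_Orlicz[OF set1 Orlicz_diff[OF w(3)[OF i] If_Orlicz[OF set2 Orlicz_scale[OF Gv(2)[OF i]] zeroO]] zeroO])
    let ?B = "\<lambda>x. \<bar>Gw x \<bullet> i\<bar> + \<bar>L * (Gv x \<bullet> i)\<bar>"
    have BO: "?B \<in> Orlicz \<phi> \<Omega>"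
      by (rule Orlicz_add(1)[OF Orlicz_abs[OF w(3)[OF i]] Orlicz_abs[OF Orlicz_scale[OF Gv(2)[OF i]]]])
    have "(\<lambda>n. \<integral>x. Phi \<phi> (R n x) \<partial>M) \<longlonglongrightarrow> (\<integral>x. 0 \<partial>M)"
    proof (rule integral_dominated_convergence[where w="\<lambda>x. Phi \<phi> (?B x)"])
      show "(\<lambda>x. Phi \<phi> (R n x)) \<in> borel_measurable M" for n
        using RO[of n] by (intro Phi_comp_measurable) (simp add: Orlicz_iff)
      show "integrable M (\<lambda>x. Phi \<phi> (?B x))" using BO by (simp add: Orlicz_iff)
      show "AE x in M. norm (Phi \<phi> (R n x)) \<le> Phi \<phi> (?B x)" for n
      proof (rule AE_I2)
        fix x
        have "\<bar>R n x\<bar> \<le> \<bar>?B x\<bar>" by (auto simp: R_def)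
        from Phi_mono[OF this] show "norm (Phi \<phi> (R n x)) \<le> Phi \<phi> (?B x)" by (simp add: Phi_nonneg)
      qed
      show "AE x in M. (\<lambda>n. Phi \<phi> (R n x)) \<longlonglongrightarrow> 0"
        using wv \<psi>lim zero_v zero_w zero_wv
      proof eventually_elim
        case (elim x)
        have "\<forall>\<^sub>F n in sequentially. R n x = 0"
        \<comment> \<open>Three sets: where \<open>v\<close> is 0 so is \<open>w\<close>, and both
          gradients vanish; where \<open>w = L * v > 0\<close> the gradients of \<open>w\<close> and
          \<open>L * v\<close> agree; where \<open>w < L * v\<close> the truncation is eventually
          inactive. The first two use that a gradient vanishes almost everywhere on the zero
          set.\<close>
        proof (cases "v x = 0")
          case True
          then have "w x = 0" "Gv x = 0" using elim L by auto
          then have "Gw x = 0" using elim by simp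
          then show ?thesis using \<open>Gv x = 0\<close> by (simp add: R_def)
        next
          case False
          have "0 \<le> L * v x" using elim by linarith
          then have vp: "v x > 0" using False L by (simp add: zero_le_mult_iff)
          have ev1: "\<forall>\<^sub>F n in sequentially. \<psi> n x > 0" by (rule order_tendstoD(1)[OF elim(2) vp])
          show ?thesis
          proof (cases "w x = L * v x")
            case True
            then have "L *\<^sub>R Gv x = Gw x" using elim by simp
            then have eq: "L * (Gv x \<bullet> i) = Gw x \<bullet> i" by (metis inner_scaleR_left)
            show ?thesis using ev1 by eventually_elim (simp add: R_def eq)
          next
            case neq: False
            then have "w x < L * v x" using elim by linarith
            then have "w x / L < v x" using L by (simp add: pos_divide_less_eq mult.commute)
            from order_tendstoD(1)[OF elim(2) this]
            show ?thesis
            proof eventually_elim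
              case (elim n)
              then have "w x < L * \<psi> n x" using L by (simp add: pos_divide_less_eq mult.commute)
              moreover have "L * \<psi> n x \<le> L * P n x" using L by (intro mult_left_mono) (auto simp: P_def)
              ultimately show ?case by (simp add: R_def)
            qed
          qed
        qed
        then have "\<forall>\<^sub>F n in sequentially. Phi \<phi> (R n x) = 0" by eventually_elim simp
        then show ?case by (rule tendsto_eventually)
      qed
    qed auto
    then have R0: "(\<lambda>n. \<integral>x. Phi \<phi> (R n x) \<partial>M) \<longlonglongrightarrow> 0" by simp
    have S0: "(\<lambda>n. 2 powr m * ((max 1 \<bar>L\<bar>) powr m * (1/2)^n + (\<integral>x. Phi \<phi> (R n x) \<partial>M))) \<longlonglongrightarrow> 0"
      by (rule tendsto_mult_right_zero[OF tendsto_add_zero[OF tendsto_mult_right_zero[OF p0] R0]])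
    show ?thesis
    proof (rule tendsto_sandwich[OF _ _ tendsto_const S0])
      have "(\<integral>x. Phi \<phi> (Gw x \<bullet> i - \<Gamma> n x \<bullet> i) \<partial>M) \<le> 2 powr m * ((max 1 \<bar>L\<bar>) powr m * (1/2)^n + (\<integral>x. Phi \<phi> (R n x) \<partial>M))" for n
      proof -
        have dm: "(\<lambda>x. Gv x \<bullet> i - pderiv_dir i (\<psi> n) x) \<in> borel_measurable M" "integrable M (\<lambda>x. Phi \<phi> (Gv x \<bullet> i - pderiv_dir i (\<psi> n) x))"
          using diO[OF i] by (auto simp: Orlicz_iff)
        have "(\<integral>x. Phi \<phi> (A n x) \<partial>M) \<le> (\<integral>x. Phi \<phi> (L * (Gv x \<bullet> i - pderiv_dir i (\<psi> n) x)) \<partial>M)"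
        proof (rule integral_mono)
          show "integrable M (\<lambda>x. Phi \<phi> (A n x))" using AO by (simp add: Orlicz_iff)
          show "integrable M (\<lambda>x. Phi \<phi> (L * (Gv x \<bullet> i - pderiv_dir i (\<psi> n) x)))" by (rule integrable_Phi_scale(1)[OF dm])
          fix x
          show "Phi \<phi> (A n x) \<le> Phi \<phi> (L * (Gv x \<bullet> i - pderiv_dir i (\<psi> n) x))"
            by (rule Phi_mono) (simp add: A_def)
        qed
        also have "\<dots> \<le> (max 1 \<bar>L\<bar>) powr m * (\<integral>x. Phi \<phi> (Gv x \<bullet> i - pderiv_dir i (\<psi> n) x) \<partial>M)"
          by (rule integrable_Phi_scale(2)[OF dm])
        also have "\<dots> \<le> (max 1 \<bar>L\<bar>) powr m * (1/2)^n" by (intro mult_left_mono \<psi>(3)[OF i]) auto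
        finally have Ale: "(\<integral>x. Phi \<phi> (A n x) \<partial>M) \<le> (max 1 \<bar>L\<bar>) powr m * (1/2)^n" .
        have "(\<integral>x. Phi \<phi> (Gw x \<bullet> i - \<Gamma> n x \<bullet> i) \<partial>M) \<le> 2 powr m * ((\<integral>x. Phi \<phi> (A n x) \<partial>M) + (\<integral>x. Phi \<phi> (R n x) \<partial>M))"
          unfolding split by (rule Orlicz_add(2)[OF AO RO])
        also have "\<dots> \<le> 2 powr m * ((max 1 \<bar>L\<bar>) powr m * (1/2)^n + (\<integral>x. Phi \<phi> (R n x) \<partial>M))"
          by (intro mult_left_mono add_right_mono Ale) auto
        finally show ?thesis .
      qed
      then show "\<forall>\<^sub>F n in sequentially. (\<integral>x. Phi \<phi> (Gw x \<bullet> i - \<Gamma> n x \<bullet> i) \<partial>M) \<le> 2 powr m * ((max 1 \<bar>L\<bar>) powr m * (1/2)^n + (\<integral>x. Phi \<phi> (R n x) \<partial>M))"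
        by (rule always_eventually[OF allI])
      show "\<forall>\<^sub>F n in sequentially. 0 \<le> (\<integral>x. Phi \<phi> (Gw x \<bullet> i - \<Gamma> n x \<bullet> i) \<partial>M)"
        by (intro always_eventually allI Bochner_Integration.integral_nonneg) (simp add: Phi_nonneg)
    qed
  qed
  have wG: "AE x in M. Gw x = weak_grad \<Omega> w x"
    using weak_grad_eq[OF open_\<Omega> w(2)] by eventually_elim simp
  show ?thesis
  proof (rule W10I[OF w1])
    fix \<delta> :: real assume "\<delta> > 0"
    \<comment> \<open>Two errors are added by \<open>Phi_add\<close>, which multiplies their sum by
      \<open>2 powr m\<close>.\<close>
    define \<delta>' where "\<delta>' = \<delta> / (2 * 2 powr m)"
    have \<delta>': "\<delta>' > 0" using \<open>\<delta> > 0\<close> by (simp add: \<delta>'_def)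
    have \<delta>'2: "2 powr m * (\<delta>' + \<delta>') = \<delta>" by (simp add: \<delta>'_def field_simps)
    have "\<forall>\<^sub>F n in sequentially. (\<integral>x. Phi \<phi> (w x - g n x) \<partial>M) < \<delta>' \<and> (\<forall>i\<in>Basis. (\<integral>x. Phi \<phi> (Gw x \<bullet> i - \<Gamma> n x \<bullet> i) \<partial>M) < \<delta>')"
      by (intro eventually_conj eventually_ball_finite ballI order_tendstoD(2)[OF conv_g \<delta>'] order_tendstoD(2)[OF conv_\<Gamma> \<delta>']) auto
    then obtain n where n: "(\<integral>x. Phi \<phi> (w x - g n x) \<partial>M) < \<delta>'" "\<And>i. i \<in> Basis \<Longrightarrow> (\<integral>x. Phi \<phi> (Gw x \<bullet> i - \<Gamma> n x \<bullet> i) \<partial>M) < \<delta>'"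
      by (auto simp: eventually_sequentially)
    obtain K where K: "compact K" "K \<subseteq> \<Omega>" "\<And>x. x \<notin> K \<Longrightarrow> \<psi> n x = 0"
      using test_functions_support[OF \<psi>(1)] by blast
    \<comment> \<open>Off \<open>K\<close> the truncated function and its gradient vanish only
      almost everywhere, as the sign of \<open>w\<close> and the vanishing of \<open>Gw\<close> on
      its zero set are known only so. A change on a null set meets the pointwise hypotheses of
      \<open>compact_support_approx\<close>.\<close>
    define g' where "g' x = (if x \<in> K then g n x else 0)" for x
    define \<Gamma>' where "\<Gamma>' x = (if x \<in> K then \<Gamma> n x else 0)" for x
    have setK: "{x \<in> space M. x \<in> K} \<in> sets M"
    proof -
      have "K \<in> sets lebesgue" using K(1) by (simp add: lmeasurable_compact fmeasurableD)
      moreover have "{x \<in> space M. x \<in> K} = K \<inter> \<Omega>" by auto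
      ultimately show ?thesis using sets_\<Omega> by (auto simp: sets_restrict_space)
    qed
    have aeg: "AE x in M. g n x = g' x" and ae\<Gamma>: "AE x in M. \<Gamma> n x = \<Gamma>' x"
    proof -
      show "AE x in M. g n x = g' x" using wv
        by eventually_elim (auto simp: g'_def g_def P_def K(3))
      show "AE x in M. \<Gamma> n x = \<Gamma>' x" using wv zero_w
        by eventually_elim (auto simp: \<Gamma>'_def \<Gamma>_def P_def DP_def K(3))
    qed
    have g'O: "g' \<in> Orlicz \<phi> \<Omega>" unfolding g'_def[abs_def] by (rule If_Orlicz[OF setK gO zeroO])
    have \<Gamma>'i: "\<Gamma>' x \<bullet> i = (if x \<in> K then \<Gamma> n x \<bullet> i else 0)" for x i by (simp add: \<Gamma>'_def)
    have \<Gamma>'O: "(\<lambda>x. \<Gamma>' x \<bullet> i) \<in> Orlicz \<phi> \<Omega>" if "i \<in> Basis" for i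
      unfolding \<Gamma>'i by (rule If_Orlicz[OF setK \<Gamma>O[OF that] zeroO])
    have g'w: "wgrad \<Omega> g' \<Gamma>'"
      by (rule wgrad_cong_AE[OF g\<Gamma> aeg ae\<Gamma>]) (use g'O \<Gamma>'O in \<open>auto simp: Orlicz_iff\<close>)
    obtain \<theta> where \<theta>: "\<theta> \<in> test_functions \<Omega>" "(\<integral>x. Phi \<phi> (g' x - \<theta> x) \<partial>M) \<le> \<delta>'"
      "\<And>i. i \<in> Basis \<Longrightarrow> (\<integral>x. Phi \<phi> (\<Gamma>' x \<bullet> i - pderiv_dir i \<theta> x) \<partial>M) \<le> \<delta>'"
      using compact_support_approx[OF g'O g'w \<Gamma>'O K(1,2) _ _ \<delta>'] by (auto simp: g'_def \<Gamma>'_def)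
    have comb: "(\<integral>x. Phi \<phi> (a x - c x) \<partial>M) \<le> \<delta>"
      if O: "a \<in> Orlicz \<phi> \<Omega>" "b \<in> Orlicz \<phi> \<Omega>" "b' \<in> Orlicz \<phi> \<Omega>" "c \<in> Orlicz \<phi> \<Omega>" and eq: "AE x in M. b x = b' x"
        and le: "(\<integral>x. Phi \<phi> (a x - b x) \<partial>M) \<le> \<delta>'" "(\<integral>x. Phi \<phi> (b' x - c x) \<partial>M) \<le> \<delta>'" for a b b' c
    proof -
      have eqbc: "(\<integral>x. Phi \<phi> (b x - c x) \<partial>M) = (\<integral>x. Phi \<phi> (b' x - c x) \<partial>M)"
      proof (rule integral_cong_AE)
        show "(\<lambda>x. Phi \<phi> (b x - c x)) \<in> borel_measurable M" "(\<lambda>x. Phi \<phi> (b' x - c x)) \<in> borel_measurable M"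
          using Orlicz_diff[OF O(2,4)] Orlicz_diff[OF O(3,4)] by (auto simp: Orlicz_iff)
        show "AE x in M. Phi \<phi> (b x - c x) = Phi \<phi> (b' x - c x)" using eq by eventually_elim simp
      qed
      have "(\<integral>x. Phi \<phi> (a x - c x) \<partial>M) = (\<integral>x. Phi \<phi> ((a x - b x) + (b x - c x)) \<partial>M)" by simp
      also have "\<dots> \<le> 2 powr m * ((\<integral>x. Phi \<phi> (a x - b x) \<partial>M) + (\<integral>x. Phi \<phi> (b x - c x) \<partial>M))"
        by (rule Orlicz_add(2)[OF Orlicz_diff[OF O(1,2)] Orlicz_diff[OF O(2,4)]])
      also have "\<dots> \<le> 2 powr m * (\<delta>' + \<delta>')"
        unfolding eqbc using le by (intro mult_left_mono add_mono) auto
      finally show ?thesis unfolding \<delta>'2 .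
    qed
    show "\<exists>\<psi>\<in>test_functions \<Omega>. (\<integral>x. Phi \<phi> (w x - \<psi> x) \<partial>M) \<le> \<delta> \<and>
      (\<forall>i\<in>Basis. (\<integral>x. Phi \<phi> (weak_grad \<Omega> w x \<bullet> i - pderiv_dir i \<psi> x) \<partial>M) \<le> \<delta>)"
    proof (intro bexI[OF _ \<theta>(1)] conjI ballI)
      show "(\<integral>x. Phi \<phi> (w x - \<theta> x) \<partial>M) \<le> \<delta>"
        by (rule comb[OF w(1) gO g'O test_function_Orlicz[OF \<theta>(1)] aeg less_imp_le[OF n(1)] \<theta>(2)])
      fix i :: 'a assume i: "i \<in> Basis"
      have cO: "pderiv_dir i \<theta> \<in> Orlicz \<phi> \<Omega>" by (rule test_function_Orlicz[OF test_functions_pderiv_dir[OF \<theta>(1) i]])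
      have aei: "AE x in M. \<Gamma> n x \<bullet> i = \<Gamma>' x \<bullet> i" using ae\<Gamma> by eventually_elim simp
      have "(\<integral>x. Phi \<phi> (Gw x \<bullet> i - pderiv_dir i \<theta> x) \<partial>M) \<le> \<delta>"
        by (rule comb[OF w(3)[OF i] \<Gamma>O[OF i] \<Gamma>'O[OF i] cO aei less_imp_le[OF n(2)[OF i]] \<theta>(3)[OF i]])
      also have "(\<integral>x. Phi \<phi> (Gw x \<bullet> i - pderiv_dir i \<theta> x) \<partial>M) = (\<integral>x. Phi \<phi> (weak_grad \<Omega> w x \<bullet> i - pderiv_dir i \<theta> x) \<partial>M)"
      proof (rule integral_cong_AE)
        show "(\<lambda>x. Phi \<phi> (Gw x \<bullet> i - pderiv_dir i \<theta> x)) \<in> borel_measurable M"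
          using Orlicz_diff[OF w(3)[OF i] cO] by (auto simp: Orlicz_iff)
        show "(\<lambda>x. Phi \<phi> (weak_grad \<Omega> w x \<bullet> i - pderiv_dir i \<theta> x)) \<in> borel_measurable M"
          using Orlicz_diff[OF W1D(3)[OF w1 i] cO] by (auto simp: Orlicz_iff)
        show "AE x in M. Phi \<phi> (Gw x \<bullet> i - pderiv_dir i \<theta> x) = Phi \<phi> (weak_grad \<Omega> w x \<bullet> i - pderiv_dir i \<theta> x)"
          using wG by eventually_elim simp
      qed
      finally show "(\<integral>x. Phi \<phi> (weak_grad \<Omega> w x \<bullet> i - pderiv_dir i \<theta> x) \<partial>M) \<le> \<delta>" .
    qed
  qed
qed

end

section \<open>Test functions of two solutions\<close>

lemma wgrad_const:
  fixes \<Omega> :: "'a::euclidean_space set"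
  assumes \<Omega>: "open \<Omega>" "bounded \<Omega>"
  shows "wgrad \<Omega> (\<lambda>_. c) (\<lambda>_. 0)"
  unfolding wgrad_def
proof (intro conjI ballI)
  interpret finite_measure "lebesgue_on \<Omega>" using \<Omega> by (rule finite_measure_lebesgue_on_bounded_open)
  show "integrable (lebesgue_on \<Omega>) (\<lambda>_. c)" by simp
  fix i :: 'a assume i: "i \<in> Basis"
  show "integrable (lebesgue_on \<Omega>) (\<lambda>_. 0 \<bullet> i)" by simp
  fix \<psi> assume \<psi>: "\<psi> \<in> test_functions \<Omega>"
  obtain K where K: "compact K" "K \<subseteq> \<Omega>" "\<And>x. x \<notin> K \<Longrightarrow> \<psi> x = 0"
    using test_functions_support[OF \<psi>] by blast
  have "(\<integral>x. c * pderiv_dir i \<psi> x \<partial>lebesgue_on \<Omega>) = - (\<integral>x. pderiv_dir i (\<lambda>_. c) x * \<psi> x \<partial>lebesgue_on \<Omega>)"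
    by (rule test_function_integration_by_parts[OF _ \<psi> i K open_UNIV])
      (use \<Omega>(1) in \<open>auto simp: pderiv_dir_const\<close>)
  then show "(\<integral>x. c * pderiv_dir i \<psi> x \<partial>lebesgue_on \<Omega>) = - (\<integral>x. (0 \<bullet> i) * \<psi> x \<partial>lebesgue_on \<Omega>)"
    by (simp add: pderiv_dir_const)
qed

text \<open>Young's inequality for \<open>c powr (l - 1)\<close> and \<open>d\<close> with the
  conjugate exponents \<open>l / (l - 1)\<close> and \<open>l\<close>, multiplied by
  \<open>l\<close>.\<close>

lemma Youngs_inequality_powr:
  fixes c d l :: real
  assumes "l > 1" "c > 0" "d \<ge> 0"
  shows "l * c powr (l - 1) * d \<le> (l - 1) * c powr l + d powr l"
proof -
  have "c powr (l - 1) * d \<le> (c powr (l - 1)) powr (l / (l - 1)) / (l / (l - 1)) + d powr l / l"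
    using assms by (intro Youngs_inequality) (auto simp: field_simps)
  also have "(c powr (l - 1)) powr (l / (l - 1)) = c powr l"
    using assms by (simp add: powr_powr)
  finally have "l * (c powr (l - 1) * d) \<le> l * (c powr l / (l / (l - 1)) + d powr l / l)"
    using assms by (intro mult_left_mono) auto
  also have "\<dots> = (l - 1) * c powr l + d powr l" using assms by (simp add: field_simps)
  finally show ?thesis by (simp add: mult.assoc)
qed

text \<open>A cone without its vertex: invariant under scaling, so a function homogeneous of degree
  0 is bounded on it as soon as it is bounded in the quotient of the coordinates, which ranges over
  \<open>[1, K]\<close>.\<close>

definition ratio_cone :: "real \<Rightarrow> (real \<times> real) set" where
  "ratio_cone K = {q. 0 < snd q \<and> snd q \<le> fst q \<and> fst q \<le> K * snd q}"

text \<open>Captures what both test functions have in common, as functions of the larger and the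
  smaller argument: regular in the open quadrant, derivatives bounded on the cone, zero on the
  diagonal.\<close>

locale ratio_function =
  fixes h ha hb :: "real \<times> real \<Rightarrow> real" and K L :: real
  assumes h_deriv: "\<And>q. 0 < fst q \<Longrightarrow> 0 < snd q \<Longrightarrow> (h has_derivative (\<lambda>z. ha q * fst z + hb q * snd z)) (at q)"
    and h_cont: "\<And>q. 0 < fst q \<Longrightarrow> 0 < snd q \<Longrightarrow> isCont ha q" "\<And>q. 0 < fst q \<Longrightarrow> 0 < snd q \<Longrightarrow> isCont hb q"
    and h_meas: "h \<in> borel_measurable borel" "ha \<in> borel_measurable borel" "hb \<in> borel_measurable borel"
    and h_bound: "\<And>q. q \<in> ratio_cone K \<Longrightarrow> \<bar>ha q\<bar> \<le> L" "\<And>q. q \<in> ratio_cone K \<Longrightarrow> \<bar>hb q\<bar> \<le> L"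
    and h_diag: "\<And>b. 0 < b \<Longrightarrow> h (b, b) = 0"
    and h_nonneg: "\<And>q. q \<in> ratio_cone K \<Longrightarrow> 0 \<le> h q"
    and K1: "1 \<le> K"
begin

text \<open>The cone truncated at height \<open>\<delta>\<close>. Unlike the cone without its vertex
  it is closed, and being convex it is an admissible set for \<open>wgrad_chain\<close>.\<close>

definition cut :: "real \<Rightarrow> (real \<times> real) set" where
  "cut \<delta> = {q. \<delta> \<le> snd q \<and> snd q \<le> fst q \<and> fst q \<le> K * snd q}"

lemma cut_closed: "closed (cut \<delta>)"
  unfolding cut_def by (intro closed_Collect_conj closed_Collect_le continuous_intros)

lemma cut_convex: "convex (cut \<delta>)"
proof (rule convexI)
  fix x y :: "real \<times> real" and s t :: real
  assume xy: "x \<in> cut \<delta>" "y \<in> cut \<delta>" and st: "0 \<le> s" "0 \<le> t" "s + t = 1"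
  have "s * \<delta> + t * \<delta> \<le> s * snd x + t * snd y" "s * snd x + t * snd y \<le> s * fst x + t * fst y"
    "s * fst x + t * fst y \<le> s * (K * snd x) + t * (K * snd y)"
    using xy st by (auto simp: cut_def intro!: add_mono mult_left_mono)
  moreover have "s * \<delta> + t * \<delta> = \<delta>" using st(3) by (simp add: distrib_right[symmetric])
  ultimately show "s *\<^sub>R x + t *\<^sub>R y \<in> cut \<delta>" by (simp add: cut_def algebra_simps)
qed

lemma cut_subset: "0 < \<delta> \<Longrightarrow> q \<in> cut \<delta> \<Longrightarrow> q \<in> ratio_cone K \<and> 0 < fst q \<and> 0 < snd q"
  by (auto simp: cut_def ratio_cone_def)

lemma L_nonneg: "0 \<le> L"
  using h_bound(1)[of "(1,1)"] K1 by (auto simp: ratio_cone_def)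

text \<open>\<open>h\<close> vanishes on the diagonal, so its value is compared with that at the
  diagonal point of the same height; both points lie in one convex cut. This supplies the bound by
  the positive part of \<open>u1 - u2\<close> that \<open>W10_dominated\<close> asks for.\<close>

lemma h_le: "q \<in> ratio_cone K \<Longrightarrow> h q \<le> 2 * L * (fst q - snd q)"
proof -
  assume q: "q \<in> ratio_cone K"
  let ?b = "snd q"
  have b: "0 < ?b" "?b \<le> fst q" using q by (auto simp: ratio_cone_def)
  have in1: "q \<in> cut ?b" using q by (auto simp: cut_def ratio_cone_def)
  have in2: "(?b, ?b) \<in> cut ?b" using K1 b by (auto simp: cut_def)
  have "\<bar>h q - h (?b, ?b)\<bar> \<le> 2 * L * (\<bar>fst q - fst (?b, ?b)\<bar> + \<bar>snd q - snd (?b, ?b)\<bar>)"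
  proof (rule convex_Lipschitz_of_gradient_bound[OF cut_convex, of ?b h ha hb L])
    fix z assume "z \<in> cut ?b"
    from cut_subset[OF b(1) this] show "(h has_derivative (\<lambda>w. ha z * fst w + hb z * snd w)) (at z)"
      "\<bar>ha z\<bar> \<le> L" "\<bar>hb z\<bar> \<le> L"
      using h_deriv h_bound by auto
  qed (use in1 in2 in auto)
  then show ?thesis using h_diag[OF b(1)] b by simp
qed

text \<open>Functions such as \<open>a - b powr l * a powr (1 - l)\<close> are not differentiable at the origin; shifting both
  arguments by \<open>e n\<close> keeps away from it.\<close>

lemma wgrad_ratio:
  assumes \<Omega>: "open \<Omega>" "bounded \<Omega>" and u: "wgrad \<Omega> u G" and v: "wgrad \<Omega> v H"
    and uv: "AE x in lebesgue_on \<Omega>. (u x, v x) \<in> ratio_cone K"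
  shows "wgrad \<Omega> (\<lambda>x. h (u x, v x)) (\<lambda>x. ha (u x, v x) *\<^sub>R G x + hb (u x, v x) *\<^sub>R H x)"
proof -
  let ?M = "lebesgue_on \<Omega>"
  interpret finite_measure ?M using \<Omega> by (rule finite_measure_lebesgue_on_bounded_open)
  define e where "e n = inverse (real (Suc n))" for n
  have e: "0 < e n" "e n \<le> 1" for n by (auto simp: e_def field_simps)
  have e0: "e \<longlonglongrightarrow> 0" unfolding e_def by (rule LIMSEQ_inverse_real_of_nat)
  have sh: "wgrad \<Omega> (\<lambda>x. a x + e n) D" if "wgrad \<Omega> a D" for a D n
    using wgrad_lincomb[OF that wgrad_const[OF \<Omega>, of "e n"], of 1 1] by simp
  have cutI: "(a + e n, b + e n) \<in> cut (e n)" if "(a, b) \<in> ratio_cone K" for a b n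
  proof -
    have "e n \<le> K * e n" using e(1)[of n] K1 by simp
    then show ?thesis using that by (auto simp: cut_def ratio_cone_def distrib_left)
  qed
  have w: "wgrad \<Omega> (\<lambda>x. h (u x + e n, v x + e n)) (\<lambda>x. ha (u x + e n, v x + e n) *\<^sub>R G x + hb (u x + e n, v x + e n) *\<^sub>R H x)" for n
  proof (rule wgrad_chain[OF \<Omega> sh[OF u] sh[OF v] cut_closed[of "e n"] cut_convex[of "e n"],
      where h=h and ha=ha and hb=hb and L=L and ?p0.0="(e n, e n)"])
    show "AE x in ?M. (u x + e n, v x + e n) \<in> cut (e n)" using uv by eventually_elim (rule cutI)
    show "(e n, e n) \<in> cut (e n)" using K1 e(1)[of n] by (simp add: cut_def)
    show "continuous_on (cut (e n)) ha" "continuous_on (cut (e n)) hb"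
      by (rule continuous_at_imp_continuous_on, rule ballI, rule h_cont; use cut_subset[OF e(1)] in blast)+
    fix q assume "q \<in> cut (e n)"
    from cut_subset[OF e(1) this] show "(h has_derivative (\<lambda>w. ha q * fst w + hb q * snd w)) (at q)"
      "\<bar>ha q\<bar> \<le> L" "\<bar>hb q\<bar> \<le> L"
      using h_deriv h_bound by auto
  qed (rule h_meas)+
  have um: "u \<in> borel_measurable ?M" and vm: "v \<in> borel_measurable ?M" using wgradD(1) u v by auto
  have comp_m: "(\<lambda>x. k (u x, v x)) \<in> borel_measurable ?M" if "k \<in> borel_measurable borel" for k :: "real \<times> real \<Rightarrow> real"
    using measurable_compose[OF borel_measurable_Pair[OF um vm] that] by simp
  have coneI: "(u x + e n, v x + e n) \<in> ratio_cone K" if "(u x, v x) \<in> ratio_cone K" for x n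
    using cut_subset[OF e(1) cutI[OF that]] by blast
  have lims: "(\<lambda>n. k (u x + e n, v x + e n)) \<longlonglongrightarrow> k (u x, v x)"
    if "isCont k (u x, v x)" for k :: "real \<times> real \<Rightarrow> real" and x
  proof (rule isCont_tendsto_compose[OF that])
    have "(\<lambda>n. (u x + e n, v x + e n)) \<longlonglongrightarrow> (u x + 0, v x + 0)"
      by (intro tendsto_intros e0)
    then show "(\<lambda>n. (u x + e n, v x + e n)) \<longlonglongrightarrow> (u x, v x)" by simp
  qed
  have pos: "0 < u x" "0 < v x" if "(u x, v x) \<in> ratio_cone K" for x
    using that by (auto simp: ratio_cone_def)
  let ?w' = "\<lambda>x. L * ((\<Sum>i\<in>Basis. \<bar>G x \<bullet> i\<bar>) + (\<Sum>i\<in>Basis. \<bar>H x \<bullet> i\<bar>))"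
  show ?thesis
  proof (rule wgrad_dominated_limit[OF w, where w="\<lambda>x. 2 * L * (\<bar>u x\<bar> + \<bar>v x\<bar>)" and w'="?w'"])
    show "AE x in ?M. (\<lambda>n. h (u x + e n, v x + e n)) \<longlonglongrightarrow> h (u x, v x)"
      using uv
    proof eventually_elim
      case (elim x)
      have "isCont h (u x, v x)"
        using h_deriv[of "(u x, v x)"] pos[OF elim] has_derivative_continuous by auto
      then show ?case by (rule lims)
    qed
    show "AE x in ?M. (\<lambda>n. ha (u x + e n, v x + e n) *\<^sub>R G x + hb (u x + e n, v x + e n) *\<^sub>R H x) \<longlonglongrightarrow>
        ha (u x, v x) *\<^sub>R G x + hb (u x, v x) *\<^sub>R H x"
      using uv
    proof eventually_elim
      case (elim x)
      have "isCont ha (u x, v x)" "isCont hb (u x, v x)" using h_cont pos[OF elim] by auto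
      from this[THEN lims] show ?case by (intro tendsto_add tendsto_scaleR tendsto_const)
    qed
    show "AE x in ?M. \<bar>h (u x + e n, v x + e n)\<bar> \<le> 2 * L * (\<bar>u x\<bar> + \<bar>v x\<bar>)" for n
      using uv
    proof eventually_elim
      case (elim x)
      have "h (u x + e n, v x + e n) \<le> 2 * L * (u x - v x)" using h_le[OF coneI[OF elim, of n]] by simp
      moreover have "2 * L * (u x - v x) \<le> 2 * L * (\<bar>u x\<bar> + \<bar>v x\<bar>)" using L_nonneg by (intro mult_left_mono) auto
      ultimately show ?case using h_nonneg[OF coneI[OF elim, of n]] by simp
    qed
    show "AE x in ?M. norm (ha (u x + e n, v x + e n) *\<^sub>R G x + hb (u x + e n, v x + e n) *\<^sub>R H x) \<le> ?w' x" for n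
      using uv
    proof eventually_elim
      case (elim x)
      note c = coneI[OF elim, of n]
      have "norm (ha (u x + e n, v x + e n) *\<^sub>R G x) \<le> L * (\<Sum>i\<in>Basis. \<bar>G x \<bullet> i\<bar>)"
        unfolding norm_scaleR using h_bound(1)[OF c] L_nonneg norm_le_l1[of "G x"] by (intro mult_mono) auto
      moreover have "norm (hb (u x + e n, v x + e n) *\<^sub>R H x) \<le> L * (\<Sum>i\<in>Basis. \<bar>H x \<bullet> i\<bar>)"
        unfolding norm_scaleR using h_bound(2)[OF c] L_nonneg norm_le_l1[of "H x"] by (intro mult_mono) auto
      ultimately show ?case using norm_triangle_ineq[of "ha (u x + e n, v x + e n) *\<^sub>R G x" "hb (u x + e n, v x + e n) *\<^sub>R H x"]
        unfolding distrib_left by linarith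
    qed
    show "(\<lambda>x. h (u x, v x)) \<in> borel_measurable ?M" by (rule comp_m[OF h_meas(1)])
    show "integrable ?M (\<lambda>x. 2 * L * (\<bar>u x\<bar> + \<bar>v x\<bar>))" using wgradD(1)[OF u] wgradD(1)[OF v] by auto
    show "integrable ?M ?w'" using wgrad_l1_integrable[OF u] wgrad_l1_integrable[OF v] by auto
    fix i :: 'a assume i: "i \<in> Basis"
    have "(\<lambda>x. ha (u x, v x) * (G x \<bullet> i) + hb (u x, v x) * (H x \<bullet> i)) \<in> borel_measurable ?M"
      by (intro borel_measurable_add borel_measurable_times comp_m h_meas borel_measurable_integrable wgradD(2)[OF u i] wgradD(2)[OF v i])
    then show "(\<lambda>x. (ha (u x, v x) *\<^sub>R G x + hb (u x, v x) *\<^sub>R H x) \<bullet> i) \<in> borel_measurable ?M"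
      by (simp add: inner_add_left)
  qed
qed

end

context young_domain
begin

text \<open>With \<open>min (u1 x) (u2 x)\<close> as second argument the pair always lies in the
  cone, and the difference of its coordinates is the positive part of \<open>u1 - u2\<close>, which
  has zero boundary values by hypothesis.\<close>

lemma ratio_test_function:
  assumes h: "ratio_function h ha hb K L" and u1: "u1 \<in> W1 \<phi> \<Omega>" and u2: "u2 \<in> W1 \<phi> \<Omega>"
    and pos: "AE x in M. 0 < u1 x" "AE x in M. 0 < u2 x" and K: "AE x in M. u1 x \<le> K * u2 x"
    and bd: "(\<lambda>x. max (u1 x - u2 x) 0) \<in> W10 \<phi> \<Omega>"
  defines "w \<equiv> \<lambda>x. h (u1 x, min (u1 x) (u2 x))"
  shows "w \<in> W10 \<phi> \<Omega>" "AE x in M. 0 \<le> w x"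
    "AE x in M. weak_grad \<Omega> w x = ha (u1 x, min (u1 x) (u2 x)) *\<^sub>R weak_grad \<Omega> u1 x
       + hb (u1 x, min (u1 x) (u2 x)) *\<^sub>R (if u1 x > u2 x then weak_grad \<Omega> u2 x else weak_grad \<Omega> u1 x)"
proof -
  interpret ratio_function h ha hb K L by (rule h)
  note D1 = W1D[OF u1] and D2 = W1D[OF u2]
  define v where "v x = min (u1 x) (u2 x)" for x
  define G where "G = weak_grad \<Omega> u1"
  define H where "H x = (if u1 x > u2 x then weak_grad \<Omega> u2 x else weak_grad \<Omega> u1 x)" for x
  have G: "wgrad \<Omega> u1 G" using D1(2) by (simp add: G_def)
  have H: "wgrad \<Omega> v H" unfolding v_def[abs_def] H_def[abs_def]
    by (rule wgrad_min[OF open_\<Omega> bounded_\<Omega> D1(2) D2(2)])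
  have cone: "AE x in M. (u1 x, v x) \<in> ratio_cone K"
    using pos K
  proof eventually_elim
    case (elim x)
    \<comment> \<open>Covers the points where the minimum is \<open>u1 x\<close> itself; there
      \<open>1 \<le> K\<close> is needed.\<close>
    have "u1 x \<le> K * u1 x" using K1 elim by simp
    then show ?case using elim by (simp add: ratio_cone_def v_def min_def)
  qed
  define Gw where "Gw x = ha (u1 x, v x) *\<^sub>R G x + hb (u1 x, v x) *\<^sub>R H x" for x
  have w_eq: "w = (\<lambda>x. h (u1 x, v x))" by (simp add: w_def v_def)
  have wG: "wgrad \<Omega> w Gw" unfolding w_eq Gw_def[abs_def] by (rule wgrad_ratio[OF open_\<Omega> bounded_\<Omega> G H cone])
  have w_le: "AE x in M. 0 \<le> w x \<and> w x \<le> 2 * L * max (u1 x - u2 x) 0"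
    using cone
  proof eventually_elim
    case (elim x)
    have "u1 x - v x = max (u1 x - u2 x) 0" by (simp add: v_def min_def max_def)
    then show ?case using h_nonneg[OF elim] h_le[OF elim] by (simp add: w_eq)
  qed
  then show "AE x in M. 0 \<le> w x" by eventually_elim simp
  have wm: "w \<in> borel_measurable M" using wgradD(1)[OF wG] by (rule borel_measurable_integrable)
  have "AE x in M. \<bar>w x\<bar> \<le> \<bar>2 * L * u1 x\<bar>"
    using w_le pos
  proof eventually_elim
    case (elim x)
    have "2 * L * max (u1 x - u2 x) 0 \<le> 2 * L * u1 x" using elim L_nonneg by (intro mult_left_mono) auto
    then show ?case using elim by linarith
  qed
  then have wO: "w \<in> Orlicz \<phi> \<Omega>" by (rule Orlicz_dominated[OF Orlicz_scale[OF D1(1)] wm])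
  have Gwi: "(\<lambda>x. Gw x \<bullet> i) \<in> Orlicz \<phi> \<Omega>" if i: "i \<in> Basis" for i
  proof (rule Orlicz_dominated)
    let ?B = "\<lambda>x. \<bar>weak_grad \<Omega> u1 x \<bullet> i\<bar> + \<bar>weak_grad \<Omega> u2 x \<bullet> i\<bar>"
    show "(\<lambda>x. (2 * L) * ?B x) \<in> Orlicz \<phi> \<Omega>"
      by (rule Orlicz_scale[OF Orlicz_add(1)[OF Orlicz_abs[OF D1(3)[OF i]] Orlicz_abs[OF D2(3)[OF i]]]])
    show "(\<lambda>x. Gw x \<bullet> i) \<in> borel_measurable M" using wgradD(2)[OF wG i] by (rule borel_measurable_integrable)
    show "AE x in M. \<bar>Gw x \<bullet> i\<bar> \<le> \<bar>(2 * L) * ?B x\<bar>"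
      using cone
    proof eventually_elim
      case (elim x)
      have "\<bar>ha (u1 x, v x) * (G x \<bullet> i)\<bar> \<le> L * ?B x"
        unfolding abs_mult using h_bound(1)[OF elim] L_nonneg by (intro mult_mono) (auto simp: G_def)
      moreover have "\<bar>hb (u1 x, v x) * (H x \<bullet> i)\<bar> \<le> L * ?B x"
        unfolding abs_mult using h_bound(2)[OF elim] L_nonneg by (intro mult_mono) (auto simp: H_def)
      moreover have "Gw x \<bullet> i = ha (u1 x, v x) * (G x \<bullet> i) + hb (u1 x, v x) * (H x \<bullet> i)"
        by (simp add: Gw_def inner_add_left)
      ultimately have "\<bar>Gw x \<bullet> i\<bar> \<le> 2 * (L * ?B x)" by linarith
      then show ?case by (simp only: mult.assoc)
    qed
  qed
  \<comment> \<open>The summand 1 makes the factor strictly positive, as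
    \<open>W10_dominated\<close> demands, while only \<open>0 \<le> L\<close> is known.\<close>
  have w_le': "AE x in M. 0 \<le> w x \<and> w x \<le> (2 * L + 1) * max (u1 x - u2 x) 0"
    using w_le by eventually_elim (auto simp: distrib_right)
  show "w \<in> W10 \<phi> \<Omega>"
    by (rule W10_dominated[OF bd wO wG Gwi _ w_le']) (use L_nonneg in auto)
  show "AE x in M. weak_grad \<Omega> w x = ha (u1 x, min (u1 x) (u2 x)) *\<^sub>R weak_grad \<Omega> u1 x
       + hb (u1 x, min (u1 x) (u2 x)) *\<^sub>R (if u1 x > u2 x then weak_grad \<Omega> u2 x else weak_grad \<Omega> u1 x)"
    using weak_grad_eq[OF open_\<Omega> wG] by eventually_elim (simp add: Gw_def G_def H_def v_def)
qed

end

text \<open>The test functions $(a^l - b^l)/a^{l-1}$ and $(a^l - b^l)/b^{l-1}$, where $a = u_1$ and $b = \min(u_1,u_2)$,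
  are written as \<open>a - b powr l * a powr (1 - l)\<close> and \<open>a powr l * b powr (1 - l) - b\<close>.\<close>

lemma ratio_powr_deriv:
  fixes a b l :: real
  assumes "0 < a" "0 < b"
  shows "((\<lambda>q. snd q powr l * fst q powr (1 - l)) has_derivative
    (\<lambda>z. (1 - l) * (b powr l * a powr (1 - l)) / a * fst z + l * (b powr l * a powr (1 - l)) / b * snd z)) (at (a, b))"
    "((\<lambda>q. fst q powr l * snd q powr (1 - l)) has_derivative
    (\<lambda>z. l * (a powr l * b powr (1 - l)) / a * fst z + (1 - l) * (a powr l * b powr (1 - l)) / b * snd z)) (at (a, b))"
  using assms by (auto intro!: derivative_eq_intros simp: field_simps)

text \<open>Every expression is homogeneous; after division by \<open>a\<close> or \<open>b\<close>
  it is a power of \<open>b / a\<close>, at most 1, or of \<open>a / b\<close>, between 1 and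
  \<open>K\<close>.\<close>

lemma ratio_powr_bounds:
  fixes a b l K :: real
  assumes "(a, b) \<in> ratio_cone K" "l > 1"
  shows "b powr l * a powr (1 - l) / a \<le> 1" "b powr l * a powr (1 - l) / b \<le> 1" "b powr l * a powr (1 - l) \<le> a"
    "a powr l * b powr (1 - l) / a \<le> K powr (l - 1)" "a powr l * b powr (1 - l) / b \<le> K powr l" "b \<le> a powr l * b powr (1 - l)"
proof -
  have ab: "0 < a" "0 < b" "b \<le> a" "a \<le> K * b" using assms by (auto simp: ratio_cone_def)
  have 1: "b powr l * a powr (1 - l) / a = (b / a) powr l"
    using ab by (simp add: powr_diff powr_divide)
  have 2: "b powr l * a powr (1 - l) / b = (b / a) powr (l - 1)"
    using ab by (simp add: powr_diff powr_divide)
  have 3: "a powr l * b powr (1 - l) / a = (a / b) powr (l - 1)"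
    using ab by (simp add: powr_diff powr_divide)
  have 4: "a powr l * b powr (1 - l) / b = (a / b) powr l"
    using ab by (simp add: powr_diff powr_divide)
  have ba: "b / a \<le> 1" "0 \<le> b / a" "1 \<le> a / b" "a / b \<le> K" using ab by (auto simp: divide_le_eq)
  show "b powr l * a powr (1 - l) / a \<le> 1" unfolding 1 using ba assms(2) by (intro powr_le1) auto
  then show "b powr l * a powr (1 - l) \<le> a" using ab by (simp add: divide_le_eq)
  show "b powr l * a powr (1 - l) / b \<le> 1" unfolding 2 using ba assms(2) by (intro powr_le1) auto
  show "a powr l * b powr (1 - l) / a \<le> K powr (l - 1)" unfolding 3 using ba assms(2) by (intro powr_mono2) auto
  show "a powr l * b powr (1 - l) / b \<le> K powr l" unfolding 4 using ba assms(2) by (intro powr_mono2) auto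
  have "1 \<le> a powr l * b powr (1 - l) / b" unfolding 4 using ba assms(2) by (intro ge_one_powr_ge_zero) auto
  then show "b \<le> a powr l * b powr (1 - l)" using ab by (simp add: le_divide_eq)
qed

lemma borel_measurable_fst_snd_real [measurable]:
  "(fst :: real \<times> real \<Rightarrow> real) \<in> borel_measurable borel"
  "(snd :: real \<times> real \<Rightarrow> real) \<in> borel_measurable borel"
  by (intro borel_measurable_continuous_onI continuous_intros)+

text \<open>The partial derivatives are \<open>1 + (l - 1) * (b / a) powr l\<close> and
  \<open>- l * (b / a) powr (l - 1)\<close>; as \<open>b \<le> a\<close>, both are at most
  \<open>l\<close> in absolute value.\<close>

lemma ratio_function_sub:
  assumes l: "l > 1" and K: "K \<ge> 1"
  shows "ratio_function (\<lambda>q. fst q - snd q powr l * fst q powr (1 - l))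
    (\<lambda>q. 1 + (l - 1) * (snd q powr l * fst q powr (1 - l) / fst q))
    (\<lambda>q. - (l * (snd q powr l * fst q powr (1 - l) / snd q))) K l"
proof
  fix q :: "real \<times> real"
  {
    assume q: "0 < fst q" "0 < snd q"
    from has_derivative_diff[OF has_derivative_fst[OF has_derivative_ident] ratio_powr_deriv(1)[OF q, of l]]
    show "((\<lambda>q. fst q - snd q powr l * fst q powr (1 - l)) has_derivative
      (\<lambda>z. (1 + (l - 1) * (snd q powr l * fst q powr (1 - l) / fst q)) * fst z + - (l * (snd q powr l * fst q powr (1 - l) / snd q)) * snd z)) (at q)"
      by (simp add: algebra_simps diff_divide_distrib add_divide_distrib)
    show "isCont (\<lambda>q. 1 + (l - 1) * (snd q powr l * fst q powr (1 - l) / fst q)) q"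
      "isCont (\<lambda>q. - (l * (snd q powr l * fst q powr (1 - l) / snd q))) q"
      using q by (auto intro!: continuous_intros)
  next
    assume q: "q \<in> ratio_cone K"
    have pos: "0 < fst q" "0 < snd q" using q by (auto simp: ratio_cone_def)
    note b = ratio_powr_bounds[of "fst q" "snd q" K l, unfolded prod.collapse, OF q l]
    have "0 \<le> (l - 1) * (snd q powr l * fst q powr (1 - l) / fst q)" using l pos by simp
    moreover have "(l - 1) * (snd q powr l * fst q powr (1 - l) / fst q) \<le> (l - 1) * 1" using l b(1) by (intro mult_left_mono) auto
    moreover have "0 \<le> t \<Longrightarrow> t \<le> (l - 1) * 1 \<Longrightarrow> \<bar>1 + t\<bar> \<le> l" for t by auto
    ultimately show "\<bar>1 + (l - 1) * (snd q powr l * fst q powr (1 - l) / fst q)\<bar> \<le> l" by blast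
    have "0 \<le> l * (snd q powr l * fst q powr (1 - l) / snd q)" using l pos by simp
    moreover have "l * (snd q powr l * fst q powr (1 - l) / snd q) \<le> l * 1" using l b(2) by (intro mult_left_mono) auto
    ultimately show "\<bar>- (l * (snd q powr l * fst q powr (1 - l) / snd q))\<bar> \<le> l" by linarith
    show "0 \<le> fst q - snd q powr l * fst q powr (1 - l)" using b(3) by simp
  }
  show "fst (b, b) - snd (b, b) powr l * fst (b, b) powr (1 - l) = 0" if "0 < b" for b :: real
    using that by (simp add: powr_add[symmetric])
  show "(\<lambda>q. fst q - snd q powr l * fst q powr (1 - l)) \<in> borel_measurable (borel :: (real \<times> real) measure)"
    "(\<lambda>q. 1 + (l - 1) * (snd q powr l * fst q powr (1 - l) / fst q)) \<in> borel_measurable (borel :: (real \<times> real) measure)"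
    "(\<lambda>q. - (l * (snd q powr l * fst q powr (1 - l) / snd q))) \<in> borel_measurable (borel :: (real \<times> real) measure)"
    by measurable
qed (rule K)

text \<open>Here powers of \<open>a / b\<close> occur, and the bound on the quotient becomes
  essential. The partial derivatives are at most \<open>l * K powr (l - 1)\<close> and
  \<open>(l - 1) * K powr l + 1\<close> in absolute value, and the stated constant exceeds
  both.\<close>

lemma ratio_function_super:
  assumes l: "l > 1" and K: "K \<ge> 1"
  shows "ratio_function (\<lambda>q. fst q powr l * snd q powr (1 - l) - snd q)
    (\<lambda>q. l * (fst q powr l * snd q powr (1 - l) / fst q))
    (\<lambda>q. - ((l - 1) * (fst q powr l * snd q powr (1 - l) / snd q) + 1)) K (l * K powr l + 1)"
proof
  fix q :: "real \<times> real"
  {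
    assume q: "0 < fst q" "0 < snd q"
    from has_derivative_diff[OF ratio_powr_deriv(2)[OF q, of l] has_derivative_snd[OF has_derivative_ident]]
    show "((\<lambda>q. fst q powr l * snd q powr (1 - l) - snd q) has_derivative
      (\<lambda>z. l * (fst q powr l * snd q powr (1 - l) / fst q) * fst z + - ((l - 1) * (fst q powr l * snd q powr (1 - l) / snd q) + 1) * snd z)) (at q)"
      by (simp add: algebra_simps diff_divide_distrib add_divide_distrib)
    show "isCont (\<lambda>q. l * (fst q powr l * snd q powr (1 - l) / fst q)) q"
      "isCont (\<lambda>q. - ((l - 1) * (fst q powr l * snd q powr (1 - l) / snd q) + 1)) q"
      using q by (auto intro!: continuous_intros)
  next
    assume q: "q \<in> ratio_cone K"
    have pos: "0 < fst q" "0 < snd q" using q by (auto simp: ratio_cone_def)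
    note b = ratio_powr_bounds[of "fst q" "snd q" K l, unfolded prod.collapse, OF q l]
    have KK: "K powr (l - 1) \<le> K powr l" using K by (intro powr_mono) auto
    have Kl: "0 \<le> K powr l" by simp
    have "0 \<le> l * (fst q powr l * snd q powr (1 - l) / fst q)" using l pos by simp
    moreover have "l * (fst q powr l * snd q powr (1 - l) / fst q) \<le> l * K powr l" using l b(4) KK by (intro mult_left_mono) auto
    ultimately show "\<bar>l * (fst q powr l * snd q powr (1 - l) / fst q)\<bar> \<le> l * K powr l + 1" by linarith
    have "0 \<le> (l - 1) * (fst q powr l * snd q powr (1 - l) / snd q)" using l pos by simp
    moreover have "(l - 1) * (fst q powr l * snd q powr (1 - l) / snd q) \<le> l * K powr l" using l b(5) Kl pos by (intro mult_mono) auto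
    ultimately show "\<bar>- ((l - 1) * (fst q powr l * snd q powr (1 - l) / snd q) + 1)\<bar> \<le> l * K powr l + 1" by linarith
    show "0 \<le> fst q powr l * snd q powr (1 - l) - snd q" using b(6) by simp
  }
  show "fst (b, b) powr l * snd (b, b) powr (1 - l) - snd (b, b) = 0" if "0 < b" for b :: real
    using that by (simp add: powr_add[symmetric])
  show "(\<lambda>q. fst q powr l * snd q powr (1 - l) - snd q) \<in> borel_measurable (borel :: (real \<times> real) measure)"
    "(\<lambda>q. l * (fst q powr l * snd q powr (1 - l) / fst q)) \<in> borel_measurable (borel :: (real \<times> real) measure)"
    "(\<lambda>q. - ((l - 1) * (fst q powr l * snd q powr (1 - l) / snd q) + 1)) \<in> borel_measurable (borel :: (real \<times> real) measure)"
    by measurable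
qed (rule K)

section \<open>Comparison\<close>

context young_function
begin

text \<open>Diaz-Saa type inequality. With $\phi(s) = s^{l-2} g(s)$, $g$ nondecreasing, Young's inequality bounds
  the difference below by $(g(A) - g(B)) (A^l - B^l)$, where $A$ and $B$ are the lengths of the vectors.\<close>

lemma flux_inequality:
  fixes x y :: "'a::euclidean_space" and a b :: real
  assumes ab: "0 < a" "0 < b"
  defines "E \<equiv> b powr l * a powr (1 - l)" and "F \<equiv> a powr l * b powr (1 - l)"
  shows "\<phi> (norm y) * (y \<bullet> ((l * (F / a)) *\<^sub>R x + (- ((l - 1) * (F / b) + 1)) *\<^sub>R y))
    \<le> \<phi> (norm x) * (x \<bullet> ((1 + (l - 1) * (E / a)) *\<^sub>R x + (- (l * (E / b))) *\<^sub>R y))"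
proof -
  have l: "1 < l" by (rule l_gt)
  have EF: "0 < E" "0 < F" using ab by (auto simp: E_def F_def)
  let ?A = "norm x" and ?B = "norm y"
  \<comment> \<open>Zero vectors are treated apart: nothing is known about \<open>\<phi>\<close> at
    0, where it occurs only with a vanishing factor.\<close>
  consider "x = 0" | "x \<noteq> 0" "y = 0" | "x \<noteq> 0" "y \<noteq> 0" by blast
  then show ?thesis
  proof cases
    case 1
    have "0 \<le> \<phi> ?B * (((l - 1) * (F / b) + 1) * (y \<bullet> y))"
    proof (cases "y = 0")
      case False
      then show ?thesis using phi_pos[of ?B] l EF ab by (intro mult_nonneg_nonneg) auto
    qed simp
    then show ?thesis using 1 by (simp add: inner_add_right algebra_simps)
  next
    case 2
    have "0 \<le> \<phi> ?A * ((1 + (l - 1) * (E / a)) * (x \<bullet> x))"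
      using 2 phi_pos[of ?A] l EF ab by (intro mult_nonneg_nonneg) auto
    then show ?thesis using 2 by simp
  next
    case 3
    \<comment> \<open>With this \<open>g\<close>, which is nondecreasing on positive reals, the flux
      becomes a weight times pure powers of the lengths.\<close>
    define g where "g s = p s * s powr (1 - l)" for s
    have A: "0 < ?A" and B: "0 < ?B" using 3 by auto
    have g_pos: "0 < g ?A" "0 < g ?B" using A B p_pos by (auto simp: g_def)
    have phi_g: "\<phi> s * s\<^sup>2 = g s * s powr l" "\<phi> s * s = g s * s powr (l - 1)" if "0 < s" for s
    proof -
      have "g s * s powr l = p s * (s powr (1 - l) * s powr l)" by (simp add: g_def mult.assoc)
      also have "s powr (1 - l) * s powr l = s" using that by (simp add: powr_add[symmetric])
      finally show "\<phi> s * s\<^sup>2 = g s * s powr l" using that by (simp add: p_def power2_eq_square)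
      have "g s * s powr (l - 1) = p s * (s powr (1 - l) * s powr (l - 1))" by (simp add: g_def mult.assoc)
      also have "s powr (1 - l) * s powr (l - 1) = 1" using that by (simp add: powr_add[symmetric])
      finally show "\<phi> s * s = g s * s powr (l - 1)" using that by (simp add: p_def)
    qed
    have Er: "E / a = (b / a) powr l" "E / b = (b / a) powr (l - 1)" "F / a = (a / b) powr (l - 1)" "F / b = (a / b) powr l"
      using ab by (simp_all add: E_def F_def powr_diff powr_divide)
    have xy: "x \<bullet> y \<le> ?A * ?B" by (rule norm_cauchy_schwarz)
    have lower: "g ?A * (?A powr l - ?B powr l) \<le> \<phi> ?A * (x \<bullet> ((1 + (l - 1) * (E / a)) *\<^sub>R x + (- (l * (E / b))) *\<^sub>R y))"
    proof -
      \<comment> \<open>Young's inequality at the rescaled length \<open>(b / a) * norm x\<close>: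
        the term with factor \<open>l - 1\<close> is exactly the one in the gradient of the test
        function, so the quotient \<open>b / a\<close> disappears.\<close>
      have Y: "l * ((b / a) * ?A) powr (l - 1) * ?B \<le> (l - 1) * ((b / a) * ?A) powr l + ?B powr l"
        using A B ab l by (intro Youngs_inequality_powr) auto
      have P: "((b / a) * ?A) powr k = (b / a) powr k * ?A powr k" for k by (rule powr_mult)
      have "g ?A * (?A powr l - ?B powr l) \<le> g ?A * (?A powr l + (l - 1) * ((b / a) powr l * ?A powr l) - l * ((b / a) powr (l - 1) * ?A powr (l - 1)) * ?B)"
        using Y[unfolded P] g_pos by (intro mult_left_mono) linarith+
      also have "\<dots> = (1 + (l - 1) * (E / a)) * (g ?A * ?A powr l) - l * (E / b) * (g ?A * ?A powr (l - 1)) * ?B"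
        unfolding Er by (simp add: algebra_simps)
      also have "\<dots> = (1 + (l - 1) * (E / a)) * (\<phi> ?A * ?A\<^sup>2) - l * (E / b) * (\<phi> ?A * ?A) * ?B"
        by (simp only: phi_g[OF A])
      also have "\<dots> = \<phi> ?A * ((1 + (l - 1) * (E / a)) * (x \<bullet> x) - l * (E / b) * (?A * ?B))"
        by (simp add: power2_norm_eq_inner algebra_simps)
      also have "\<dots> \<le> \<phi> ?A * ((1 + (l - 1) * (E / a)) * (x \<bullet> x) - l * (E / b) * (x \<bullet> y))"
        using phi_pos[OF A] xy l EF ab by (intro mult_left_mono diff_left_mono) auto
      also have "\<dots> = \<phi> ?A * (x \<bullet> ((1 + (l - 1) * (E / a)) *\<^sub>R x + (- (l * (E / b))) *\<^sub>R y))"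
        by (simp only: inner_add_right inner_scaleR_right) simp
      finally show ?thesis .
    qed
    have upper: "\<phi> ?B * (y \<bullet> ((l * (F / a)) *\<^sub>R x + (- ((l - 1) * (F / b) + 1)) *\<^sub>R y)) \<le> g ?B * (?A powr l - ?B powr l)"
    proof -
      \<comment> \<open>The mirror image, with the roles of the vectors exchanged and the quotient
        inverted.\<close>
      have Y: "l * ((a / b) * ?B) powr (l - 1) * ?A \<le> (l - 1) * ((a / b) * ?B) powr l + ?A powr l"
        using A B ab l by (intro Youngs_inequality_powr) auto
      have P: "((a / b) * ?B) powr k = (a / b) powr k * ?B powr k" for k by (rule powr_mult)
      have "\<phi> ?B * (y \<bullet> ((l * (F / a)) *\<^sub>R x + (- ((l - 1) * (F / b) + 1)) *\<^sub>R y))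
        = \<phi> ?B * (l * (F / a) * (x \<bullet> y) - ((l - 1) * (F / b) + 1) * (y \<bullet> y))"
        by (simp only: inner_add_right inner_scaleR_right inner_commute[of y x] mult_minus_left add_uminus_conv_diff)
      also have "\<dots> \<le> \<phi> ?B * (l * (F / a) * (?A * ?B) - ((l - 1) * (F / b) + 1) * (y \<bullet> y))"
        using phi_pos[OF B] xy l EF ab by (intro mult_left_mono diff_right_mono) auto
      also have "\<dots> = l * (F / a) * (\<phi> ?B * ?B) * ?A - ((l - 1) * (F / b) + 1) * (\<phi> ?B * ?B\<^sup>2)"
        by (simp add: power2_norm_eq_inner algebra_simps)
      also have "\<dots> = l * (F / a) * (g ?B * ?B powr (l - 1)) * ?A - ((l - 1) * (F / b) + 1) * (g ?B * ?B powr l)"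
        by (simp only: phi_g[OF B])
      also have "\<dots> = g ?B * (l * ((a / b) powr (l - 1) * ?B powr (l - 1)) * ?A - (l - 1) * ((a / b) powr l * ?B powr l) - ?B powr l)"
        unfolding Er by (simp add: algebra_simps)
      also have "\<dots> \<le> g ?B * (?A powr l - ?B powr l)"
        using Y[unfolded P] g_pos by (intro mult_left_mono) linarith+
      finally show ?thesis .
    qed
    \<comment> \<open>Both factors are nondecreasing functions of the length, so they have the same
      sign.\<close>
    have "0 \<le> (g ?A - g ?B) * (?A powr l - ?B powr l)"
    proof (cases "?A \<le> ?B")
      case True
      then have "g ?A \<le> g ?B" unfolding g_def by (rule p_powr_mono[OF A])
      moreover have "?A powr l \<le> ?B powr l" using True l by (intro powr_mono2) auto
      ultimately show ?thesis by (intro mult_nonpos_nonpos) auto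
    next
      case False
      then have BA: "?B \<le> ?A" by simp
      then have "g ?B \<le> g ?A" unfolding g_def by (rule p_powr_mono[OF B])
      moreover have "?B powr l \<le> ?A powr l" using BA l by (intro powr_mono2) auto
      ultimately show ?thesis by (intro mult_nonneg_nonneg) auto
    qed
    then have "g ?B * (?A powr l - ?B powr l) \<le> g ?A * (?A powr l - ?B powr l)" by (simp add: left_diff_distrib)
    with lower upper show ?thesis by linarith
  qed
qed

end

context young_domain
begin

section \<open>Integrability of the flux and conclusion\<close>

lemma Orlicz_norm:
  assumes "\<And>i. i \<in> Basis \<Longrightarrow> (\<lambda>x. G x \<bullet> i) \<in> Orlicz \<phi> \<Omega>"
  shows "G \<in> borel_measurable M" "(\<lambda>x. norm (G x)) \<in> Orlicz \<phi> \<Omega>"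
proof -
  show Gm: "G \<in> borel_measurable M"
    using assms by (subst borel_measurable_euclidean_space) (auto simp: Orlicz_iff)
  have sumO: "(\<lambda>x. \<Sum>i\<in>S. \<bar>G x \<bullet> i\<bar>) \<in> Orlicz \<phi> \<Omega>" if "finite S" "S \<subseteq> Basis" for S
    using that
  proof (induction S rule: finite_induct)
    case empty
    then show ?case using bounded_Orlicz[of "\<lambda>_. 0" 0] by simp
  next
    case (insert i S)
    then have "(\<lambda>x. \<bar>G x \<bullet> i\<bar> + (\<Sum>i\<in>S. \<bar>G x \<bullet> i\<bar>)) \<in> Orlicz \<phi> \<Omega>"
      by (intro Orlicz_add(1) Orlicz_abs assms) auto
    then show ?case using insert by simp
  qed
  show "(\<lambda>x. norm (G x)) \<in> Orlicz \<phi> \<Omega>"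
  proof (rule Orlicz_dominated[OF sumO[OF finite_Basis order_refl]])
    show "(\<lambda>x. norm (G x)) \<in> borel_measurable M" using Gm borel_measurable_norm by (rule measurable_compose)
    show "AE x in M. \<bar>norm (G x)\<bar> \<le> \<bar>\<Sum>i\<in>Basis. \<bar>G x \<bullet> i\<bar>\<bar>"
      using norm_le_l1 by (intro AE_I2) (auto intro: order_trans)
  qed
qed

text \<open>By Cauchy-Schwarz the integrand is at most \<open>p A * B\<close> for the two gradient
  lengths \<open>A\<close> and \<open>B\<close>, and this is controlled by
  \<open>Phi \<phi> A\<close> and \<open>Phi \<phi> B\<close>. The Bochner integral of a
  nonintegrable function is 0 by convention, so integrability is required before integrands are
  compared.\<close>

lemma flux_integrable:
  assumes u: "u \<in> W1 \<phi> \<Omega>" and w: "w \<in> W1 \<phi> \<Omega>"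
  shows "integrable M (\<lambda>x. \<phi> (norm (weak_grad \<Omega> u x)) * (weak_grad \<Omega> u x \<bullet> weak_grad \<Omega> w x))"
proof -
  let ?G = "weak_grad \<Omega> u" and ?H = "weak_grad \<Omega> w"
  have G: "?G \<in> borel_measurable M" "(\<lambda>x. norm (?G x)) \<in> Orlicz \<phi> \<Omega>"
    by (rule Orlicz_norm, erule W1D(3)[OF u])+
  have H: "?H \<in> borel_measurable M" "(\<lambda>x. norm (?H x)) \<in> Orlicz \<phi> \<Omega>"
    by (rule Orlicz_norm, erule W1D(3)[OF w])+
  have nG: "(\<lambda>x. norm (?G x)) \<in> borel_measurable M" using G(2) by (simp add: Orlicz_iff)
  have p_meas: "p \<in> borel_measurable borel"
    by (intro borel_measurable_continuous_onI continuous_at_imp_continuous_on ballI p_isCont)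
  \<comment> \<open>\<open>p\<close> is continuous and hence measurable on the whole line, whereas
    \<open>\<phi>\<close> is arbitrary at nonpositive arguments; at a vanishing gradient both sides
    are 0.\<close>
  have eq: "\<phi> (norm (?G x)) * (?G x \<bullet> ?H x) = p (norm (?G x)) / norm (?G x) * (?G x \<bullet> ?H x)" for x
    by (cases "?G x = 0") (auto simp: p_def)
  have bound: "\<bar>p (norm (?G x)) / norm (?G x) * (?G x \<bullet> ?H x)\<bar> \<le> m * (Phi \<phi> (norm (?G x)) + Phi \<phi> (norm (?H x)))" for x
  proof (cases "?G x = 0")
    case True
    then show ?thesis using m_gt Phi_nonneg by simp
  next
    case False
    let ?A = "norm (?G x)" and ?B = "norm (?H x)"
    have A: "0 < ?A" using False by simp
    have p0: "0 \<le> p ?A" "0 \<le> p ?B" using p_mono[of 0 ?A] p_mono[of 0 ?B] by auto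
    have "\<bar>p ?A / ?A * (?G x \<bullet> ?H x)\<bar> \<le> p ?A / ?A * (?A * ?B)"
      unfolding abs_mult using p0 A Cauchy_Schwarz_ineq2[of "?G x" "?H x"] by (intro mult_mono) auto
    also have "\<dots> = p ?A * ?B" using A by simp
    \<comment> \<open>Replacing the smaller of the two lengths by the larger one gives a term of the
      form \<open>t * p t\<close>, which \<open>mult_p_le_Phi\<close> bounds.\<close>
    also have "\<dots> \<le> ?A * p ?A + ?B * p ?B"
    proof (cases "?A \<le> ?B")
      case True
      then have "p ?A * ?B \<le> p ?B * ?B" using p_mono by (intro mult_right_mono) auto
      then show ?thesis using p0 A by (simp add: mult.commute add_increasing)
    next
      case False
      then have "p ?A * ?B \<le> p ?A * ?A" using p0 by (intro mult_left_mono) auto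
      then show ?thesis using p0 by (simp add: mult.commute add_increasing2)
    qed
    also have "\<dots> \<le> m * Phi \<phi> ?A + m * Phi \<phi> ?B" by (intro add_mono mult_p_le_Phi)
    finally show ?thesis by (simp add: distrib_left)
  qed
  show ?thesis
    unfolding eq
  proof (rule Bochner_Integration.integrable_bound)
    show "integrable M (\<lambda>x. m * (Phi \<phi> (norm (?G x)) + Phi \<phi> (norm (?H x))))"
      using G(2) H(2) by (simp add: Orlicz_iff)
    have "(\<lambda>x. p (norm (?G x))) \<in> borel_measurable M"
      by (rule measurable_compose[OF nG p_meas])
    then show "(\<lambda>x. p (norm (?G x)) / norm (?G x) * (?G x \<bullet> ?H x)) \<in> borel_measurable M"
      by (intro borel_measurable_times borel_measurable_divide nG borel_measurable_inner G(1) H(1))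
    show "AE x in M. norm (p (norm (?G x)) / norm (?G x) * (?G x \<bullet> ?H x)) \<le> norm (m * (Phi \<phi> (norm (?G x)) + Phi \<phi> (norm (?H x))))"
      using bound by (intro AE_I2) (auto intro: order_trans[OF _ abs_ge_self])
  qed
qed

lemma weak_comparison:
  assumes f: "AE x in M. strict_antimono_on {0<..} (\<lambda>t. f x t / t powr (l - 1))"
    and sub: "subsolution \<phi> f \<Omega> u1" and super: "supersolution \<phi> f \<Omega> u2"
    and ratio: "(\<lambda>x. u1 x / u2 x) \<in> Linf \<Omega>" and bd: "le_on_boundary \<phi> \<Omega> u1 u2"
  shows "AE x in M. u1 x \<le> u2 x"
proof -
  have u1: "u1 \<in> W1 \<phi> \<Omega>" "AE x in M. 0 < u1 x" using sub by (auto simp: subsolution_def)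
  have u2: "u2 \<in> W1 \<phi> \<Omega>" "AE x in M. 0 < u2 x" using super by (auto simp: supersolution_def)
  obtain C where C: "AE x in M. \<bar>u1 x / u2 x\<bar> \<le> C" using ratio by (auto simp: Linf_def)
  \<comment> \<open>The maximum with 1 keeps the diagonal, and with it all points where
    \<open>u1 x \<le> u2 x\<close>, inside the cone.\<close>
  define K where "K = max 1 C"
  have K1: "1 \<le> K" by (simp add: K_def)
  have K: "AE x in M. u1 x \<le> K * u2 x"
    using C u1(2) u2(2)
  proof eventually_elim
    case (elim x)
    then have "u1 x / u2 x \<le> K" by (simp add: K_def)
    then show ?case using elim(3) by (simp add: divide_le_eq)
  qed
  have bd': "(\<lambda>x. max (u1 x - u2 x) 0) \<in> W10 \<phi> \<Omega>" using bd by (simp add: le_on_boundary_def)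
  let ?v = "\<lambda>x. min (u1 x) (u2 x)"
  define w1 where "w1 x = u1 x - ?v x powr l * u1 x powr (1 - l)" for x
  define w2 where "w2 x = u1 x powr l * ?v x powr (1 - l) - ?v x" for x
  have w1_eq: "w1 = (\<lambda>x. (\<lambda>q. fst q - snd q powr l * fst q powr (1 - l)) (u1 x, ?v x))" by (simp add: w1_def[abs_def])
  have w2_eq: "w2 = (\<lambda>x. (\<lambda>q. fst q powr l * snd q powr (1 - l) - snd q) (u1 x, ?v x))" by (simp add: w2_def[abs_def])
  note t1 = ratio_test_function[OF ratio_function_sub[OF l_gt K1] u1(1) u2(1) u1(2) u2(2) K bd', folded w1_eq]
  note t2 = ratio_test_function[OF ratio_function_super[OF l_gt K1] u1(1) u2(1) u1(2) u2(2) K bd', folded w2_eq]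
  have w1W: "w1 \<in> W1 \<phi> \<Omega>" and w2W: "w2 \<in> W1 \<phi> \<Omega>" using t1(1) t2(1) by (auto simp: W10_def)
  have w1n: "AE x in M. 0 \<le> w1 x" using t1(2) by eventually_elim (simp add: w1_def)
  have w2n: "AE x in M. 0 \<le> w2 x" using t2(2) by eventually_elim (simp add: w2_def)
  have s1: "integrable M (\<lambda>x. f x (u1 x) * w1 x)" "Phi_Laplace \<phi> \<Omega> u1 w1 \<le> (\<integral>x. f x (u1 x) * w1 x \<partial>M)"
    using sub[unfolded subsolution_def, THEN conjunct2, THEN conjunct2, THEN bspec, OF t1(1), THEN mp, OF w1n]
    by (rule conjunct1, rule conjunct2)
  have s2: "integrable M (\<lambda>x. f x (u2 x) * w2 x)" "(\<integral>x. f x (u2 x) * w2 x \<partial>M) \<le> Phi_Laplace \<phi> \<Omega> u2 w2"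
    using super[unfolded supersolution_def, THEN conjunct2, THEN conjunct2, THEN bspec, OF t2(1), THEN mp, OF w2n]
    by (rule conjunct1, rule conjunct2)
  have flux: "Phi_Laplace \<phi> \<Omega> u2 w2 \<le> Phi_Laplace \<phi> \<Omega> u1 w1"
    unfolding Phi_Laplace_def
  proof (rule integral_mono_AE[OF flux_integrable[OF u2(1) w2W] flux_integrable[OF u1(1) w1W]])
    show "AE x in M. \<phi> (norm (weak_grad \<Omega> u2 x)) * (weak_grad \<Omega> u2 x \<bullet> weak_grad \<Omega> w2 x)
      \<le> \<phi> (norm (weak_grad \<Omega> u1 x)) * (weak_grad \<Omega> u1 x \<bullet> weak_grad \<Omega> w1 x)"
      using t1(3) t2(3) u1(2) u2(2)
    proof eventually_elim
      case (elim x)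
      show ?case
      proof (cases "u2 x < u1 x")
        case True
        then have v: "?v x = u2 x" by simp
        show ?thesis
          using flux_inequality[OF elim(3,4), of "weak_grad \<Omega> u2 x" "weak_grad \<Omega> u1 x"] True
          unfolding elim(1,2) v by simp
      next
        case False
        then have v: "?v x = u1 x" by simp
        have E: "u1 x powr l * u1 x powr (1 - l) / u1 x = 1" using elim(3) by (simp add: powr_add[symmetric])
        \<comment> \<open>Both arguments of the test functions coincide here, all quotients equal 1,
          and the coefficients \<open>1 + (l - 1)\<close> and \<open>- l\<close>, respectively
          \<open>l\<close> and \<open>- l\<close>, act on the same gradient.\<close>
        have "weak_grad \<Omega> w1 x = 0" "weak_grad \<Omega> w2 x = 0"
          unfolding elim(1,2) v using False by (simp_all add: E scaleR_left_distrib[symmetric])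
        then show ?thesis by simp
      qed
    qed
  qed
  let ?d = "\<lambda>x. f x (u2 x) * w2 x - f x (u1 x) * w1 x"
  \<comment> \<open>The sign is recorded together with the case of equality: the flux inequality
    forces the integral of \<open>?d\<close> to be at most 0, so \<open>?d\<close> vanishes almost
    everywhere, and by strict decrease this happens only where
    \<open>u1 x \<le> u2 x\<close>.\<close>
  have d_sign: "AE x in M. 0 \<le> ?d x \<and> (?d x = 0 \<longrightarrow> u1 x \<le> u2 x)"
    using f u1(2) u2(2)
  proof eventually_elim
    case (elim x)
    show ?case
    proof (cases "u2 x < u1 x")
      case True
      let ?a = "u1 x" and ?b = "u2 x"
      have v: "?v x = ?b" using True by simp
      have "f x ?a / ?a powr (l - 1) < f x ?b / ?b powr (l - 1)"
        using elim True by (auto simp: monotone_on_def)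
      then have fab: "f x ?a * ?a powr (1 - l) < f x ?b * ?b powr (1 - l)"
        by (simp add: powr_minus_divide[symmetric] divide_inverse powr_minus[symmetric])
      have "?b powr l < ?a powr l" using True elim l_gt by (intro powr_less_mono2) auto
      then have pos: "0 < (?a powr l - ?b powr l) * (f x ?b * ?b powr (1 - l) - f x ?a * ?a powr (1 - l))"
        using fab by (intro mult_pos_pos) auto
      have w12: "w1 x = (?a powr l - ?b powr l) * ?a powr (1 - l)" "w2 x = (?a powr l - ?b powr l) * ?b powr (1 - l)"
      proof -
        have aa: "?a powr l * ?a powr (1 - l) = ?a" "?b powr l * ?b powr (1 - l) = ?b"
          using elim by (simp_all add: powr_add[symmetric])
        show "w1 x = (?a powr l - ?b powr l) * ?a powr (1 - l)" "w2 x = (?a powr l - ?b powr l) * ?b powr (1 - l)"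
          unfolding w1_def w2_def v left_diff_distrib aa by simp_all
      qed
      \<comment> \<open>The common weight factors out, leaving exactly the difference of the two
        decreasing quotients.\<close>
      have "?d x = (?a powr l - ?b powr l) * (f x ?b * ?b powr (1 - l) - f x ?a * ?a powr (1 - l))"
        unfolding w12 by (simp only: right_diff_distrib mult_ac)
      with pos show ?thesis by linarith
    next
      case False
      then have v: "?v x = u1 x" by simp
      have E: "u1 x powr l * u1 x powr (1 - l) = u1 x" using elim by (simp add: powr_add[symmetric])
      have "w1 x = 0" "w2 x = 0" unfolding w1_def w2_def v E by simp_all
      then show ?thesis using False by simp
    qed
  qed
  have int_d: "integrable M ?d" using s1(1) s2(1) by simp
  have "(\<integral>x. ?d x \<partial>M) \<le> 0" using s1 s2 flux by simp
  moreover have nn: "AE x in M. 0 \<le> ?d x" using d_sign by eventually_elim simp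
  ultimately have "(\<integral>x. ?d x \<partial>M) = 0" using integral_nonneg_AE[OF nn] by linarith
  then have "AE x in M. ?d x = 0" using integral_nonneg_eq_0_iff_AE[OF int_d nn] by simp
  with d_sign show ?thesis by eventually_elim simp
qed

end

theorem theorem1p2:
  fixes \<Omega> :: "'a::euclidean_space set"
    and \<phi> :: "real \<Rightarrow> real" and l m :: real
    and f :: "'a \<Rightarrow> real \<Rightarrow> real"
    and u1 u2 :: "'a \<Rightarrow> real"
  assumes "smooth_bounded_domain \<Omega>"
    and "\<And>s. s > 0 \<Longrightarrow> \<phi> s > 0"
    and "\<phi> C1_differentiable_on {0<..}"
    and phi1: "((\<lambda>s. s * \<phi> s) \<longlongrightarrow> 0) (at_right 0)"
              "filterlim (\<lambda>s. s * \<phi> s) at_top at_top"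
    and phi2: "strict_mono_on {0<..} (\<lambda>s. s * \<phi> s)"
    and phi3: "1 < l" "l < DIM('a)" "1 < m" "m < DIM('a)"
              "\<And>s. s > 0 \<Longrightarrow> l - 1 \<le> deriv (\<lambda>s. s * \<phi> s) s / \<phi> s"
              "\<And>s. s > 0 \<Longrightarrow> deriv (\<lambda>s. s * \<phi> s) s / \<phi> s \<le> m - 1"
    and "Caratheodory \<Omega> f"
    and "AE x in lebesgue_on \<Omega>. strict_antimono_on {0<..} (\<lambda>t. f x t / t powr (l - 1))"
    and "subsolution \<phi> f \<Omega> u1"
    and "supersolution \<phi> f \<Omega> u2"
    and "(\<lambda>x. u1 x / u2 x) \<in> Linf \<Omega>"
    and "le_on_boundary \<phi> \<Omega> u1 u2"
  shows "AE x in lebesgue_on \<Omega>. u1 x \<le> u2 x"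
proof -
  interpret young_domain \<phi> l m \<Omega>
    by unfold_locales (use assms in \<open>auto simp: smooth_bounded_domain_def\<close>)
  show ?thesis by (rule weak_comparison) (use assms in auto)
qed

end
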